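(* Let $R>0$, and let $g$, $f$, $J$, $X$ be as in the context with $\Omega=B_R\subset\mathbb{R}^N$. Let $u\in C^1(\overline{B_R})$ with $u\ge0$, $u\not\equiv0$ be a weak solution of $$-\operatorname{div}\left(\frac{g(|\nabla u|)}{|\nabla u|}\nabla u\right)=f(u)\ \text{ in }B_R,\qquad u=0\ \text{ on }\partial B_R,$$ and suppose that $u$ is also a global minimizer for $J$ in $X$. Then $u$ is positive in $B_R$, radially symmetric and radially non-increasing, i.e. there is a non-increasing function $U\in C^1[0,R]$ with $u(x)=U(|x|)$ for all $x\in B_R$. Moreover, there is a number $R'\in[0,R)$ such that $U'(r)<0$ for $r\in(R',R)$ and $U$ is constant on $[0,R']$.
   Context: $B_R$ is the open ball in $\mathbb{R}^N$ of radius $R$ centred at the origin. Standing assumptions: $g\in C[0,+\infty)\cap C^1(0,+\infty)$, $g(0)=0$, $g$ strictly increasing; $f\in C[0,+\infty)$. Put $G(t):=\int_0^t g(s)\,ds$ and $F(t):=\int_0^t f(s)\,ds$ for $t\in[0,+\infty)$. Convention: $\frac{g(|y|)}{|y|}y=0$ if $y=0$. Weak solution means solution in the sense of distributions. For a bounded domain $\Omega\subset\mathbb{R}^N$ with $C^1$-boundary, $X:=\{v\in C^1(\overline\Omega): v=0\text{ on }\partial\Omega\}$ and $$J(v):=\int_\Omega\big(G(|\nabla v|)-F(v)\big)\,dx,\quad v\in X.$$ $u$ is a global minimizer for $J$ in $X$ if $u\in X$ and $J(u)\le J(v)$ for all $v\in X$. *)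

theory Defs
  imports "HOL-Analysis.Analysis"
begin

definition grad :: "(real ^ 'n \<Rightarrow> real) \<Rightarrow> real ^ 'n \<Rightarrow> real ^ 'n" where
  "grad v x = (THE d. GDERIV v x :> d)"

lemma grad_eqI:
  assumes "GDERIV v x :> d"
  shows "grad v x = d"
  unfolding grad_def
proof (rule the_equality)
  fix e assume "GDERIV v x :> e"
  with assms have "(\<lambda>h. h \<bullet> d) = (\<lambda>h. h \<bullet> e)"
    unfolding gderiv_def by (rule has_derivative_unique)
  then show "e = d"
    by (metis inner_commute vector_eq_rdot)
qed (rule assms)

text \<open>\<open>C\<^sup>1(closure \<Omega>)\<close>: the gradient exists in \<open>\<Omega>\<close> and has a continuous extension \<open>D\<close>
  to the closure. Elements are total functions; their values off the closure are irrelevant.\<close>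

definition C1_closure :: "(real ^ 'n) set \<Rightarrow> (real ^ 'n \<Rightarrow> real) set" where
  "C1_closure \<Omega> = {v. continuous_on (closure \<Omega>) v \<and>
     (\<exists>D. continuous_on (closure \<Omega>) D \<and> (\<forall>x\<in>\<Omega>. GDERIV v x :> D x))}"

definition X_space :: "(real ^ 'n) set \<Rightarrow> (real ^ 'n \<Rightarrow> real) set" where
  "X_space \<Omega> = {v \<in> C1_closure \<Omega>. \<forall>x\<in>frontier \<Omega>. v x = 0}"

definition primitive :: "(real \<Rightarrow> real) \<Rightarrow> real \<Rightarrow> real" where
  "primitive h t = integral {0..t} h"

definition J_functional ::
  "(real \<Rightarrow> real) \<Rightarrow> (real \<Rightarrow> real) \<Rightarrow> (real ^ 'n) set \<Rightarrow> (real ^ 'n \<Rightarrow> real) \<Rightarrow> real" where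
  "J_functional g f \<Omega> v =
     (LINT x:\<Omega>|lborel. primitive g (norm (grad v x)) - primitive f (v x))"

text \<open>Since \<open>f\<close> and hence \<open>F\<close> are given on \<open>[0,\<infinity>)\<close> only, \<open>J(v)\<close> has a meaning only for
  those \<open>v \<in> X\<close> with \<open>v \<ge> 0\<close>; these are the competitors. No values of \<open>f\<close> or \<open>F\<close> at
  negative arguments are ever used.\<close>

definition global_minimizer ::
  "(real \<Rightarrow> real) \<Rightarrow> (real \<Rightarrow> real) \<Rightarrow> (real ^ 'n) set \<Rightarrow> (real ^ 'n \<Rightarrow> real) \<Rightarrow> bool" where
  "global_minimizer g f \<Omega> u \<longleftrightarrow>
     u \<in> X_space \<Omega> \<and>
     (\<forall>v\<in>X_space \<Omega>. (\<forall>x\<in>\<Omega>. 0 \<le> v x) \<longrightarrow> J_functional g f \<Omega> u \<le> J_functional g f \<Omega> v)"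

text \<open>\<open>C\<^sup>k\<close> on the whole space, by recursion over the partial derivatives.\<close>

fun Ck :: "nat \<Rightarrow> (real ^ 'n \<Rightarrow> real) \<Rightarrow> bool" where
  "Ck 0 \<phi> \<longleftrightarrow> continuous_on UNIV \<phi>"
| "Ck (Suc k) \<phi> \<longleftrightarrow> \<phi> differentiable_on UNIV \<and>
     (\<forall>i. Ck k (\<lambda>x. frechet_derivative \<phi> (at x) (axis i 1)))"

definition test_function :: "(real ^ 'n) set \<Rightarrow> (real ^ 'n \<Rightarrow> real) \<Rightarrow> bool" where
  "test_function \<Omega> \<phi> \<longleftrightarrow> (\<forall>k. Ck k \<phi>) \<and>
     compact (closure {x. \<phi> x \<noteq> 0}) \<and> closure {x. \<phi> x \<noteq> 0} \<subseteq> \<Omega>"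

text \<open>By \<open>x / 0 = 0\<close> this is \<open>0\<close> at \<open>y = 0\<close>, as the convention requires.\<close>

definition flux :: "(real \<Rightarrow> real) \<Rightarrow> real ^ 'n \<Rightarrow> real ^ 'n" where
  "flux g y = (g (norm y) / norm y) *\<^sub>R y"

definition weak_solution ::
  "(real \<Rightarrow> real) \<Rightarrow> (real \<Rightarrow> real) \<Rightarrow> (real ^ 'n) set \<Rightarrow> (real ^ 'n \<Rightarrow> real) \<Rightarrow> bool" where
  "weak_solution g f \<Omega> u \<longleftrightarrow>
     (\<forall>\<phi>. test_function \<Omega> \<phi> \<longrightarrow>
        (LINT x:\<Omega>|lborel. flux g (grad u x) \<bullet> grad \<phi> x) = (LINT x:\<Omega>|lborel. f (u x) * \<phi> x))"

end

theory Submission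
  imports Defs
begin

text \<open>
  Reflect \<open>u\<close> at a hyperplane \<open>{x. x \<bullet> e = c}\<close> with \<open>c \<ge> 0\<close>.  Exchanging \<open>u\<close> for the minimum of \<open>u\<close> and its
  reflection on the cap \<open>{x. x \<bullet> e > c}\<close> does not change the energy, so this minimum is a Lipschitz limit of
  competitors with least energy and cannot have a kink.  At a point of the hyperplane this says that the
  derivative of \<open>u\<close> in direction \<open>e\<close> is at most 0.  Hence \<open>\<nabla>u(x) \<bullet> e \<le> 0\<close> whenever \<open>x \<bullet> e \<ge> 0\<close>, so that
  the gradient is radial and \<open>u\<close> decreases along rays; in dimension at least two \<open>u\<close> is then radial.

  Suppose the radial derivative vanishes at a point where \<open>u\<close> has a value \<open>c\<close> below its maximum.  Truncating at
  \<open>c\<close> shows that \<open>G(|\<nabla>u|) - (F(u) - F(c))\<close> has nonpositive integral over \<open>{u > c}\<close>.  Stretching the part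
  of the graph above \<open>c\<close> by a factor \<open>t > 1\<close> costs only \<open>o(t - 1)\<close> at the boundary, and comparing energies makes
  the integral of \<open>G(|\<nabla>u|)\<close> over \<open>{u > c}\<close> vanish, a contradiction.  So \<open>u\<close> is flat only at its maximum.

  In dimension one the absence of kinks also gives opposite slopes at two points with the same value, one on each
  side of the origin.  The inverses of the two branches of \<open>u\<close> then differ by a constant, which is zero.
\<close>

section \<open>Linear isometries and Lebesgue measure\<close>

text \<open>Competitors must be of class C^1, while minima, truncations and stretched graphs have
  kinks. They are reached as pointwise limits of C^1 cut-offs, and \<open>energy\<close> takes a
  function together with the limit of its gradients. For c \<ge> 0 the reflection maps the cap into
  the ball. As u is nonnegative and vanishes on the sphere, the minimum on the cap and the maximum
  on its mirror image are both admissible; the two energy changes are opposite and neither is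
  negative. Since f is merely continuous, comparison principles for the difference of u and its
  reflection are out of reach. Kinks are excluded by scaling instead: on a ball of radius r, up to
  the volume factor, the flux jump gains order r^3 and the Lipschitz bound for F costs only order
  r^4. In the stretching, convexity of G bounds the gradient term by t^(n-1) times the old one, the
  F-term scales like t^n, and truncation compares the two. In dimension one there are no tangential
  directions, so the sign of the slope gives no symmetry. Critical points are treated there before
  symmetry is known, by stretching from an endpoint of the interval.\<close>

lemma nn_integral_lborel_affine_euclidean:
  fixes f :: "'a::euclidean_space \<Rightarrow> ennreal"
  assumes [measurable]: "f \<in> borel_measurable borel" and "c \<noteq> 0"
  shows "(\<integral>\<^sup>+x. f x \<partial>lborel) = ennreal (\<bar>c\<bar> ^ DIM('a)) * (\<integral>\<^sup>+x. f (t + c *\<^sub>R x) \<partial>lborel)"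
  by (subst lborel_affine[OF \<open>c \<noteq> 0\<close>, of t])
     (simp add: nn_integral_density nn_integral_distr nn_integral_cmult)

text \<open>The change-of-variables theorems in \<open>HOL-Analysis\<close> need a well-ordered index type.  Here the
  image measure is compared with Lebesgue measure by Fubini, as in the uniqueness proof for Haar measure.\<close>

lemma lborel_distr_linear_isometry:
  fixes T :: "'a::euclidean_space \<Rightarrow> 'a"
  assumes lin: "linear T" and norm: "\<And>x. norm (T x) = norm x"
  shows "distr lborel borel T = lborel"
proof -
  have [measurable]: "T \<in> borel_measurable borel"
    using lin by (intro borel_measurable_continuous_onI linear_continuous_on linear_conv_bounded_linear[THEN iffD1])
  have "inj T"
    using lin norm by (metis linear_injective_0 norm_eq_zero)
  then have surj: "surj T"
    using lin linear_injective_imp_surjective by blast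
  \<comment> \<open>The unit ball is invariant under \<open>T\<close>. Its indicator serves as a
    weight in the double integral, and its finite nonzero integral is cancelled at the end.\<close>
  let ?h = "indicator (ball (0::'a) 1) :: 'a \<Rightarrow> ennreal"
  have [measurable]: "?h \<in> borel_measurable borel"
    by (auto intro!: borel_measurable_indicator)
  have hT: "?h (T x) = ?h x" for x
    by (simp add: indicator_def norm)
  show ?thesis
  proof (rule measure_eqI)
    fix A assume "A \<in> sets (distr lborel borel T)"
    then have [measurable]: "A \<in> sets borel" by simp
    let ?f = "indicator A :: 'a \<Rightarrow> ennreal"
    have shift: "(\<integral>\<^sup>+x. ?f (T x) \<partial>lborel) = (\<integral>\<^sup>+x. ?f (T x + y) \<partial>lborel)" for y
    proof -
      obtain z where z: "T z = y" using surj by (metis surjD)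
      show ?thesis
        by (subst nn_integral_lborel_affine_euclidean[where c=1 and t=z])
           (auto simp: linear_add[OF lin] z add.commute)
    qed
    have ref: "(\<integral>\<^sup>+x. ?h (y - T x) \<partial>lborel) = (\<integral>\<^sup>+x. ?h x \<partial>lborel)" for y
    proof -
      obtain z where z: "T z = y" using surj by (metis surjD)
      have "y - T x = T (z - x)" for x by (simp add: linear_diff[OF lin] z)
      then show ?thesis
        by (subst nn_integral_lborel_affine_euclidean[of ?h "-1" z])
           (auto simp: hT intro!: borel_measurable_indicator)
    qed
    have "(\<integral>\<^sup>+x. ?f (T x) \<partial>lborel) * (\<integral>\<^sup>+y. ?h y \<partial>lborel)
      = (\<integral>\<^sup>+y. (\<integral>\<^sup>+x. ?f (T x) \<partial>lborel) * ?h y \<partial>lborel)"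
      by (intro nn_integral_cmult[symmetric]) measurable
    also have "\<dots> = (\<integral>\<^sup>+y. (\<integral>\<^sup>+x. ?f (T x + y) \<partial>lborel) * ?h y \<partial>lborel)"
      by (intro nn_integral_cong) (simp add: shift[symmetric])
    also have "\<dots> = (\<integral>\<^sup>+y. (\<integral>\<^sup>+x. ?f (T x + y) * ?h y \<partial>lborel) \<partial>lborel)"
      by (intro nn_integral_cong nn_integral_multc[symmetric]) measurable
    also have "\<dots> = (\<integral>\<^sup>+x. (\<integral>\<^sup>+y. ?f (T x + y) * ?h y \<partial>lborel) \<partial>lborel)"
      by (intro lborel_pair.Fubini') (measurable)
    also have "\<dots> = (\<integral>\<^sup>+x. (\<integral>\<^sup>+y. ?f y * ?h (y - T x) \<partial>lborel) \<partial>lborel)"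
    proof (rule nn_integral_cong)
      fix x
      show "(\<integral>\<^sup>+y. ?f (T x + y) * ?h y \<partial>lborel) = (\<integral>\<^sup>+y. ?f y * ?h (y - T x) \<partial>lborel)"
        by (subst (2) nn_integral_lborel_affine_euclidean[where c=1 and t="T x"]) auto
    qed
    also have "\<dots> = (\<integral>\<^sup>+y. (\<integral>\<^sup>+x. ?f y * ?h (y - T x) \<partial>lborel) \<partial>lborel)"
      by (intro lborel_pair.Fubini') (measurable)
    also have "\<dots> = (\<integral>\<^sup>+y. ?f y * (\<integral>\<^sup>+x. ?h (y - T x) \<partial>lborel) \<partial>lborel)"
      by (intro nn_integral_cong nn_integral_cmult) measurable
    also have "\<dots> = (\<integral>\<^sup>+y. ?f y \<partial>lborel) * (\<integral>\<^sup>+y. ?h y \<partial>lborel)"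
      by (subst ref, intro nn_integral_multc) measurable
    finally have eq: "(\<integral>\<^sup>+x. ?f (T x) \<partial>lborel) * emeasure lborel (ball (0::'a) 1)
        = (\<integral>\<^sup>+y. ?f y \<partial>lborel) * emeasure lborel (ball (0::'a) 1)"
      by simp
    have "emeasure lborel (ball (0::'a) 1) \<noteq> 0" "emeasure lborel (ball (0::'a) 1) \<noteq> top"
      by (simp_all add: emeasure_ball ennreal_eq_0_iff not_le)
    then have "(\<integral>\<^sup>+x. ?f (T x) \<partial>lborel) = (\<integral>\<^sup>+y. ?f y \<partial>lborel)"
      using eq by (metis ennreal_mult_cancel_left mult.commute)
    moreover have "(\<integral>\<^sup>+x. ?f x \<partial>distr lborel borel T) = (\<integral>\<^sup>+x. ?f (T x) \<partial>lborel)"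
      by (rule nn_integral_distr) measurable
    ultimately show "emeasure (distr lborel borel T) A = emeasure lborel A"
      by simp
  qed simp
qed

section \<open>Cut-offs that preserve continuous differentiability\<close>

lemma has_derivative_zero_if_quadratic:
  fixes f :: "'a::real_normed_vector \<Rightarrow> real"
  assumes "\<And>y. \<bar>f y - f x\<bar> \<le> K * (norm (y - x))\<^sup>2"
  shows "(f has_derivative (\<lambda>_. 0)) (at x)"
  unfolding has_derivative_at
proof
  have "norm (f (x + h) - f x - 0) / norm h \<le> norm h * K" for h
    using assms[of "x + h"] by (cases "h = 0") (auto simp: divide_simps power2_eq_square mult_ac)
  then have ev: "\<forall>h. norm (norm (f (x + h) - f x - 0) / norm h) \<le> norm h * K" by simp
  have "((\<lambda>h. norm h * K) \<longlongrightarrow> 0) (at (0::'a))"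
    by (auto intro!: tendsto_eq_intros)
  then show "(\<lambda>h. norm (f (x + h) - f x - 0) / norm h) \<midarrow>0\<rightarrow> 0"
    by (rule Lim_null_comparison[OF always_eventually[OF ev]])
qed simp

text \<open>\<open>soft_pos \<epsilon>\<close> is a \<open>C\<^sup>1\<close> approximation from below of \<open>max 0\<close>, quadratic at the origin, so that a
  function that is \<open>\<le> 0\<close> on the boundary of a set can be cut off there without a kink.\<close>

definition soft_pos :: "real \<Rightarrow> real \<Rightarrow> real" where
  "soft_pos \<epsilon> t = (max 0 t)\<^sup>2 / (max 0 t + \<epsilon>)"

text \<open>The derivative of \<open>soft_pos\<close>; written as 1 minus a square, its bound by 1
  is immediate.\<close>

definition soft_step :: "real \<Rightarrow> real \<Rightarrow> real" where
  "soft_step \<epsilon> t = 1 - (\<epsilon> / (max 0 t + \<epsilon>))\<^sup>2"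

context
  fixes \<epsilon> :: real
  assumes eps: "\<epsilon> > 0"
begin

lemma soft_pos_nonneg: "0 \<le> soft_pos \<epsilon> t"
  using eps by (auto simp: soft_pos_def)

lemma soft_pos_le: "soft_pos \<epsilon> t \<le> max 0 t"
  using eps by (auto simp: soft_pos_def divide_simps max_def power2_eq_square algebra_simps)

lemma soft_pos_quadratic: "soft_pos \<epsilon> t \<le> (max 0 t)\<^sup>2 / \<epsilon>"
  using eps unfolding soft_pos_def by (intro divide_left_mono mult_pos_pos) auto

lemma soft_step_nonneg: "0 \<le> soft_step \<epsilon> t"
proof -
  have "(\<epsilon> / (max 0 t + \<epsilon>))\<^sup>2 \<le> 1\<^sup>2"
    using eps by (intro power_mono) (auto simp: divide_simps)
  then show ?thesis by (simp add: soft_step_def)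
qed

lemma soft_step_le_one: "soft_step \<epsilon> t \<le> 1"
  by (simp add: soft_step_def)

text \<open>Linear vanishing at the origin is what makes the gradient of a cut-off continuous across
  the frontier of the cut-off set.\<close>

lemma soft_step_linear: "soft_step \<epsilon> t \<le> 2 * max 0 t / \<epsilon>"
proof -
  define m where "m = max 0 t"
  have m: "0 \<le> m" by (simp add: m_def)
  have "1 - (\<epsilon> / (m + \<epsilon>))\<^sup>2 = (1 + \<epsilon> / (m + \<epsilon>)) * (m / (m + \<epsilon>))"
  proof -
    define q where "q = \<epsilon> / (m + \<epsilon>)"
    have "m / (m + \<epsilon>) = 1 - q" using eps m by (simp add: q_def divide_simps)
    moreover have "1 - q\<^sup>2 = (1 + q) * (1 - q)" by (simp add: power2_eq_square algebra_simps)
    ultimately show ?thesis unfolding q_def[symmetric] by simp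
  qed
  also have "\<dots> \<le> 2 * (m / \<epsilon>)"
    using eps m by (intro mult_mono frac_le) (auto simp: divide_simps)
  finally show ?thesis by (simp add: soft_step_def m_def)
qed

lemma DERIV_soft_pos: "DERIV (soft_pos \<epsilon>) t :> soft_step \<epsilon> t"
proof -
  consider "t < 0" | "t = 0" | "t > 0" by linarith
  then show ?thesis
  proof cases
    case 1
    have "DERIV (\<lambda>t. 0) t :> soft_step \<epsilon> t"
      using 1 eps by (simp add: soft_step_def)
    then show ?thesis
      by (rule DERIV_cong_ev[THEN iffD1, rotated -1, OF _ refl _ refl])
         (use 1 in \<open>auto simp: soft_pos_def eventually_nhds intro!: exI[of _ "{..<0}"]\<close>)
  next
    case 2
    have "(soft_pos \<epsilon> has_derivative (\<lambda>_. 0)) (at 0)"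
    proof (rule has_derivative_zero_if_quadratic[where K = "1 / \<epsilon>"])
      fix y :: real
      have "(max 0 y)\<^sup>2 \<le> (norm y)\<^sup>2" by (auto simp: max_def)
      then have "(max 0 y)\<^sup>2 / \<epsilon> \<le> (norm y)\<^sup>2 / \<epsilon>" using eps by (intro divide_right_mono) auto
      moreover have "soft_pos \<epsilon> 0 = 0" by (simp add: soft_pos_def)
      ultimately show "\<bar>soft_pos \<epsilon> y - soft_pos \<epsilon> 0\<bar> \<le> 1 / \<epsilon> * (norm (y - 0))\<^sup>2"
        using soft_pos_quadratic[of y] soft_pos_nonneg[of y] by simp
    qed
    then show ?thesis
      using 2 eps by (auto simp: has_field_derivative_def soft_step_def elim!: has_derivative_eq_rhs)
  next
    case 3
    have "DERIV (\<lambda>t. t\<^sup>2 / (t + \<epsilon>)) t :> soft_step \<epsilon> t"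
    proof -
      define d where "d = t + \<epsilon>"
      have d: "d \<noteq> 0" "\<epsilon> = d - t" using 3 eps by (auto simp: d_def)
      have "1 - (\<epsilon> / d)\<^sup>2 = (2 * t * d - t\<^sup>2) / (d * d)"
        using d(1) unfolding d(2) by (simp add: divide_simps) algebra
      then have "soft_step \<epsilon> t = (2 * t * d - t\<^sup>2) / (d * d)"
        using 3 by (simp add: soft_step_def d_def)
      then show ?thesis
        using d(1) unfolding d_def by (auto intro!: derivative_eq_intros)
    qed
    then show ?thesis
      by (rule DERIV_cong_ev[THEN iffD1, rotated -1, OF _ refl _ refl])
         (use 3 in \<open>auto simp: soft_pos_def eventually_nhds intro!: exI[of _ "{0<..}"]\<close>)
  qed
qed

lemma continuous_on_soft_step: "continuous_on A (soft_step \<epsilon>)"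
  unfolding soft_step_def using eps by (intro continuous_intros) (auto simp: max_def)

end

lemma soft_pos_tendsto:
  "(\<lambda>n. soft_pos (inverse (real (Suc n))) t) \<longlonglongrightarrow> max 0 t"
proof -
  have "(\<lambda>n. (max 0 t)\<^sup>2 / (max 0 t + inverse (real (Suc n)))) \<longlonglongrightarrow> (max 0 t)\<^sup>2 / (max 0 t + 0)" if "t > 0"
    using that by (intro tendsto_intros LIMSEQ_inverse_real_of_nat) auto
  then show ?thesis
    by (cases "t > 0") (auto simp: soft_pos_def power2_eq_square)
qed

lemma soft_step_tendsto:
  "(\<lambda>n. soft_step (inverse (real (Suc n))) t) \<longlonglongrightarrow> (if t > 0 then 1 else 0)"
proof -
  have "(\<lambda>n. 1 - (inverse (real (Suc n)) / (max 0 t + inverse (real (Suc n))))\<^sup>2) \<longlonglongrightarrow> 1 - (0 / (max 0 t + 0))\<^sup>2"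
    if "t > 0"
    using that by (intro tendsto_intros LIMSEQ_inverse_real_of_nat) auto
  then show ?thesis
    by (cases "t > 0") (auto simp: soft_step_def)
qed

text \<open>Convexity turns a bound for the gradient into a Lipschitz bound. The sign of
  \<open>h\<close> on the frontier lets its positive part be extended continuously by 0.\<close>

definition cut_data :: "'a::euclidean_space set \<Rightarrow> ('a \<Rightarrow> real) \<Rightarrow> ('a \<Rightarrow> 'a) \<Rightarrow> bool" where
  "cut_data C h D \<longleftrightarrow> open C \<and> convex C \<and> bounded C \<and>
     continuous_on (closure C) h \<and> continuous_on (closure C) D \<and>
     (\<forall>x\<in>C. GDERIV h x :> D x) \<and> (\<forall>x\<in>frontier C. h x \<le> 0)"

text \<open>For the last bound, a segment from a point of \<open>C\<close> to a point outside meets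
  the frontier, where \<open>h\<close> is at most 0; the Lipschitz estimate up to that point does
  the rest.\<close>

lemma cut_data_bounds:
  assumes "cut_data C h D"
  obtains L where "L \<ge> 0" "\<And>x. x \<in> C \<Longrightarrow> norm (D x) \<le> L" "\<And>x. x \<in> C \<Longrightarrow> \<bar>h x\<bar> \<le> L"
    "\<And>x y. x \<in> C \<Longrightarrow> y \<notin> C \<Longrightarrow> h x \<le> L * norm (y - x)"
proof -
  have C: "open C" "convex C" "bounded C" "continuous_on (closure C) h" "continuous_on (closure C) D"
    "\<And>x. x \<in> C \<Longrightarrow> GDERIV h x :> D x" "\<And>x. x \<in> frontier C \<Longrightarrow> h x \<le> 0"
    using assms by (auto simp: cut_data_def)
  have cl: "compact (closure C)" using C by (simp add: compact_closure)
  obtain L1 where L1: "\<And>x. x \<in> closure C \<Longrightarrow> norm (D x) \<le> L1"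
    using compact_imp_bounded[OF compact_continuous_image[OF C(5) cl]] by (auto simp: bounded_iff)
  obtain L2 where L2: "\<And>x. x \<in> closure C \<Longrightarrow> norm (h x) \<le> L2"
    using compact_imp_bounded[OF compact_continuous_image[OF C(4) cl]] by (auto simp: bounded_iff)
  define L where "L = max 0 (max L1 L2)"
  have L: "norm (D x) \<le> L" "\<bar>h x\<bar> \<le> L" if "x \<in> closure C" for x
    using L1[OF that] L2[OF that] by (auto simp: L_def)
  have L0: "L \<ge> 0" by (simp add: L_def)
  have "L-lipschitz_on C h"
  proof (rule lipschitz_onI[OF _ L0])
    fix x y assume xy: "x \<in> C" "y \<in> C"
    have "norm (h x - h y) \<le> L * norm (x - y)"
    proof (rule differentiable_bound[OF C(2)])
      show "(h has_derivative (\<lambda>v. v \<bullet> D z)) (at z within C)" if "z \<in> C" for z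
        using C(6)[OF that] by (auto simp: gderiv_def intro: has_derivative_at_withinI)
      show "onorm (\<lambda>v. v \<bullet> D z) \<le> L" if "z \<in> C" for z
      proof (rule onorm_le)
        fix v show "norm (v \<bullet> D z) \<le> L * norm v"
          using Cauchy_Schwarz_ineq2[of v "D z"] mult_left_mono[OF L(1), of z "norm v"] that closure_subset[of C]
          by (auto simp: mult.commute)
      qed
    qed (use xy in auto)
    then show "dist (h x) (h y) \<le> L * dist x y" by (simp add: dist_norm)
  qed
  then have lip: "L-lipschitz_on (closure C) h" by (rule lipschitz_on_closure[OF _ C(4)])
  have "h x \<le> L * norm (y - x)" if "x \<in> C" "y \<notin> C" for x y
  proof -
    have "closed_segment x y \<inter> frontier C \<noteq> {}"
      using that by (intro connected_Int_frontier) auto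
    then obtain z where z: "z \<in> closed_segment x y" "z \<in> frontier C" by auto
    have "h x \<le> h x - h z" using C(7)[OF z(2)] by simp
    also have "\<dots> \<le> L * dist x z"
      using lipschitz_onD[OF lip, of x z] that z(2) closure_subset[of C] by (auto simp: dist_real_def frontier_def)
    also have "dist x z \<le> norm (y - x)"
      using segment_bound(1)[OF z(1)] by (simp add: dist_norm norm_minus_commute)
    finally show ?thesis using L0 by (simp add: mult_left_mono)
  qed
  then show ?thesis using that[OF L0] L closure_subset[of C] by blast
qed

context
  fixes C :: "'a::euclidean_space set" and h D and \<epsilon> :: real
  assumes cd: "cut_data C h D" and eps: "\<epsilon> > 0"
begin

text \<open>Outside \<open>C\<close>, and in particular on the frontier, the distance bound for
  \<open>h\<close> and the quadratic bound for \<open>soft_pos\<close> together leave an error of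
  second order, so the derivative there is 0.\<close>

lemma GDERIV_soft_cut:
  "GDERIV (\<lambda>x. if x \<in> C then soft_pos \<epsilon> (h x) else 0) x :> (if x \<in> C then soft_step \<epsilon> (h x) *\<^sub>R D x else 0)"
proof (cases "x \<in> C")
  case True
  have "GDERIV h x :> D x" "open C" using cd True by (auto simp: cut_data_def)
  from GDERIV_DERIV_compose[OF this(1) DERIV_soft_pos[OF eps]]
  have "((\<lambda>x. soft_pos \<epsilon> (h x)) has_derivative (\<lambda>k. k \<bullet> (soft_step \<epsilon> (h x) *\<^sub>R D x))) (at x)"
    by (simp add: gderiv_def)
  then show ?thesis unfolding gderiv_def
    by (rule has_derivative_transform_within_open[OF _ \<open>open C\<close> True, THEN has_derivative_eq_rhs])
       (use True in auto)
next
  case False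
  obtain L where L: "L \<ge> 0" "\<And>x y. x \<in> C \<Longrightarrow> y \<notin> C \<Longrightarrow> h x \<le> L * norm (y - x)"
    using cut_data_bounds[OF cd] by metis
  have "((\<lambda>x. if x \<in> C then soft_pos \<epsilon> (h x) else 0) has_derivative (\<lambda>_. 0)) (at x)"
  proof (rule has_derivative_zero_if_quadratic[where K = "L\<^sup>2 / \<epsilon>"])
    fix y
    show "\<bar>(if y \<in> C then soft_pos \<epsilon> (h y) else 0) - (if x \<in> C then soft_pos \<epsilon> (h x) else 0)\<bar>
           \<le> L\<^sup>2 / \<epsilon> * (norm (y - x))\<^sup>2"
    proof (cases "y \<in> C")
      case True
      have "max 0 (h y) \<le> L * norm (y - x)"
        using L(2)[OF True False] L(1) by (auto simp: norm_minus_commute)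
      then have "(max 0 (h y))\<^sup>2 / \<epsilon> \<le> (L * norm (y - x))\<^sup>2 / \<epsilon>"
        using eps by (intro divide_right_mono power_mono) auto
      then show ?thesis
        using soft_pos_quadratic[OF eps, of "h y"] soft_pos_nonneg[OF eps, of "h y"] True False
        by (auto simp: power_mult_distrib)
    qed (use eps False in auto)
  qed
  then show ?thesis using False by (simp add: gderiv_def)
qed

lemma isCont_soft_cut_grad:
  "isCont (\<lambda>x. if x \<in> C then soft_step \<epsilon> (h x) *\<^sub>R D x else 0) x"
proof (cases "x \<in> C")
  case True
  have C: "open C" "continuous_on C h" "continuous_on C D"
    using cd by (auto simp: cut_data_def intro: continuous_on_subset[OF _ closure_subset])
  have "continuous_on C (\<lambda>x. soft_step \<epsilon> (h x) *\<^sub>R D x)"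
    using C by (intro continuous_intros continuous_on_compose2[OF continuous_on_soft_step[OF eps, of UNIV]]) auto
  then have "continuous_on C (\<lambda>x. if x \<in> C then soft_step \<epsilon> (h x) *\<^sub>R D x else 0)"
    by (rule continuous_on_eq) auto
  then show ?thesis using continuous_on_eq_continuous_at[OF C(1)] True by blast
next
  case False
  obtain L where L: "L \<ge> 0" "\<And>x. x \<in> C \<Longrightarrow> norm (D x) \<le> L"
    "\<And>x y. x \<in> C \<Longrightarrow> y \<notin> C \<Longrightarrow> h x \<le> L * norm (y - x)"
    using cut_data_bounds[OF cd] by metis
  have "norm (if y \<in> C then soft_step \<epsilon> (h y) *\<^sub>R D y else 0) \<le> norm (y - x) * (2 * L / \<epsilon> * L)" for y
  proof (cases "y \<in> C")
    case True
    have "max 0 (h y) \<le> L * norm (y - x)"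
      using L(3)[OF True False] L(1) by (auto simp: norm_minus_commute)
    then have "2 * max 0 (h y) / \<epsilon> \<le> 2 * (L * norm (y - x)) / \<epsilon>"
      using eps by (intro divide_right_mono) auto
    then have "soft_step \<epsilon> (h y) \<le> 2 * (L * norm (y - x)) / \<epsilon>"
      using soft_step_linear[OF eps, of "h y"] by linarith
    then have "soft_step \<epsilon> (h y) * norm (D y) \<le> 2 * (L * norm (y - x)) / \<epsilon> * L"
      using L True soft_step_nonneg[OF eps, of "h y"] by (intro mult_mono) auto
    then show ?thesis using True soft_step_nonneg[OF eps, of "h y"] by (simp add: mult_ac)
  qed (use L eps in auto)
  then have ev: "\<forall>y. norm (if y \<in> C then soft_step \<epsilon> (h y) *\<^sub>R D y else 0) \<le> norm (y - x) * (2 * L / \<epsilon> * L)" by blast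
  have "((\<lambda>y. norm (y - x) * (2 * L / \<epsilon> * L)) \<longlongrightarrow> 0) (at x)"
    by (rule tendsto_eq_rhs, rule tendsto_intros, rule tendsto_norm_zero, rule LIM_zero, rule tendsto_ident_at)
      (auto intro: tendsto_const)
  then have "((\<lambda>x. if x \<in> C then soft_step \<epsilon> (h x) *\<^sub>R D x else 0) \<longlongrightarrow> 0) (at x)"
    by (rule Lim_null_comparison[OF always_eventually[OF ev]])
  then show ?thesis using False by (simp add: isCont_def)
qed

end

section \<open>Competitors for the minimisation problem\<close>

lemma primitive_has_derivative:
  assumes "continuous_on {0..} h" "t \<ge> 0"
  shows "(primitive h has_real_derivative h t) (at t within {0..})"
proof -
  have "((\<lambda>x. integral {0..x} h) has_real_derivative h t) (at t within {0..t+1})"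
    using assms by (intro integral_has_real_derivative) (auto intro: continuous_on_subset)
  moreover have "at t within {0..t+1} = at t within {0..}"
    using assms by (intro at_within_nhd[of _ "{..<t+1}"]) auto
  ultimately show ?thesis by (simp add: primitive_def[abs_def])
qed

lemma continuous_on_primitive:
  assumes "continuous_on {0..} h"
  shows "continuous_on {0..} (primitive h)"
  using primitive_has_derivative[OF assms] by (intro DERIV_continuous_on) auto

lemma primitive_0: "primitive h 0 = 0"
  by (simp add: primitive_def)

lemma primitive_mean_value:
  assumes "continuous_on {0..} h" "0 \<le> a" "a < b"
  obtains \<xi> where "a < \<xi>" "\<xi> < b" "primitive h b - primitive h a = (b - a) * h \<xi>"
proof -
  have "continuous_on {a..b} (primitive h)"
    using continuous_on_primitive[OF assms(1)] assms by (auto intro: continuous_on_subset)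
  moreover have "(primitive h has_derivative (*) (h x)) (at x)" if "a < x" "x < b" for x
  proof -
    have "at x within {0..} = at x" using assms that by (intro at_within_interior) auto
    then show ?thesis
      using primitive_has_derivative[OF assms(1), of x] that assms by (auto simp: has_field_derivative_def)
  qed
  ultimately show ?thesis
    using mvt[OF assms(3), of "primitive h" "\<lambda>x. (*) (h x)"] that by (metis mult.commute)
qed

lemma primitive_lipschitz:
  assumes h: "continuous_on {0..} h" and K: "\<And>t. 0 \<le> t \<Longrightarrow> t \<le> M \<Longrightarrow> \<bar>h t\<bar> \<le> K"
    and ab: "0 \<le> a" "a \<le> M" "0 \<le> b" "b \<le> M"
  shows "\<bar>primitive h b - primitive h a\<bar> \<le> K * \<bar>b - a\<bar>"
proof -
  have *: "\<bar>primitive h b - primitive h a\<bar> \<le> K * \<bar>b - a\<bar>" if ab: "0 \<le> a" "a < b" "b \<le> M" for a b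
  proof -
    obtain \<xi> where \<xi>: "a < \<xi>" "\<xi> < b" "primitive h b - primitive h a = (b - a) * h \<xi>"
      using primitive_mean_value[OF h ab(1,2)] .
    have "\<bar>h \<xi>\<bar> \<le> K" using K[of \<xi>] \<xi> ab by auto
    then show ?thesis using \<xi>(3) ab by (simp add: abs_mult mult.commute mult_left_mono)
  qed
  consider "a < b" | "a = b" | "b < a" by linarith
  then show ?thesis
    using *[of a b] *[of b a] ab by cases (auto simp: abs_minus_commute)
qed

definition pos_cut :: "'a set \<Rightarrow> ('a \<Rightarrow> real) \<Rightarrow> 'a \<Rightarrow> real" where
  "pos_cut C h x = (if x \<in> C then max 0 (h x) else 0)"

text \<open>The pointwise limit of the gradients of the soft cut-offs. Where \<open>h x = 0\<close>
  it is 0 whatever \<open>D x\<close> is, because \<open>soft_step\<close> vanishes at 0; the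
  convergence therefore holds everywhere and no null sets have to be discussed.\<close>

definition grad_cut :: "'a set \<Rightarrow> ('a \<Rightarrow> real) \<Rightarrow> ('a \<Rightarrow> 'a::real_vector) \<Rightarrow> 'a \<Rightarrow> 'a" where
  "grad_cut C h D x = (if x \<in> C \<and> h x > 0 then D x else 0)"

text \<open>Switches off one of the two cuts in \<open>energy_le_cut\<close>.\<close>

lemma cut_data_empty: "cut_data {} h D"
  by (simp add: cut_data_def)

lemma pos_cut_empty [simp]: "pos_cut {} h x = 0" and grad_cut_empty [simp]: "grad_cut {} h D x = 0"
  by (simp_all add: pos_cut_def grad_cut_def)

lemma pos_cut_nonneg: "0 \<le> pos_cut C h x"
  by (simp add: pos_cut_def)

section \<open>The convex energy density and its flux\<close>

locale flux_law =
  fixes g :: "real \<Rightarrow> real"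
  assumes g_cont: "continuous_on {0..} g" and g_0: "g 0 = 0" and g_mono: "strict_mono_on {0..} g"
begin

abbreviation G :: "real \<Rightarrow> real" where "G \<equiv> primitive g"

lemma g_nonneg: "t \<ge> 0 \<Longrightarrow> g t \<ge> 0"
  using strict_mono_onD[OF g_mono, of 0 t] g_0 by (cases "t = 0") auto

lemma g_pos: "t > 0 \<Longrightarrow> g t > 0"
  using strict_mono_onD[OF g_mono, of 0 t] g_0 by auto

lemma G_cont: "continuous_on {0..} G"
  by (rule continuous_on_primitive[OF g_cont])

lemma G_tangent:
  assumes "a \<ge> 0" "b \<ge> 0"
  shows "G b - G a \<ge> g a * (b - a)"
proof -
  consider "a < b" | "a = b" | "b < a" by linarith
  then show ?thesis
  proof cases
    case 1
    obtain \<xi> where \<xi>: "a < \<xi>" "\<xi> < b" "G b - G a = (b - a) * g \<xi>"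
      using primitive_mean_value[OF g_cont assms(1) 1] .
    have "g a \<le> g \<xi>" using strict_mono_onD[OF g_mono, of a \<xi>] \<xi> assms by auto
    then show ?thesis using \<xi> 1 by (simp add: mult.commute)
  next
    case 3
    obtain \<xi> where \<xi>: "b < \<xi>" "\<xi> < a" "G a - G b = (a - b) * g \<xi>"
      using primitive_mean_value[OF g_cont assms(2) 3] .
    have "g \<xi> \<le> g a" using strict_mono_onD[OF g_mono, of \<xi> a] \<xi> assms by auto
    then have "(a - b) * g \<xi> \<le> (a - b) * g a" using 3 by (intro mult_left_mono) auto
    then show ?thesis using \<xi>(3) by (simp add: algebra_simps)
  qed simp
qed

lemma G_nonneg: "t \<ge> 0 \<Longrightarrow> G t \<ge> 0"
  using G_tangent[of 0 t] by (simp add: g_0 primitive_0)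

lemma G_pos: "t > 0 \<Longrightarrow> G t > 0"
  using G_tangent[of "t/2" t] G_nonneg[of "t/2"] g_pos[of "t/2"]
  by (smt (verit) field_sum_of_halves half_gt_zero mult_pos_pos)

text \<open>Both estimates come from the tangent of \<open>G\<close> at \<open>p / t\<close>:
  evaluated at 0, where \<open>G\<close> vanishes, and at \<open>p\<close>. Stretching a graph by
  \<open>t\<close> divides its gradient by \<open>t\<close>, hence this form.\<close>

lemma G_scale:
  assumes "t \<ge> 1" "p \<ge> 0"
  shows "t * G (p / t) \<le> G p"
proof -
  define a where "a = p / t"
  have a: "a \<ge> 0" "p = t * a" using assms by (auto simp: a_def)
  have "G a \<le> g a * a"
    using G_tangent[of a 0] a by (simp add: primitive_0)
  then have "(t - 1) * G a \<le> (t - 1) * (g a * a)"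
    using assms by (intro mult_left_mono) auto
  moreover have "G p - G a \<ge> g a * (p - a)"
    using G_tangent[of a p] a assms by auto
  moreover have "g a * (p - a) = (t - 1) * (g a * a)" unfolding a(2) by (simp add: algebra_simps)
  moreover have "(t - 1) * G a = t * G a - G a" by (simp add: algebra_simps)
  ultimately show ?thesis unfolding a_def[symmetric] by linarith
qed

lemma norm_flux: "norm (flux g y) = g (norm y)"
  using g_nonneg[of "norm y"] by (cases "y = 0") (auto simp: flux_def g_0)

text \<open>\<open>flux g\<close> is the gradient of the convex function
  \<open>\<lambda>y. G (norm y)\<close>. The flux is taken at \<open>x\<close>, so that an energy
  increment is bounded above by the flux at the perturbed gradient.\<close>

lemma flux_tangent: "G (norm x) - G (norm y) \<le> flux g x \<bullet> (x - y)"
proof (cases "x = 0")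
  case True
  then show ?thesis using G_nonneg[of "norm y"] by (simp add: flux_def primitive_0)
next
  case False
  have "G (norm x) - G (norm y) \<le> g (norm x) * (norm x - norm y)"
    using G_tangent[of "norm x" "norm y"] by (simp add: algebra_simps)
  also have "\<dots> = g (norm x) / norm x * (norm x * norm x - norm x * norm y)"
    using False by (simp add: field_simps)
  also have "\<dots> \<le> g (norm x) / norm x * (x \<bullet> x - x \<bullet> y)"
    using norm_cauchy_schwarz[of x y] g_nonneg[of "norm x"]
    by (intro mult_left_mono) (auto simp: dot_square_norm power2_eq_square)
  finally show ?thesis by (simp add: flux_def inner_diff_right diff_divide_distrib right_diff_distrib)
qed

lemma isCont_flux:
  fixes y :: "real ^ 'n"
  shows "isCont (flux g) y"
proof (cases "y = 0")
  case True
  have "((\<lambda>y. g (norm y)) \<longlongrightarrow> g (norm (0::real^'n))) (at (0::real^'n))"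
    by (rule continuous_on_tendsto_compose[OF g_cont tendsto_norm[OF tendsto_ident_at]]) auto
  then have "((\<lambda>y. norm (flux g y)) \<longlongrightarrow> 0) (at (0::real^'n))"
    by (simp add: norm_flux g_0)
  then have "(flux g \<longlongrightarrow> 0) (at (0::real^'n))"
    by (rule tendsto_norm_zero_cancel)
  then show ?thesis using True by (simp add: isCont_def flux_def)
next
  case False
  have "((\<lambda>y. g (norm y)) \<longlongrightarrow> g (norm y)) (at y)"
    by (rule continuous_on_tendsto_compose[OF g_cont tendsto_norm[OF tendsto_ident_at]]) auto
  then have "((\<lambda>y. (g (norm y) / norm y) *\<^sub>R y) \<longlongrightarrow> (g (norm y) / norm y) *\<^sub>R y) (at y)"
    using False by (intro tendsto_intros) auto
  then show ?thesis by (simp add: isCont_def flux_def[abs_def])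
qed

end

section \<open>The energy on the ball and limits of competitors\<close>

locale ball_minimizer = flux_law g
  for g :: "real \<Rightarrow> real" +
  fixes f :: "real \<Rightarrow> real" and R :: real and u :: "real ^ 'n \<Rightarrow> real" and Du :: "real ^ 'n \<Rightarrow> real ^ 'n"
  assumes R_pos: "R > 0"
    and f_cont: "continuous_on {0..} f"
    and u_cont: "continuous_on (cball 0 R) u" and Du_cont: "continuous_on (cball 0 R) Du"
    and u_grad: "\<And>x. x \<in> ball 0 R \<Longrightarrow> GDERIV u x :> Du x"
    and u_nonneg: "\<And>x. x \<in> cball 0 R \<Longrightarrow> u x \<ge> 0"
    and u_bdry: "\<And>x. norm x = R \<Longrightarrow> u x = 0"
    and minimal: "\<And>(v :: real ^ 'n \<Rightarrow> real) (Dv :: real ^ 'n \<Rightarrow> real ^ 'n). continuous_on (cball 0 R) v \<Longrightarrow> continuous_on (cball 0 R) Dv \<Longrightarrow>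
      (\<And>x. x \<in> ball 0 R \<Longrightarrow> GDERIV v x :> Dv x) \<Longrightarrow> (\<And>x. x \<in> ball 0 R \<Longrightarrow> 0 \<le> v x) \<Longrightarrow>
      (\<And>x. norm x = R \<Longrightarrow> v x = 0) \<Longrightarrow>
      (LINT x:ball 0 R|lborel. primitive g (norm (Du x)) - primitive f (u x))
        \<le> (LINT x:ball 0 R|lborel. primitive g (norm (Dv x)) - primitive f (v x))"
begin

abbreviation B :: "(real ^ 'n) set" where "B \<equiv> ball 0 R"

abbreviation F :: "real \<Rightarrow> real" where "F \<equiv> primitive f"

text \<open>The gradient is a separate argument because \<open>energy\<close> is also applied to
  functions with kinks, where \<open>grad\<close> need not exist and a limit of gradients takes its
  place.\<close>

definition energy :: "(real ^ 'n \<Rightarrow> real) \<Rightarrow> (real ^ 'n \<Rightarrow> real ^ 'n) \<Rightarrow> real" where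
  "energy v D = (LINT x:B|lborel. G (norm (D x)) - F (v x))"

lemma F_cont: "continuous_on {0..} F"
  by (rule continuous_on_primitive[OF f_cont])

lemma bounded_on_interval:
  fixes h :: "real \<Rightarrow> real"
  assumes "continuous_on {0..} h"
  obtains K where "K > 0" "\<And>t. 0 \<le> t \<Longrightarrow> t \<le> M \<Longrightarrow> \<bar>h t\<bar> \<le> K"
proof -
  have "compact (h ` {0..M})"
    by (rule compact_continuous_image[OF continuous_on_subset[OF assms]]) auto
  then obtain K where "K > 0" "\<forall>y\<in>h ` {0..M}. norm y \<le> K"
    using compact_imp_bounded bounded_pos by metis
  then show ?thesis using that by auto
qed

text \<open>Dominated convergence on a ball of finite measure carries minimality over to pointwise
  limits, which need not be differentiable. Integrability is recorded because energies are later
  subtracted and split.\<close>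

lemma energy_limit:
  fixes v :: "nat \<Rightarrow> real ^ 'n \<Rightarrow> real" and D :: "nat \<Rightarrow> real ^ 'n \<Rightarrow> real ^ 'n"
  assumes v_cont: "\<And>n. continuous_on (cball 0 R) (v n)" and D_cont: "\<And>n. continuous_on (cball 0 R) (D n)"
    and grad: "\<And>n x. x \<in> B \<Longrightarrow> GDERIV (v n) x :> D n x"
    and nonneg: "\<And>n x. x \<in> B \<Longrightarrow> 0 \<le> v n x" and bdry: "\<And>n (x :: real ^ 'n). norm x = R \<Longrightarrow> v n x = 0"
    and v_bd: "\<And>n x. x \<in> B \<Longrightarrow> v n x \<le> K" and D_bd: "\<And>n x. x \<in> B \<Longrightarrow> norm (D n x) \<le> K"
    and v_lim: "\<And>x. x \<in> B \<Longrightarrow> (\<lambda>n. v n x) \<longlonglongrightarrow> w x" and D_lim: "\<And>x. x \<in> B \<Longrightarrow> (\<lambda>n. D n x) \<longlonglongrightarrow> E x"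
  shows "energy u Du \<le> energy w E" and "set_integrable lborel B (\<lambda>x. G (norm (E x)) - F (w x))"
proof -
  obtain KG where KG: "KG > 0" "\<And>t. 0 \<le> t \<Longrightarrow> t \<le> K \<Longrightarrow> \<bar>G t\<bar> \<le> KG" using bounded_on_interval[OF G_cont] by metis
  obtain KF where KF: "KF > 0" "\<And>t. 0 \<le> t \<Longrightarrow> t \<le> K \<Longrightarrow> \<bar>F t\<bar> \<le> KF" using bounded_on_interval[OF F_cont] by metis
  let ?s = "\<lambda>n x. indicator B x *\<^sub>R (G (norm (D n x)) - F (v n x))"
  let ?w = "\<lambda>x. indicator B x *\<^sub>R (G (norm (E x)) - F (w x))"
  have meas: "?s n \<in> borel_measurable lborel" for n
  proof -
    have "continuous_on B (\<lambda>x. G (norm (D n x)) - F (v n x))"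
      by (intro continuous_intros continuous_on_compose2[OF G_cont] continuous_on_compose2[OF F_cont]
          continuous_on_subset[OF D_cont] continuous_on_subset[OF v_cont]) (auto intro: nonneg)
    then have "?s n \<in> borel_measurable borel"
      by (intro borel_measurable_continuous_on_indicator) auto
    then show ?thesis by simp
  qed
  have lim: "(\<lambda>n. ?s n x) \<longlonglongrightarrow> ?w x" for x
  proof (cases "x \<in> B")
    case True
    have "(\<lambda>n. G (norm (D n x))) \<longlonglongrightarrow> G (norm (E x))"
      by (rule continuous_on_tendsto_compose[OF G_cont tendsto_norm[OF D_lim[OF True]]]) auto
    moreover have "(\<lambda>n. F (v n x)) \<longlonglongrightarrow> F (w x)"
      using nonneg[OF True] LIMSEQ_le_const[OF v_lim[OF True], of 0]
      by (intro continuous_on_tendsto_compose[OF F_cont v_lim[OF True]]) auto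
    ultimately show ?thesis by (intro tendsto_intros)
  qed simp
  have bd: "norm (?s n x) \<le> indicator B x *\<^sub>R (KG + KF)" for n x
  proof (cases "x \<in> B")
    case True
    then show ?thesis
      using KG(2)[of "norm (D n x)"] KF(2)[of "v n x"] nonneg[OF True] v_bd[OF True] D_bd[OF True]
        abs_triangle_ineq4[of "G (norm (D n x))" "F (v n x)"] by (auto intro: order_trans)
  qed simp
  have "integrable lborel (\<lambda>x. indicator B x *\<^sub>R (KG + KF))"
    using emeasure_lborel_ball_finite[of "0::real^'n" R] by (intro integrableI_bounded_set_indicator[where B = "KG + KF"]) (use KG KF in auto)
  note dc = integral_dominated_convergence[OF borel_measurable_LIMSEQ_metric[OF meas lim] meas this AE_I2[OF lim] AE_I2[OF bd]]
  note dc' = integrable_dominated_convergence[OF borel_measurable_LIMSEQ_metric[OF meas lim] meas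
     \<open>integrable lborel (\<lambda>x. indicator B x *\<^sub>R (KG + KF))\<close> AE_I2[OF lim] AE_I2[OF bd]]
  show "set_integrable lborel B (\<lambda>x. G (norm (E x)) - F (w x))"
    using dc' by (simp add: set_integrable_def)
  have "energy u Du \<le> energy (v n) (D n)" for n
    unfolding energy_def by (rule minimal[of "v n" "D n", OF v_cont D_cont grad nonneg bdry])
  then show "energy u Du \<le> energy w E"
    using dc by (intro LIMSEQ_le_const[where X = "\<lambda>n. energy (v n) (D n)"]) (auto simp: energy_def set_lebesgue_integral_def)
qed

text \<open>One statement serves all later competitors: a subtracted cut for minima and truncations,
  an added one for maxima and stretched graphs, and a C^1 perturbation for testing. Nonnegativity is
  asked without the added cut; it passes to the approximations since \<open>soft_pos\<close> never
  exceeds the positive part.\<close>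

lemma energy_le_cut:
  assumes cd1: "cut_data C1 h1 D1" "C1 \<subseteq> B" and cd2: "cut_data C2 h2 D2" "C2 \<subseteq> B"
    and \<eta>: "continuous_on (cball 0 R) \<eta>" "continuous_on (cball 0 R) D\<eta>" "\<And>x. x \<in> B \<Longrightarrow> GDERIV \<eta> x :> D\<eta> x"
      "\<And>x. norm x = R \<Longrightarrow> \<eta> x = 0"
    and nonneg: "\<And>x. x \<in> B \<Longrightarrow> 0 \<le> u x - pos_cut C1 h1 x + \<eta> x"
  shows "energy u Du \<le> energy (\<lambda>x. u x - pos_cut C1 h1 x + pos_cut C2 h2 x + \<eta> x)
      (\<lambda>x. Du x - grad_cut C1 h1 D1 x + grad_cut C2 h2 D2 x + D\<eta> x)" (is ?th1)
    and "set_integrable lborel B (\<lambda>x. G (norm (Du x - grad_cut C1 h1 D1 x + grad_cut C2 h2 D2 x + D\<eta> x))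
       - F (u x - pos_cut C1 h1 x + pos_cut C2 h2 x + \<eta> x))" (is ?th2)
proof -
  obtain L1 where L1: "L1 \<ge> 0" "\<And>x. x \<in> C1 \<Longrightarrow> norm (D1 x) \<le> L1"
    using cut_data_bounds[OF cd1(1)] by metis
  obtain L2 where L2: "L2 \<ge> 0" "\<And>x. x \<in> C2 \<Longrightarrow> norm (D2 x) \<le> L2" "\<And>x. x \<in> C2 \<Longrightarrow> \<bar>h2 x\<bar> \<le> L2"
    using cut_data_bounds[OF cd2(1)] by metis
  have bd: "\<exists>K. \<forall>x\<in>cball 0 R. norm (w x) \<le> K" if "continuous_on (cball 0 R) w" for w :: "real^'n \<Rightarrow> 'b::real_normed_vector"
    using compact_imp_bounded[OF compact_continuous_image[OF that compact_cball]] by (auto simp: bounded_iff)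
  obtain Ku KD Ke Kd where K: "\<forall>x\<in>cball 0 R. norm (u x) \<le> Ku" "\<forall>x\<in>cball 0 R. norm (Du x) \<le> KD"
    "\<forall>x\<in>cball 0 R. norm (\<eta> x) \<le> Ke" "\<forall>x\<in>cball 0 R. norm (D\<eta> x) \<le> Kd"
    using bd[OF u_cont] bd[OF Du_cont] bd[OF \<eta>(1)] bd[OF \<eta>(2)] by metis
  let ?e = "\<lambda>n. inverse (real (Suc n))"
  let ?p = "\<lambda>C h n x. if x \<in> C then soft_pos (?e n) (h x) else 0"
  let ?q = "\<lambda>C h D n x. if x \<in> C then soft_step (?e n) (h x) *\<^sub>R D x else 0"
  let ?v = "\<lambda>n x. u x - ?p C1 h1 n x + ?p C2 h2 n x + \<eta> x"
  let ?D = "\<lambda>n x. Du x - ?q C1 h1 D1 n x + ?q C2 h2 D2 n x + D\<eta> x"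
  have e: "?e n > 0" for n by simp
  have pc: "continuous_on A (?p C h n)" if "cut_data C h D" for C h D n A
    using GDERIV_soft_cut[OF that e] unfolding gderiv_def
    by (intro continuous_at_imp_continuous_on ballI has_derivative_continuous) blast
  have qc: "continuous_on A (?q C h D n)" if "cut_data C h D" for C h D n A
    using isCont_soft_cut_grad[OF that e] by (intro continuous_at_imp_continuous_on ballI)
  have p0: "?p C h n x \<ge> 0" for x :: "real^'n" and C n h using soft_pos_nonneg[OF e] by simp
  have p_le: "?p C h n x \<le> pos_cut C h x" for x :: "real^'n" and C n h
    using soft_pos_le[OF e] by (simp add: pos_cut_def)
  have p_lim: "(\<lambda>n. ?p C h n x) \<longlonglongrightarrow> pos_cut C h x" for C h and x :: "real^'n"
    using soft_pos_tendsto[of "h x"] by (simp add: pos_cut_def)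
  have q_lim: "(\<lambda>n. ?q C h D n x) \<longlonglongrightarrow> grad_cut C h D x" for C h D and x :: "real^'n"
    using tendsto_scaleR[OF soft_step_tendsto[of "h x"] tendsto_const[of "D x"]]
    by (cases "x \<in> C"; cases "h x > 0") (simp_all add: grad_cut_def del: of_nat_Suc)
  have q_le: "norm (?q C h D n x) \<le> L" if "\<And>x. x \<in> C \<Longrightarrow> norm (D x) \<le> L" "L \<ge> 0" for C h D n L and x :: "real^'n"
  proof (cases "x \<in> C")
    case True
    have "soft_step (?e n) (h x) * norm (D x) \<le> 1 * L"
      using that True soft_step_nonneg[OF e] soft_step_le_one[OF e] by (intro mult_mono) auto
    then show ?thesis using True soft_step_nonneg[OF e, of n "h x"] by (simp del: of_nat_Suc)
  qed (use that in simp)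
  have v_cont: "continuous_on (cball 0 R) (?v n)" and D_cont: "continuous_on (cball 0 R) (?D n)" for n
    by (intro continuous_intros u_cont Du_cont pc[OF cd1(1)] pc[OF cd2(1)] qc[OF cd1(1)] qc[OF cd2(1)] \<eta>)+
  have grad: "GDERIV (?v n) x :> ?D n x" if "x \<in> B" for n x
    by (intro GDERIV_add GDERIV_diff u_grad \<eta> that GDERIV_soft_cut[OF cd1(1) e] GDERIV_soft_cut[OF cd2(1) e])
  have v_nonneg: "0 \<le> ?v n x" if "x \<in> B" for n x
    using nonneg[OF that] p0[of x C2 n h2] p_le[of x C1 n h1] by linarith
  have bdry: "?v n x = 0" if "norm x = R" for n x
    using cd1(2) cd2(2) that u_bdry[OF that] \<eta>(4)[OF that] by (auto simp: subset_eq)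
  let ?K = "max (Ku + L2 + Ke) (KD + L1 + L2 + Kd)"
  have v_bd: "?v n x \<le> ?K" if "x \<in> B" for n x
  proof -
    have "pos_cut C2 h2 x \<le> L2" using L2(1) L2(3)[of x] by (auto simp: pos_cut_def)
    moreover have "u x \<le> Ku" "\<eta> x \<le> Ke" using K(1,3) that by (auto simp: abs_le_iff)
    ultimately show ?thesis
      using p0[of x C1 n h1] p_le[of x C2 n h2] by linarith
  qed
  have D_bd: "norm (?D n x) \<le> ?K" if "x \<in> B" for n x
  proof -
    have "norm (Du x) \<le> KD" "norm (D\<eta> x) \<le> Kd" using K(2,4) that by auto
    moreover have "norm (?q C1 h1 D1 n x) \<le> L1" by (rule q_le[OF L1(2) L1(1)])
    moreover have "norm (?q C2 h2 D2 n x) \<le> L2" by (rule q_le[OF L2(2) L2(1)])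
    moreover have "norm (a - b + c + d) \<le> norm a + norm b + norm c + norm d" for a b c d :: "real^'n"
      by (intro order_trans[OF norm_triangle_ineq] add_mono norm_triangle_ineq4 order_refl)
    ultimately have "norm (?D n x) \<le> KD + L1 + L2 + Kd"
      by (meson add_mono order_trans)
    then show ?thesis by linarith
  qed
  have v_lim: "(\<lambda>n. ?v n x) \<longlonglongrightarrow> u x - pos_cut C1 h1 x + pos_cut C2 h2 x + \<eta> x"
    and D_lim: "(\<lambda>n. ?D n x) \<longlonglongrightarrow> Du x - grad_cut C1 h1 D1 x + grad_cut C2 h2 D2 x + D\<eta> x" for x
    by (intro tendsto_intros p_lim q_lim)+
  show ?th1 ?th2
    by (rule energy_limit[of ?v ?D ?K, OF v_cont D_cont grad v_nonneg bdry v_bd D_bd v_lim D_lim]; assumption)+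
qed

end

section \<open>A test bump\<close>

lemma lborel_integral_affine_euclidean:
  fixes f :: "'a::euclidean_space \<Rightarrow> real"
  assumes "c \<noteq> 0" and [measurable]: "f \<in> borel_measurable borel"
  shows "integrable lborel (\<lambda>x. f (t + c *\<^sub>R x)) \<longleftrightarrow> integrable lborel f"
    and "(LINT x|lborel. f x) = \<bar>c\<bar> ^ DIM('a) * (LINT x|lborel. f (t + c *\<^sub>R x))"
proof -
  have c: "\<bar>c\<bar> ^ DIM('a) \<noteq> 0" "\<bar>c\<bar> ^ DIM('a) \<ge> 0" using assms by auto
  have eq: "lborel = density (distr lborel borel (\<lambda>x. t + c *\<^sub>R x)) (\<lambda>_. ennreal (\<bar>c\<bar> ^ DIM('a)))"
    by (rule lborel_affine[OF \<open>c \<noteq> 0\<close>])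
  show "integrable lborel (\<lambda>x. f (t + c *\<^sub>R x)) \<longleftrightarrow> integrable lborel f"
    using c by (subst (2) eq) (simp add: integrable_density integrable_distr_eq)
  show "(LINT x|lborel. f x) = \<bar>c\<bar> ^ DIM('a) * (LINT x|lborel. f (t + c *\<^sub>R x))"
    using c by (subst eq) (simp add: integral_density integral_distr)
qed

text \<open>Used mainly through its square: squaring removes the kink on the sphere of radius
  \<open>r\<close>, and the gradient of the square at \<open>y\<close> is a multiple of
  \<open>bump r y\<close> times \<open>y\<close>.\<close>

definition bump :: "real \<Rightarrow> 'a::real_inner \<Rightarrow> real" where
  "bump r y = max 0 (r\<^sup>2 - y \<bullet> y)"

lemma continuous_on_bump [continuous_intros]: "continuous_on A k \<Longrightarrow> continuous_on A (\<lambda>x. bump r (k x))"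
  unfolding bump_def by (intro continuous_intros)

lemma bump_nonneg: "bump r y \<ge> 0"
  by (simp add: bump_def)

lemma bump_eq_0: "r \<ge> 0 \<Longrightarrow> bump r y = 0 \<longleftrightarrow> r \<le> norm y"
  using power_mono_iff[of r "norm y" 2] by (auto simp: bump_def power2_norm_eq_inner max_def)

lemma bump_le: "bump r y \<le> r\<^sup>2"
  by (simp add: bump_def)

lemma bump_scaleR: "bump r (r *\<^sub>R z) = r\<^sup>2 * bump 1 z"
  by (simp add: bump_def power2_eq_square max_mult_distrib_left algebra_simps)

lemma GDERIV_bump_square: "GDERIV (\<lambda>x. (bump r (x - x0))\<^sup>2) x :> (- 4 * bump r (x - x0)) *\<^sub>R (x - x0)"
proof -
  have pos_square: "DERIV (\<lambda>t. (max 0 t)\<^sup>2) t :> 2 * max 0 t" for t :: real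
  proof -
    consider "t < 0" | "t = 0" | "t > 0" by linarith
    then show ?thesis
    proof cases
      case 1
      have "DERIV (\<lambda>t. 0) t :> 2 * max 0 t" using 1 by simp
      then show ?thesis
        by (rule DERIV_cong_ev[THEN iffD1, rotated -1, OF _ refl _ refl])
           (use 1 in \<open>auto simp: eventually_nhds intro!: exI[of _ "{..<0}"]\<close>)
    next
      case 2
      have "((\<lambda>t. (max 0 t)\<^sup>2) has_derivative (\<lambda>_. 0)) (at (0::real))"
        by (rule has_derivative_zero_if_quadratic[where K = 1]) (auto simp: max_def)
      then show ?thesis
        using 2 by (auto simp: has_field_derivative_def elim!: has_derivative_eq_rhs)
    next
      case 3
      have "DERIV (\<lambda>t. t\<^sup>2) t :> 2 * max 0 t" using 3 by (auto intro!: derivative_eq_intros)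
      then show ?thesis
        by (rule DERIV_cong_ev[THEN iffD1, rotated -1, OF _ refl _ refl])
           (use 3 in \<open>auto simp: eventually_nhds intro!: exI[of _ "{0<..}"]\<close>)
    qed
  qed
  have "GDERIV (\<lambda>x. r\<^sup>2 - (x - x0) \<bullet> (x - x0)) x :> (-2) *\<^sub>R (x - x0)"
    unfolding gderiv_def by (auto intro!: derivative_eq_intros simp: inner_commute algebra_simps)
  from GDERIV_DERIV_compose[OF this pos_square] show ?thesis
    by (simp add: bump_def)
qed

text \<open>After the substitution x = x0 + r z, the terms with \<tau> and \<kappa> carry the factor
  r^3 and the term with \<open>K\<close> carries r^4. A small \<tau> and a small radius therefore
  let the negative term dominate, with a choice that is uniform in \<open>x0\<close>.\<close>

lemma bump_balance:
  fixes e :: "'a::euclidean_space"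
  assumes "norm e = 1" "\<kappa> > 0"
  obtains \<tau> r0 where "\<tau> > 0" "r0 > 0"
    "\<And>r x0. 0 < r \<Longrightarrow> r \<le> r0 \<Longrightarrow>
      integrable lborel (\<lambda>x. bump r (x - x0) * (\<tau> * norm (x - x0) - \<kappa> * max 0 ((x - x0) \<bullet> e) + K * bump r (x - x0))) \<and>
      (LINT x|lborel. bump r (x - x0) * (\<tau> * norm (x - x0) - \<kappa> * max 0 ((x - x0) \<bullet> e) + K * bump r (x - x0))) < 0"
proof -
  define A1 where "A1 = (\<lambda>z::'a. bump 1 z * max 0 (z \<bullet> e))"
  define A2 where "A2 = (\<lambda>z::'a. bump 1 z * norm z)"
  define A3 where "A3 = (\<lambda>z::'a. bump 1 z * bump 1 z)"
  have int: "integrable lborel k" if "continuous_on UNIV k" "\<And>z. 1 \<le> norm z \<Longrightarrow> k z = 0" for k :: "'a \<Rightarrow> real"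
  proof -
    have "integrable lborel (\<lambda>x. indicator (cball 0 1) x *\<^sub>R k x)"
      using that by (intro borel_integrable_compact) (auto intro: continuous_on_subset)
    moreover have "indicator (cball 0 1) x *\<^sub>R k x = k x" for x using that(2)[of x] by (auto simp: indicator_def)
    ultimately show ?thesis by (simp only:)
  qed
  have i: "integrable lborel A1" "integrable lborel A2" "integrable lborel A3"
    unfolding A1_def A2_def A3_def by (intro int continuous_intros; simp add: bump_eq_0)+
  define a1 where "a1 = (LINT z|lborel. A1 z)"
  define a2 where "a2 = (LINT z|lborel. A2 z)"
  define a3 where "a3 = (LINT z|lborel. A3 z)"
  have "a2 \<ge> 0" unfolding a2_def A2_def by (intro integral_nonneg_AE) (auto simp: bump_nonneg)
  have "a1 > 0"
  proof -
    \<comment> \<open>On this ball the component along \<open>e\<close> is at least 1/4 and the norm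
      at most 3/4, so \<open>bump 1\<close> is at least 7/16; the product gives 7/64.\<close>
    let ?S = "ball ((1/2) *\<^sub>R e) (1/4)"
    have ee: "e \<bullet> e = 1" using assms(1) by (simp add: norm_eq_sqrt_inner)
    have *: "indicator ?S z *\<^sub>R (7/64) \<le> A1 z" for z :: 'a
    proof (cases "z \<in> ?S")
      case True
      define w where "w = z - (1/2) *\<^sub>R e"
      have w: "norm w < 1/4" "z = w + (1/2) *\<^sub>R e"
        using True by (auto simp: w_def dist_norm norm_minus_commute)
      have "\<bar>w \<bullet> e\<bar> \<le> norm w" using Cauchy_Schwarz_ineq2[of w e] assms(1) by simp
      then have 1: "z \<bullet> e \<ge> 1/4" using w(1) ee by (simp add: w(2) inner_add_left)
      have "norm z \<le> norm w + norm ((1/2) *\<^sub>R e)" unfolding w(2) by (rule norm_triangle_ineq)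
      also have "\<dots> \<le> 3/4" using w(1) assms(1) by simp
      finally have "(norm z)\<^sup>2 \<le> (3/4)\<^sup>2" by (intro power_mono) auto
      then have "z \<bullet> z \<le> 9/16" by (simp add: power2_norm_eq_inner power_divide)
      then have 2: "bump 1 z \<ge> 7/16" by (simp add: bump_def le_max_iff_disj)
      have "(7/16) * (1/4) \<le> bump 1 z * max 0 (z \<bullet> e)" using 1 2 by (intro mult_mono) auto
      then show ?thesis using True by (simp add: A1_def)
    qed (simp add: A1_def bump_nonneg)
    have "0 < measure lborel ?S * (7/64)"
      using content_ball_pos[of "1/4" "(1/2) *\<^sub>R e"] by simp
    also have "\<dots> = (LINT z|lborel. indicator ?S z *\<^sub>R (7/64))" by simp
    also have "\<dots> \<le> a1" unfolding a1_def
      using emeasure_lborel_ball_finite[of "(1/2) *\<^sub>R e" "1/4"]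
      by (intro integral_mono i * integrableI_bounded_set_indicator[where B = "7/64"]) auto
    finally show ?thesis .
  qed
  \<comment> \<open>Each choice keeps its error term below a quarter of the main term
    \<open>\<kappa> * a1\<close>. The added 1 keeps the denominators positive.\<close>
  define \<tau> where "\<tau> = \<kappa> * a1 / (4 * (a2 + 1))"
  define r0 where "r0 = \<kappa> * a1 / (4 * (\<bar>K\<bar> * \<bar>a3\<bar> + 1))"
  have \<tau>: "\<tau> > 0" "\<tau> * a2 \<le> \<kappa> * a1 / 4"
  proof -
    show "\<tau> > 0" using \<open>a1 > 0\<close> \<open>a2 \<ge> 0\<close> assms by (simp add: \<tau>_def)
    then have "\<tau> * a2 \<le> \<tau> * (a2 + 1)" by simp
    also have "\<dots> = \<kappa> * a1 / 4"
    proof -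
      have "a2 + 1 \<noteq> 0" using \<open>a2 \<ge> 0\<close> by simp
      then show ?thesis unfolding \<tau>_def
        by (metis nonzero_mult_divide_mult_cancel_right times_divide_eq_left)
    qed
    finally show "\<tau> * a2 \<le> \<kappa> * a1 / 4" .
  qed
  have r0: "r0 > 0" "r0 * (\<bar>K\<bar> * \<bar>a3\<bar>) \<le> \<kappa> * a1 / 4"
  proof -
    have p: "\<bar>K\<bar> * \<bar>a3\<bar> + 1 > 0" by (simp add: add_nonneg_pos)
    then show "r0 > 0" using \<open>a1 > 0\<close> assms by (simp add: r0_def)
    then have "r0 * (\<bar>K\<bar> * \<bar>a3\<bar>) \<le> r0 * (\<bar>K\<bar> * \<bar>a3\<bar> + 1)" by simp
    also have "\<dots> = \<kappa> * a1 / 4"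
    proof -
      have "\<bar>K\<bar> * \<bar>a3\<bar> + 1 \<noteq> 0" using p by simp
      then show ?thesis unfolding r0_def
        by (metis nonzero_mult_divide_mult_cancel_right times_divide_eq_left)
    qed
    finally show "r0 * (\<bar>K\<bar> * \<bar>a3\<bar>) \<le> \<kappa> * a1 / 4" .
  qed
  show ?thesis
  proof (rule that[OF \<tau>(1) r0(1)])
    fix r :: real and x0 :: 'a assume r: "0 < r" "r \<le> r0"
    let ?m = "\<lambda>x. bump r (x - x0) * (\<tau> * norm (x - x0) - \<kappa> * max 0 ((x - x0) \<bullet> e) + K * bump r (x - x0))"
    have meas: "?m \<in> borel_measurable borel"
      by (intro borel_measurable_continuous_onI continuous_intros)
    have scale: "?m (x0 + r *\<^sub>R z) = r ^ 3 * (\<tau> * A2 z - \<kappa> * A1 z + (K * r) * A3 z)" for z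
    proof -
      have "max 0 (r * (z \<bullet> e)) = r * max 0 (z \<bullet> e)" using r by (simp add: max_mult_distrib_left)
      then show ?thesis
        using r by (simp add: bump_scaleR A1_def A2_def A3_def algebra_simps power2_eq_square power3_eq_cube)
    qed
    have "integrable lborel (\<lambda>z. ?m (x0 + r *\<^sub>R z))"
      unfolding scale using i by auto
    then have "integrable lborel ?m"
      using lborel_integral_affine_euclidean(1)[of r ?m x0] meas r by simp
    moreover have "(LINT x|lborel. ?m x) = r ^ DIM('a) * (LINT z|lborel. ?m (x0 + r *\<^sub>R z))"
      using lborel_integral_affine_euclidean(2)[of r ?m x0] meas r by simp
    moreover have "(LINT z|lborel. ?m (x0 + r *\<^sub>R z)) = r ^ 3 * (\<tau> * a2 - \<kappa> * a1 + (K * r) * a3)"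
      unfolding scale a1_def a2_def a3_def using i by simp
    moreover have "\<tau> * a2 - \<kappa> * a1 + (K * r) * a3 < 0"
    proof -
      have "(K * r) * a3 \<le> \<bar>(K * r) * a3\<bar>" by simp
      also have "\<dots> = r * (\<bar>K\<bar> * \<bar>a3\<bar>)" using r by (simp add: abs_mult)
      also have "\<dots> \<le> r0 * (\<bar>K\<bar> * \<bar>a3\<bar>)" using r by (intro mult_right_mono) auto
      finally have "(K * r) * a3 \<le> \<kappa> * a1 / 4" using r0(2) by linarith
      moreover have "\<kappa> * a1 > 0" using \<open>a1 > 0\<close> assms by simp
      ultimately show ?thesis using \<tau>(2) by linarith
    qed
    ultimately show "integrable lborel ?m \<and> (LINT x|lborel. ?m x) < 0"
      using r by (simp add: mult_pos_neg)
  qed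
qed

section \<open>Absence of kinks\<close>

context ball_minimizer
begin

lemma F_lipschitz:
  obtains K where "K > 0" "\<And>a b. 0 \<le> a \<Longrightarrow> a \<le> M \<Longrightarrow> 0 \<le> b \<Longrightarrow> b \<le> M \<Longrightarrow> \<bar>F b - F a\<bar> \<le> K * \<bar>b - a\<bar>"
proof -
  obtain K where "K > 0" "\<And>t. 0 \<le> t \<Longrightarrow> t \<le> M \<Longrightarrow> \<bar>f t\<bar> \<le> K" using bounded_on_interval[OF f_cont] by metis
  then show ?thesis using primitive_lipschitz[OF f_cont] that by metis
qed

lemma u_bounded: obtains M where "M > 0" "\<And>x. x \<in> cball 0 R \<Longrightarrow> u x \<le> M"
proof -
  obtain M where "M > 0" "\<forall>y\<in>u ` cball 0 R. norm y \<le> M"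
    using compact_imp_bounded[OF compact_continuous_image[OF u_cont compact_cball]] bounded_pos by metis
  then show ?thesis by (intro that[of M]) (auto dest!: bspec simp: abs_le_iff)
qed

lemma integrand_increment:
  assumes "\<bar>F b - F a\<bar> \<le> K * \<bar>b - a\<bar>"
  shows "(G (norm q) - F b) - (G (norm p) - F a) \<le> flux g q \<bullet> (q - p) + K * \<bar>b - a\<bar>"
  using flux_tangent[of q p] assms by linarith

lemma integrable_u: "set_integrable lborel B (\<lambda>x. G (norm (Du x)) - F (u x))"
  using energy_le_cut(2)[where ?h1.0 = "\<lambda>_. 0" and ?D1.0 = "\<lambda>_. 0" and ?h2.0 = "\<lambda>_. 0" and ?D2.0 = "\<lambda>_. 0" and \<eta> = "\<lambda>_. 0" and D\<eta> = "\<lambda>_. 0",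
      OF cut_data_empty empty_subsetI cut_data_empty empty_subsetI
        continuous_on_const continuous_on_const GDERIV_const refl] u_nonneg
  by simp

lemma subtract_cut:
  assumes "cut_data C h D" "C \<subseteq> B" "\<And>x. x \<in> B \<Longrightarrow> 0 \<le> u x - pos_cut C h x"
  shows "energy u Du \<le> energy (\<lambda>x. u x - pos_cut C h x) (\<lambda>x. Du x - grad_cut C h D x)"
    and "set_integrable lborel B (\<lambda>x. G (norm (Du x - grad_cut C h D x)) - F (u x - pos_cut C h x))"
  using energy_le_cut[where ?h2.0 = "\<lambda>_. 0" and ?D2.0 = "\<lambda>_. 0" and \<eta> = "\<lambda>_. 0" and D\<eta> = "\<lambda>_. 0",
      OF assms(1,2) cut_data_empty empty_subsetI continuous_on_const continuous_on_const GDERIV_const refl] assms(3)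
  by simp_all

lemma add_cut:
  assumes "cut_data C h D" "C \<subseteq> B"
  shows "energy u Du \<le> energy (\<lambda>x. u x + pos_cut C h x) (\<lambda>x. Du x + grad_cut C h D x)"
    and "set_integrable lborel B (\<lambda>x. G (norm (Du x + grad_cut C h D x)) - F (u x + pos_cut C h x))"
  using energy_le_cut[where ?h1.0 = "\<lambda>_. 0" and ?D1.0 = "\<lambda>_. 0" and \<eta> = "\<lambda>_. 0" and D\<eta> = "\<lambda>_. 0",
      OF cut_data_empty empty_subsetI assms continuous_on_const continuous_on_const GDERIV_const refl] u_nonneg
  by simp_all

text \<open>The minimum of \<open>u\<close> and \<open>u - h\<close> is a minimiser in the limit.  Testing it with \<open>s * bump\<^sup>2\<close> and \<open>u\<close> itself
  with \<open>- s * bump\<^sup>2\<close>, the flux jump contributes \<open>- 4 * \<bar>s\<bar> * \<bar>\<kappa>\<bar> * bump * ((x - x0) \<bullet> e)\<^sup>+\<close>, which dominates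
  all other terms on small balls.\<close>

lemma no_kink:
  assumes cd: "cut_data C h D" "C \<subseteq> B"
    and nonneg: "\<And>x. x \<in> B \<Longrightarrow> 0 \<le> u x - pos_cut C h x"
    and swap: "energy (\<lambda>x. u x - pos_cut C h x) (\<lambda>x. Du x - grad_cut C h D x) \<le> energy u Du"
    and x0: "x0 \<in> B" "x0 \<in> closure C" "h x0 = 0" "u x0 > 0"
    and half: "\<delta> > 0" "\<And>x. x \<in> ball x0 \<delta> \<Longrightarrow> (x \<in> C \<and> h x > 0) \<longleftrightarrow> (x - x0) \<bullet> e > 0"
    and jump: "norm e = 1" "flux g (Du x0 - D x0) - flux g (Du x0) = (- \<kappa>) *\<^sub>R e"
  shows "\<kappa> = 0"
proof (rule ccontr)
  assume "\<kappa> \<noteq> 0"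
  define uC where "uC = (\<lambda>x. u x - pos_cut C h x)"
  define DC where "DC = (\<lambda>x. Du x - grad_cut C h D x)"
  obtain M where M: "M > 0" "\<And>x. x \<in> cball 0 R \<Longrightarrow> u x \<le> M" by (rule u_bounded, rule that)
  obtain K where K: "K > 0" "\<And>a b. 0 \<le> a \<Longrightarrow> a \<le> M + 1 \<Longrightarrow> 0 \<le> b \<Longrightarrow> b \<le> M + 1 \<Longrightarrow> \<bar>F b - F a\<bar> \<le> K * \<bar>b - a\<bar>"
    by (rule F_lipschitz[of "M + 1"], rule that)
  \<comment> \<open>The coefficient is \<open>K / 2\<close> because the two increments of
    \<open>F\<close> together cost \<open>2 * K * s0\<close> times the squared bump, and
    \<open>4 * s0\<close> is factored out below.\<close>
  obtain \<tau> r0 where \<tau>: "\<tau> > 0" and r0: "r0 > 0" and bal: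
    "\<And>r x0. 0 < r \<Longrightarrow> r \<le> r0 \<Longrightarrow>
      integrable lborel (\<lambda>x. bump r (x - x0) * (\<tau> * norm (x - x0) - \<bar>\<kappa>\<bar> * max 0 ((x - x0) \<bullet> e) + K / 2 * bump r (x - x0))) \<and>
      (LINT x|lborel. bump r (x - x0) * (\<tau> * norm (x - x0) - \<bar>\<kappa>\<bar> * max 0 ((x - x0) \<bullet> e) + K / 2 * bump r (x - x0))) < 0"
  proof -
    have "\<bar>\<kappa>\<bar> > 0" using \<open>\<kappa> \<noteq> 0\<close> by simp
    from bump_balance[OF jump(1) this, of "K / 2"] show ?thesis using that by blast
  qed
  obtain \<rho> where \<rho>: "\<rho> > 0"
    "\<And>q. dist q (Du x0) < \<rho> \<Longrightarrow> norm (flux g q - flux g (Du x0)) < \<tau> / 2"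
    "\<And>q. dist q (Du x0 - D x0) < \<rho> \<Longrightarrow> norm (flux g q - flux g (Du x0 - D x0)) < \<tau> / 2"
  proof -
    have "\<exists>\<rho>>0. \<forall>q. dist q p < \<rho> \<longrightarrow> norm (flux g q - flux g p) < \<tau> / 2" for p :: "real^'n"
      using isCont_flux[of p] half_gt_zero[OF \<tau>] unfolding continuous_at_eps_delta dist_norm by blast
    from this[of "Du x0"] this[of "Du x0 - D x0"] obtain \<rho>1 \<rho>2 where
      "\<rho>1 > 0" "\<And>q. dist q (Du x0) < \<rho>1 \<Longrightarrow> norm (flux g q - flux g (Du x0)) < \<tau> / 2"
      "\<rho>2 > 0" "\<And>q. dist q (Du x0 - D x0) < \<rho>2 \<Longrightarrow> norm (flux g q - flux g (Du x0 - D x0)) < \<tau> / 2"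
      by blast
    then show ?thesis using that[of "min \<rho>1 \<rho>2"] by simp
  qed
  have clC: "closure C \<subseteq> cball 0 R"
    using closure_mono[OF cd(2)] R_pos by (simp add: closure_ball)
  have C_cont: "continuous_on (closure C) h" "continuous_on (closure C) D" using cd(1) by (auto simp: cut_data_def)
  have near: "\<exists>d>0. \<forall>x\<in>S. dist x x0 < d \<longrightarrow> dist (k x) (k x0) < \<epsilon>"
    if "continuous_on S k" "x0 \<in> S" "\<epsilon> > 0" for S and k :: "real^'n \<Rightarrow> 'b::metric_space" and \<epsilon>
    using that unfolding continuous_on_iff by blast
  have u4: "u x0 / 4 > 0" using x0(4) by simp
  have x0B: "x0 \<in> cball 0 R" using x0 by auto
  obtain d1 where d1: "d1 > 0" "\<And>x. x \<in> cball 0 R \<Longrightarrow> dist x x0 < d1 \<Longrightarrow> dist (Du x) (Du x0) < \<rho> / 2"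
    using near[OF Du_cont x0B, of "\<rho> / 2"] half_gt_zero[OF \<rho>(1)] by blast
  have cDD: "continuous_on (closure C) (\<lambda>x. Du x - D x)"
    by (intro continuous_on_diff continuous_on_subset[OF Du_cont clC] C_cont(2))
  obtain d2 where d2: "d2 > 0" "\<And>x. x \<in> closure C \<Longrightarrow> dist x x0 < d2 \<Longrightarrow> dist (Du x - D x) (Du x0 - D x0) < \<rho> / 2"
    using near[OF cDD x0(2), of "\<rho> / 2"] half_gt_zero[OF \<rho>(1)] by blast
  obtain d3 where d3: "d3 > 0" "\<And>x. x \<in> cball 0 R \<Longrightarrow> dist x x0 < d3 \<Longrightarrow> dist (u x) (u x0) < u x0 / 4"
    using near[OF u_cont x0B, of "u x0 / 4"] u4 by blast
  obtain d4 where d4: "d4 > 0" "\<And>x. x \<in> closure C \<Longrightarrow> dist x x0 < d4 \<Longrightarrow> dist (h x) (h x0) < u x0 / 4"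
    using near[OF C_cont(1) x0(2), of "u x0 / 4"] u4 by blast
  have "R - norm x0 > 0" using x0 by simp
  define r where "r = min r0 (min \<delta> (min d1 (min d2 (min d3 (min d4 (R - norm x0))))))"
  have r: "r > 0" "r \<le> r0" "r \<le> \<delta>" "r \<le> d1" "r \<le> d2" "r \<le> d3" "r \<le> d4" "r \<le> R - norm x0"
    by (simp_all only: r_def min_less_iff_conj min_le_iff_disj order_refl simp_thms
        r0 half(1) d1(1) d2(1) d3(1) d4(1) \<open>R - norm x0 > 0\<close>)
  have rB: "ball x0 r \<subseteq> B"
  proof
    fix x assume "x \<in> ball x0 r"
    then have "norm (x - x0) < r" by (simp add: dist_norm norm_minus_commute)
    then show "x \<in> B" using r(8) norm_triangle_sub[of x x0] by simp
  qed
  \<comment> \<open>The three bounds keep the arguments of \<open>F\<close> below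
    \<open>M + 1\<close>, the perturbed functions nonnegative, and the gradient of the perturbation
    below \<open>\<rho> / 2\<close>.\<close>
  define s0 where "s0 = Min {1 / r ^ 4, u x0 / 4 / r ^ 4, \<rho> / 2 / (4 * r ^ 3)}"
  have s0: "s0 > 0" "s0 * r ^ 4 \<le> 1" "s0 * r ^ 4 \<le> u x0 / 4" "s0 * (4 * r ^ 3) \<le> \<rho> / 2"
  proof -
    show "s0 > 0" using r x0 \<rho>(1) by (simp add: s0_def)
    have "s0 \<le> 1 / r ^ 4" "s0 \<le> u x0 / 4 / r ^ 4" "s0 \<le> \<rho> / 2 / (4 * r ^ 3)"
      by (simp_all add: s0_def min_le_iff_disj)
    then show "s0 * r ^ 4 \<le> 1" "s0 * r ^ 4 \<le> u x0 / 4" "s0 * (4 * r ^ 3) \<le> \<rho> / 2"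
      using r(1) by (simp_all add: pos_le_divide_eq)
  qed
  \<comment> \<open>With the sign opposite to that of \<kappa>, the flux jump lowers the energy in
    either case.\<close>
  define s where "s = - sgn \<kappa> * s0"
  have s: "\<bar>s\<bar> = s0" "s * \<kappa> = - (s0 * \<bar>\<kappa>\<bar>)"
    using s0(1) \<open>\<kappa> \<noteq> 0\<close> by (auto simp: s_def abs_mult sgn_if)
  define \<eta> where "\<eta> = (\<lambda>x. s * (bump r (x - x0))\<^sup>2)"
  define D\<eta> where "D\<eta> = (\<lambda>x. s *\<^sub>R ((- 4 * bump r (x - x0)) *\<^sub>R (x - x0)))"
  have \<eta>_grad: "GDERIV \<eta> x :> D\<eta> x" for x
  proof -
    have "GDERIV (\<lambda>x. s * (bump r (x - x0))\<^sup>2) x :> s *\<^sub>R ((- 4 * bump r (x - x0)) *\<^sub>R (x - x0)) + (bump r (x - x0))\<^sup>2 *\<^sub>R 0"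
      by (rule GDERIV_mult[OF GDERIV_const GDERIV_bump_square])
    then show ?thesis by (simp add: \<eta>_def D\<eta>_def)
  qed
  have \<eta>_cont: "continuous_on A \<eta>" and D\<eta>_cont: "continuous_on A D\<eta>" for A
    unfolding \<eta>_def D\<eta>_def by (intro continuous_intros)+
  have outside: "\<eta> x = 0" "D\<eta> x = 0" if "x \<notin> ball x0 r" for x
    using bump_eq_0[of r "x - x0"] r(1) that by (auto simp: \<eta>_def D\<eta>_def dist_norm norm_minus_commute)
  have \<eta>_abs: "\<bar>\<eta> x\<bar> = s0 * (bump r (x - x0))\<^sup>2" for x
    using s(1) by (simp add: \<eta>_def abs_mult)
  have \<eta>_small: "\<bar>\<eta> x\<bar> \<le> s0 * r ^ 4" for x
  proof -
    have "(bump r (x - x0))\<^sup>2 \<le> (r\<^sup>2)\<^sup>2" using bump_le bump_nonneg by (intro power_mono)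
    then show ?thesis using s0(1) by (simp add: \<eta>_abs mult_left_mono flip: power_mult)
  qed
  have D\<eta>_norm: "norm (D\<eta> x) = s0 * (4 * bump r (x - x0) * norm (x - x0))" for x
    using s(1) bump_nonneg[of r "x - x0"] by (simp add: D\<eta>_def abs_mult)
  have D\<eta>_small: "norm (D\<eta> x) \<le> \<rho> / 2" for x
  proof (cases "x \<in> ball x0 r")
    case True
    then have "norm (x - x0) \<le> r" by (simp add: dist_norm norm_minus_commute)
    then have "bump r (x - x0) * norm (x - x0) \<le> r\<^sup>2 * r"
      using bump_le bump_nonneg by (intro mult_mono) auto
    then have "s0 * (4 * bump r (x - x0) * norm (x - x0)) \<le> s0 * (4 * r ^ 3)"
      using s0(1) by (simp add: power2_eq_square power3_eq_cube)
    then show ?thesis using s0(4) unfolding D\<eta>_norm by linarith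
  qed (use outside \<rho>(1) in simp)
  have uC_half: "uC x \<ge> u x0 / 2" if "x \<in> ball x0 r" for x
  proof -
    have "x \<in> cball 0 R" "dist x x0 < d3" "dist x x0 < d4" using that rB r by (auto simp: dist_commute)
    then have *: "\<bar>u x - u x0\<bar> < u x0 / 4" "x \<in> C \<Longrightarrow> \<bar>h x\<bar> < u x0 / 4"
      using d3(2)[of x] d4(2)[of x] closure_subset[of C] x0(3) by (auto simp: dist_real_def)
    show ?thesis
    proof (cases "x \<in> C")
      case True
      then have "pos_cut C h x \<le> u x0 / 4" using *(2) x0(4) by (auto simp: pos_cut_def)
      then show ?thesis using *(1) unfolding uC_def by linarith
    next
      case False
      then have "uC x = u x" by (simp add: uC_def pos_cut_def)
      then show ?thesis using *(1) x0(4) by linarith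
    qed
  qed
  have uC_le: "uC x \<le> u x" for x using pos_cut_nonneg[of C h x] by (simp add: uC_def)
  have pos: "0 \<le> uC x" "0 \<le> uC x + \<eta> x" "0 \<le> u x - \<eta> x" "u x \<le> M" if "x \<in> B" for x
  proof -
    show "0 \<le> uC x" using nonneg[OF that] by (simp add: uC_def)
    show "u x \<le> M" using M(2) that by auto
    have "\<bar>\<eta> x\<bar> \<le> uC x"
    proof (cases "x \<in> ball x0 r")
      case True
      then show ?thesis using uC_half[OF True] \<eta>_small[of x] s0(3) x0(4) by linarith
    next
      case False
      then show ?thesis using outside(1)[OF False] \<open>0 \<le> uC x\<close> by simp
    qed
    then show "0 \<le> uC x + \<eta> x" "0 \<le> u x - \<eta> x"
      using uC_le[of x] by linarith+
  qed
  have bd\<eta>: "\<eta> x = 0" if "norm x = R" for x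
  proof (rule outside(1))
    have "x \<notin> B" using that by simp
    then show "x \<notin> ball x0 r" using rB by blast
  qed
  have E1: "energy u Du \<le> energy (\<lambda>x. uC x + \<eta> x) (\<lambda>x. DC x + D\<eta> x)"
    "set_integrable lborel B (\<lambda>x. G (norm (DC x + D\<eta> x)) - F (uC x + \<eta> x))"
    using energy_le_cut[OF cd cut_data_empty empty_subsetI \<eta>_cont D\<eta>_cont \<eta>_grad bd\<eta>, of "\<lambda>_. 0" "\<lambda>_. 0"] pos(2)
    by (simp_all add: uC_def DC_def)
  have E2: "energy u Du \<le> energy (\<lambda>x. u x - \<eta> x) (\<lambda>x. Du x - D\<eta> x)"
    "set_integrable lborel B (\<lambda>x. G (norm (Du x - D\<eta> x)) - F (u x - \<eta> x))"
    using energy_le_cut[OF cut_data_empty empty_subsetI cut_data_empty empty_subsetI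
        continuous_on_minus[OF \<eta>_cont] continuous_on_minus[OF D\<eta>_cont] GDERIV_minus[OF \<eta>_grad], of "\<lambda>_. 0" "\<lambda>_. 0" "\<lambda>_. 0" "\<lambda>_. 0"] pos(3) bd\<eta>
    by simp_all
  note E3 = subtract_cut(2)[OF cd nonneg]
  note E4 = integrable_u
  \<comment> \<open>The increments of both minimisers are added, with opposite perturbations, so
    that the common value \<open>flux g (Du x0)\<close> cancels and only the jump across the kink is
    left to first order.\<close>
  let ?\<Delta> = "\<lambda>x. ((G (norm (DC x + D\<eta> x)) - F (uC x + \<eta> x)) - (G (norm (DC x)) - F (uC x))) +
     ((G (norm (Du x - D\<eta> x)) - F (u x - \<eta> x)) - (G (norm (Du x)) - F (u x)))"
  let ?m = "\<lambda>x. bump r (x - x0) * (\<tau> * norm (x - x0) - \<bar>\<kappa>\<bar> * max 0 ((x - x0) \<bullet> e) + K / 2 * bump r (x - x0))"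
  have split: "set_integrable lborel B (\<lambda>x. (a x - b x) + (c x - d x))"
      "(LINT x:B|lborel. (a x - b x) + (c x - d x))
        = ((LINT x:B|lborel. a x) - (LINT x:B|lborel. b x)) + ((LINT x:B|lborel. c x) - (LINT x:B|lborel. d x))"
    if "set_integrable lborel B a" "set_integrable lborel B b" "set_integrable lborel B c" "set_integrable lborel B d"
    for a b c d :: "real ^ 'n \<Rightarrow> real"
    using that by (simp_all add: set_integral_add set_integral_diff)
  have int\<Delta>: "set_integrable lborel B ?\<Delta>"
    unfolding uC_def DC_def by (rule split(1)[OF E1(2)[unfolded uC_def DC_def] E3 E2(2) E4])
  have "(LINT x:B|lborel. ?\<Delta> x) = (energy (\<lambda>x. uC x + \<eta> x) (\<lambda>x. DC x + D\<eta> x) - energy uC DC)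
     + (energy (\<lambda>x. u x - \<eta> x) (\<lambda>x. Du x - D\<eta> x) - energy u Du)"
    unfolding energy_def uC_def DC_def by (rule split(2)[OF E1(2)[unfolded uC_def DC_def] E3 E2(2) E4])
  moreover have "energy uC DC \<le> energy u Du" using swap by (simp add: uC_def DC_def)
  ultimately have "0 \<le> (LINT x:B|lborel. ?\<Delta> x)" using E1(1) E2(1) by linarith
  also have "\<dots> \<le> (LINT x|lborel. (4 * s0) * ?m x)"
    unfolding set_lebesgue_integral_def
  proof (rule integral_mono)
    show "integrable lborel (\<lambda>x. indicator B x *\<^sub>R ?\<Delta> x)" using int\<Delta> by (simp add: set_integrable_def)
    show "integrable lborel (\<lambda>x. (4 * s0) * ?m x)" using bal[OF r(1,2), of x0] by simp
    fix x
    show "indicator B x *\<^sub>R ?\<Delta> x \<le> (4 * s0) * ?m x"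
    proof (cases "x \<in> ball x0 r")
      case False
      then have "bump r (x - x0) = 0" using r(1) by (simp add: bump_eq_0 dist_norm norm_minus_commute)
      then show ?thesis using outside[OF False] by simp
    next
      case True
      have xB: "x \<in> B" using True rB by auto
      define y where "y = x - x0"
      define b where "b = bump r y"
      have b: "b \<ge> 0" by (simp add: b_def bump_nonneg)
      have D\<eta>: "D\<eta> x = (- 4 * s * b) *\<^sub>R y" by (simp add: D\<eta>_def b_def y_def)
      have "\<bar>F (uC x + \<eta> x) - F (uC x)\<bar> \<le> K * \<bar>(uC x + \<eta> x) - uC x\<bar>"
        using pos[OF xB] uC_le[of x] \<eta>_small[of x] s0(2) by (intro K(2)) auto
      from integrand_increment[OF this, of "DC x + D\<eta> x" "DC x"]
      have 1: "(G (norm (DC x + D\<eta> x)) - F (uC x + \<eta> x)) - (G (norm (DC x)) - F (uC x))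
         \<le> flux g (DC x + D\<eta> x) \<bullet> D\<eta> x + K * \<bar>\<eta> x\<bar>" by simp
      have "\<bar>F (u x - \<eta> x) - F (u x)\<bar> \<le> K * \<bar>(u x - \<eta> x) - u x\<bar>"
        using pos[OF xB] uC_le[of x] \<eta>_small[of x] s0(2) by (intro K(2)) auto
      from integrand_increment[OF this, of "Du x - D\<eta> x" "Du x"]
      have 2: "(G (norm (Du x - D\<eta> x)) - F (u x - \<eta> x)) - (G (norm (Du x)) - F (u x))
         \<le> - (flux g (Du x - D\<eta> x) \<bullet> D\<eta> x) + K * \<bar>\<eta> x\<bar>" by simp
      have dx: "dist x x0 < r" using True by (simp add: dist_commute)
      have Du: "dist (Du x) (Du x0) < \<rho> / 2" using d1(2)[of x] xB dx r by auto
      have "norm (flux g (Du x - D\<eta> x) - flux g (Du x0)) < \<tau> / 2"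
      proof (rule \<rho>(2))
        have "dist (Du x - D\<eta> x) (Du x0) \<le> dist (Du x) (Du x0) + norm (D\<eta> x)"
          using norm_triangle_ineq4[of "Du x - Du x0" "D\<eta> x"] by (simp add: dist_norm algebra_simps)
        then show "dist (Du x - D\<eta> x) (Du x0) < \<rho>" using Du D\<eta>_small[of x] by linarith
      qed
      \<comment> \<open>The limiting difference of the fluxes of \<open>uC\<close> and
        \<open>u\<close> on the two sides of the kink.\<close>
      moreover define j where "j = (if y \<bullet> e > 0 then (- \<kappa>) *\<^sub>R e else 0)"
      have "norm (flux g (DC x + D\<eta> x) - flux g (Du x0) - j) < \<tau> / 2"
      proof (cases "y \<bullet> e > 0")
        case True
        then have xC: "x \<in> C" "h x > 0" using half(2)[of x] dx r by (auto simp: y_def dist_commute)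
        have 3: "flux g (DC x + D\<eta> x) - flux g (Du x0) - j = flux g (DC x + D\<eta> x) - flux g (Du x0 - D x0)"
          using jump(2) True by (simp add: j_def algebra_simps)
        have "dist (Du x - D x) (Du x0 - D x0) < \<rho> / 2"
          using d2(2)[of x] xC closure_subset[of C] dx r by auto
        moreover have "dist (DC x + D\<eta> x) (Du x0 - D x0) \<le> dist (Du x - D x) (Du x0 - D x0) + norm (D\<eta> x)"
          using norm_triangle_ineq[of "Du x - D x - (Du x0 - D x0)" "D\<eta> x"] xC
          by (simp add: dist_norm algebra_simps DC_def grad_cut_def)
        ultimately have "dist (DC x + D\<eta> x) (Du x0 - D x0) < \<rho>" using D\<eta>_small[of x] by linarith
        then show ?thesis unfolding 3 by (rule \<rho>(3))
      next
        case False
        then have "\<not> (x \<in> C \<and> h x > 0)" using half(2)[of x] dx r by (auto simp: y_def dist_commute)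
        then have "DC x = Du x" by (auto simp: DC_def grad_cut_def)
        moreover have "dist (Du x + D\<eta> x) (Du x0) \<le> dist (Du x) (Du x0) + norm (D\<eta> x)"
          using norm_triangle_ineq[of "Du x - Du x0" "D\<eta> x"] by (simp add: dist_norm algebra_simps)
        ultimately have "dist (DC x + D\<eta> x) (Du x0) < \<rho>" using Du D\<eta>_small[of x] by simp
        from \<rho>(2)[OF this] show ?thesis using False by (simp add: j_def)
      qed
      ultimately have "norm ((flux g (DC x + D\<eta> x) - flux g (Du x0) - j) - (flux g (Du x - D\<eta> x) - flux g (Du x0))) \<le> \<tau>"
        using norm_triangle_ineq4[of "flux g (DC x + D\<eta> x) - flux g (Du x0) - j" "flux g (Du x - D\<eta> x) - flux g (Du x0)"]
        by linarith
      then have 4: "norm (flux g (DC x + D\<eta> x) - flux g (Du x - D\<eta> x) - j) \<le> \<tau>"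
        by (simp add: algebra_simps)
      have "(flux g (DC x + D\<eta> x) - flux g (Du x - D\<eta> x) - j) \<bullet> D\<eta> x \<le> \<tau> * norm (D\<eta> x)"
        using norm_cauchy_schwarz[of "flux g (DC x + D\<eta> x) - flux g (Du x - D\<eta> x) - j" "D\<eta> x"]
          mult_right_mono[OF 4, OF norm_ge_zero[of "D\<eta> x"]] by linarith
      then have "?\<Delta> x \<le> j \<bullet> D\<eta> x + \<tau> * norm (D\<eta> x) + 2 * (K * \<bar>\<eta> x\<bar>)"
        using 1 2 by (simp add: inner_diff_left)
      also have "j \<bullet> D\<eta> x = - (4 * s0 * b * (\<bar>\<kappa>\<bar> * max 0 (y \<bullet> e)))"
      proof (cases "y \<bullet> e > 0")
        case True
        have "j \<bullet> D\<eta> x = (s * \<kappa>) * (4 * b * (y \<bullet> e))"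
          using True by (simp add: j_def D\<eta> inner_commute mult_ac)
        then show ?thesis using True by (simp add: s(2))
      qed (simp add: j_def)
      also have "norm (D\<eta> x) = 4 * s0 * b * norm y" using D\<eta>_norm[of x] by (simp add: b_def y_def)
      also have "\<bar>\<eta> x\<bar> = s0 * b\<^sup>2" using \<eta>_abs[of x] by (simp add: b_def y_def)
      also have "- (4 * s0 * b * (\<bar>\<kappa>\<bar> * max 0 (y \<bullet> e))) + \<tau> * (4 * s0 * b * norm y) + 2 * (K * (s0 * b\<^sup>2)) = (4 * s0) * ?m x"
        unfolding b_def[symmetric] y_def[symmetric] by (simp add: algebra_simps power2_eq_square)
      finally show ?thesis using xB by simp
    qed
  qed
  also have "\<dots> = (4 * s0) * (LINT x|lborel. ?m x)" by simp
  also have "\<dots> < 0" using bal[OF r(1,2), of x0] s0(1) by (intro mult_pos_neg) auto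
  finally show False by simp
qed

end

section \<open>Reflections\<close>

definition reflect :: "'a::real_inner \<Rightarrow> real \<Rightarrow> 'a \<Rightarrow> 'a" where
  "reflect e c x = x - (2 * (x \<bullet> e - c)) *\<^sub>R e"

lemma linear_reflect_0: "linear (reflect e 0)"
  by (rule linearI) (simp_all add: reflect_def algebra_simps inner_add_left)

lemma continuous_on_reflect [continuous_intros]:
  "continuous_on A k \<Longrightarrow> continuous_on A (\<lambda>x. reflect e c (k x))"
  unfolding reflect_def by (intro continuous_intros)

text \<open>Gradients transform with the adjoint of the linear part; the reflections and dilations
  needed here are self-adjoint.\<close>

lemma GDERIV_compose_symmetric:
  fixes L :: "'a::euclidean_space \<Rightarrow> 'a"
  assumes "linear L" "\<And>x y. L x \<bullet> y = x \<bullet> L y" "\<And>x. T x = L x + a" "GDERIV v (T x) :> d"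
  shows "GDERIV (\<lambda>x. v (T x)) x :> L d"
proof -
  have "(L has_derivative L) (at x)"
    using assms(1) by (intro bounded_linear_imp_has_derivative) (simp add: linear_conv_bounded_linear)
  then have "((\<lambda>x. L x + a) has_derivative L) (at x)"
    by (intro has_derivative_add_const)
  moreover have "T = (\<lambda>x. L x + a)" using assms(3) by auto
  ultimately have "(T has_derivative L) (at x)" by simp
  from has_derivative_compose[OF this assms(4)[unfolded gderiv_def]]
  show ?thesis by (simp add: gderiv_def assms(2))
qed

context
  fixes e :: "'a::euclidean_space"
  assumes e: "norm e = 1"
begin

lemma inner_self_unit: "e \<bullet> e = 1"
  using e by (simp add: norm_eq_sqrt_inner)

lemma reflect_reflect: "reflect e c (reflect e c x) = x"
  by (simp add: reflect_def inner_diff_left inner_self_unit algebra_simps flip: scaleR_add_left)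

lemma reflect_inner: "reflect e c x \<bullet> e = 2 * c - x \<bullet> e"
  by (simp add: reflect_def inner_diff_left inner_self_unit)

lemma norm_reflect_0: "norm (reflect e 0 x) = norm x"
  by (simp add: norm_eq_sqrt_inner reflect_def inner_diff_left inner_diff_right inner_self_unit inner_commute)

lemma reflect_eq: "reflect e c x = reflect e 0 (x - (2 * c) *\<^sub>R e)"
  by (simp add: reflect_def inner_diff_left inner_self_unit algebra_simps flip: scaleR_add_left)

lemma norm_reflect: "norm (reflect e c x) = norm (x - (2 * c) *\<^sub>R e)"
  by (simp add: reflect_eq[of c] norm_reflect_0)

text \<open>The sign of \<open>c\<close> enters here: the origin is not beyond the hyperplane, so
  points beyond it move closer to the origin and the reflected cap stays in the ball.\<close>

lemma norm_reflect_le: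
  assumes "c \<ge> 0" "x \<bullet> e \<ge> c"
  shows "norm (reflect e c x) \<le> norm x"
proof -
  have "(norm (reflect e c x))\<^sup>2 = (norm x)\<^sup>2 - 4 * c * (x \<bullet> e - c)"
    by (simp add: norm_reflect power2_norm_eq_inner inner_diff_left inner_diff_right inner_self_unit
        inner_commute algebra_simps)
  also have "\<dots> \<le> (norm x)\<^sup>2" using assms by simp
  finally show ?thesis by simp
qed

lemma reflect_0_symmetric: "reflect e 0 x \<bullet> y = x \<bullet> reflect e 0 y"
  by (simp add: reflect_def inner_diff_left inner_diff_right inner_commute)

lemma GDERIV_reflect: "GDERIV v (reflect e c x) :> d \<Longrightarrow> GDERIV (\<lambda>x. v (reflect e c x)) x :> reflect e 0 d"
  by (rule GDERIV_compose_symmetric[OF linear_reflect_0 reflect_0_symmetric])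
     (auto simp: reflect_def algebra_simps)

lemma integral_reflect:
  assumes [measurable]: "k \<in> borel_measurable borel"
  shows "(LINT x|lborel. k (reflect e c x)) = (LINT x|lborel. k x :: real)"
proof -
  have m0 [measurable]: "reflect e 0 \<in> borel_measurable borel"
    by (intro borel_measurable_continuous_onI continuous_intros)
  have "(LINT x|lborel. k x) = (LINT x|distr lborel borel (reflect e 0). k x)"
    by (simp add: lborel_distr_linear_isometry[OF linear_reflect_0 norm_reflect_0])
  also have "\<dots> = (LINT x|lborel. k (reflect e 0 x))"
    by (rule integral_distr) measurable
  also have "\<dots> = (LINT x|lborel. k (reflect e 0 (- ((2 * c) *\<^sub>R e) + 1 *\<^sub>R x)))"
    by (subst lborel_integral_affine_euclidean(2)[of 1 _ "- ((2 * c) *\<^sub>R e)"]) auto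
  also have "\<dots> = (LINT x|lborel. k (reflect e c x))" by (simp add: reflect_eq[of c])
  finally show ?thesis by simp
qed

end

lemma less_along_direction:
  fixes h :: "'a::real_inner \<Rightarrow> real"
  assumes S: "convex S" and grad: "\<And>x. x \<in> S \<Longrightarrow> GDERIV h x :> D x" and pos: "\<And>x. x \<in> S \<Longrightarrow> D x \<bullet> e > 0"
    and y: "y \<in> S" "y + t *\<^sub>R e \<in> S" "t > 0"
  shows "h y < h (y + t *\<^sub>R e)"
proof -
  have "h (y + 0 *\<^sub>R e) < h (y + t *\<^sub>R e)"
  proof (rule DERIV_pos_imp_increasing[OF y(3)])
    fix s assume s: "0 \<le> s" "s \<le> t"
    have "(1 - s / t) *\<^sub>R y + (s / t) *\<^sub>R (y + t *\<^sub>R e) \<in> S"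
      using s y by (intro convexD[OF S]) auto
    then have "y + s *\<^sub>R e \<in> S" using y(3) by (simp add: algebra_simps)
    then have "((\<lambda>s. h (y + s *\<^sub>R e)) has_derivative (*) (D (y + s *\<^sub>R e) \<bullet> e)) (at s)"
      using grad[unfolded gderiv_def]
      by (intro has_derivative_compose[of "\<lambda>s. y + s *\<^sub>R e" _ _ _ h, THEN has_derivative_eq_rhs])
         (auto intro!: derivative_eq_intros simp: fun_eq_iff inner_commute)
    then have "((\<lambda>s. h (y + s *\<^sub>R e)) has_real_derivative D (y + s *\<^sub>R e) \<bullet> e) (at s)"
      by (simp add: has_field_derivative_def)
    then show "\<exists>d. ((\<lambda>s. h (y + s *\<^sub>R e)) has_real_derivative d) (at s) \<and> 0 < d"
      using pos[OF \<open>y + s *\<^sub>R e \<in> S\<close>] by blast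
  qed
  then show ?thesis by simp
qed

lemma (in flux_law) flux_inject: "flux g x = flux g y \<Longrightarrow> x = y"
proof -
  assume eq: "flux g x = flux g y"
  then have "g (norm x) = g (norm y)" by (metis norm_flux)
  then have n: "norm x = norm y"
    using strict_mono_on_eqD[OF g_mono] by auto
  show "x = y"
  proof (cases "norm x = 0")
    case False
    then have "g (norm x) / norm x \<noteq> 0" using g_pos[of "norm x"] by auto
    then show ?thesis using eq n by (simp add: flux_def)
  qed (use n in auto)
qed

lemma (in ball_minimizer) grad_zero_at_min:
  assumes "x \<in> S" "open S" "S \<subseteq> B" "\<And>y. y \<in> S \<Longrightarrow> u x \<le> u y"
  shows "Du x = 0"
proof -
  have "(u has_derivative (\<lambda>v. v \<bullet> Du x)) (at x)"
    using u_grad[of x] assms by (auto simp: gderiv_def)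
  then have "(\<lambda>v. v \<bullet> Du x) = (\<lambda>v. 0)"
    using assms by (intro differential_zero_maxmin[of x S u]) auto
  then have "Du x \<bullet> Du x = 0" by metis
  then show ?thesis by simp
qed

section \<open>Exchanging values across a hyperplane\<close>

locale reflected_minimizer = ball_minimizer g f R u Du
  for g f R and u :: "real ^ 'n \<Rightarrow> real" and Du +
  fixes e :: "real ^ 'n" and c :: real
  assumes e: "norm e = 1" and c: "c \<ge> 0"
begin

abbreviation \<sigma> :: "real ^ 'n \<Rightarrow> real ^ 'n" where "\<sigma> \<equiv> reflect e c"

definition cap :: "(real ^ 'n) set" where "cap = ball 0 R \<inter> {x. x \<bullet> e > c}"
text \<open>The mirror image of \<open>cap\<close>, see \<open>mem_cap'\<close>. As an intersection
  of a ball and a half-space it is visibly open and convex.\<close>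

definition cap' :: "(real ^ 'n) set" where "cap' = ball ((2 * c) *\<^sub>R e) R \<inter> {x. x \<bullet> e < c}"

definition h :: "real ^ 'n \<Rightarrow> real" where "h x = u x - u (\<sigma> x)"
definition Dh :: "real ^ 'n \<Rightarrow> real ^ 'n" where "Dh x = Du x - reflect e 0 (Du (\<sigma> x))"

lemma mem_cap': "x \<in> cap' \<longleftrightarrow> \<sigma> x \<in> cap"
  by (auto simp: cap_def cap'_def norm_reflect[OF e] reflect_inner[OF e] dist_norm norm_minus_commute)

lemma \<sigma>_cap: "x \<in> cball 0 R \<Longrightarrow> x \<bullet> e \<ge> c \<Longrightarrow> \<sigma> x \<in> cball 0 R"
  using norm_reflect_le[OF e c, of x] by simp

lemma \<sigma>_cap_ball: "x \<in> B \<Longrightarrow> x \<bullet> e \<ge> c \<Longrightarrow> \<sigma> x \<in> B"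
  using norm_reflect_le[OF e c, of x] by simp

lemma cap_subset: "cap \<subseteq> B" by (auto simp: cap_def)

lemma cap'_subset: "cap' \<subseteq> B"
proof
  fix x assume "x \<in> cap'"
  then have "\<sigma> x \<in> B" "\<sigma> x \<bullet> e \<ge> c" using mem_cap' by (auto simp: cap_def)
  from \<sigma>_cap_ball[OF this] show "x \<in> B" by (simp add: reflect_reflect[OF e])
qed

lemma h_grad: "x \<in> B \<Longrightarrow> \<sigma> x \<in> B \<Longrightarrow> GDERIV h x :> Dh x"
  unfolding h_def Dh_def by (intro GDERIV_diff u_grad GDERIV_reflect[OF e])

text \<open>On the spherical part of the frontier \<open>u\<close> is 0 and its reflected value is
  nonnegative; on the flat part every point is its own reflection and \<open>h\<close>
  vanishes.\<close>

lemma cut_data_cap: "cut_data cap h Dh"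
  unfolding cut_data_def
proof (intro conjI ballI)
  have cl: "closure cap \<subseteq> cball 0 R \<inter> {x. x \<bullet> e \<ge> c}"
  proof (rule closure_minimal)
    have "closed {x. x \<bullet> e \<ge> c}" by (intro closed_Collect_le continuous_intros)
    then show "closed (cball 0 R \<inter> {x. x \<bullet> e \<ge> c})" by (intro closed_Int closed_cball)
  qed (auto simp: cap_def)
  have "open {x. x \<bullet> e > c}" "convex {x. x \<bullet> e > c}"
    using open_halfspace_gt[of c e] convex_halfspace_gt[of c e] by (simp_all only: inner_commute[of e])
  then show "open cap" "convex cap" "bounded cap" by (auto simp: cap_def intro: convex_Int)
  have \<sigma>cl: "\<sigma> ` closure cap \<subseteq> cball 0 R" using cl \<sigma>_cap by blast
  show "continuous_on (closure cap) h" unfolding h_def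
    using cl \<sigma>cl by (intro continuous_on_diff continuous_on_compose2[OF u_cont]
        continuous_on_subset[OF u_cont] continuous_intros) auto
  show "continuous_on (closure cap) Dh" unfolding Dh_def
    using cl \<sigma>cl by (intro continuous_on_diff continuous_on_compose2[OF Du_cont]
        continuous_on_subset[OF Du_cont] continuous_intros) auto
  show "GDERIV h x :> Dh x" if "x \<in> cap" for x
    using that \<sigma>_cap_ball[of x] by (intro h_grad) (auto simp: cap_def)
  show "h x \<le> 0" if "x \<in> frontier cap" for x
  proof -
    have x: "x \<in> cball 0 R" "x \<bullet> e \<ge> c" "x \<notin> cap"
      using that cl \<open>open cap\<close> unfolding frontier_def interior_open[OF \<open>open cap\<close>] by blast+
    then consider "norm x = R" | "x \<bullet> e = c" by (fastforce simp: cap_def)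
    then show ?thesis
    proof cases
      case 1
      then show ?thesis using u_bdry[of x] u_nonneg[OF \<sigma>_cap[OF x(1,2)]] by (simp add: h_def)
    qed (simp add: h_def reflect_def)
  qed
qed

lemma cut_data_cap': "cut_data cap' (\<lambda>x. - h x) (\<lambda>x. - Dh x)"
  unfolding cut_data_def
proof (intro conjI ballI)
  have cl: "closure cap' \<subseteq> cball ((2 * c) *\<^sub>R e) R \<inter> {x. x \<bullet> e \<le> c}"
  proof (rule closure_minimal)
    have "closed {x. x \<bullet> e \<le> c}" by (intro closed_Collect_le continuous_intros)
    then show "closed (cball ((2 * c) *\<^sub>R e) R \<inter> {x. x \<bullet> e \<le> c})" by (intro closed_Int closed_cball)
  qed (auto simp: cap'_def)
  have "open {x. x \<bullet> e < c}" "convex {x. x \<bullet> e < c}"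
    using open_halfspace_lt[of e c] convex_halfspace_lt[of e c] by (simp_all only: inner_commute[of e])
  then show "open cap'" "convex cap'" "bounded cap'" by (auto simp: cap'_def intro: convex_Int)
  have *: "\<sigma> x \<in> cball 0 R" "\<sigma> x \<bullet> e \<ge> c" "x \<in> cball 0 R" if "x \<in> closure cap'" for x
  proof -
    show 1: "\<sigma> x \<in> cball 0 R" "\<sigma> x \<bullet> e \<ge> c"
    proof -
      have "x \<in> cball ((2 * c) *\<^sub>R e) R" "x \<bullet> e \<le> c" using cl that by blast+
      then show "\<sigma> x \<in> cball 0 R" "\<sigma> x \<bullet> e \<ge> c"
        by (simp_all add: norm_reflect[OF e] reflect_inner[OF e] dist_norm norm_minus_commute[of x])
    qed
    show "x \<in> cball 0 R" using \<sigma>_cap[OF 1] by (simp add: reflect_reflect[OF e])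
  qed
  show "continuous_on (closure cap') (\<lambda>x. - h x)" unfolding h_def
    using * by (intro continuous_on_diff continuous_on_minus continuous_on_compose2[OF u_cont]
        continuous_on_subset[OF u_cont] continuous_intros) auto
  show "continuous_on (closure cap') (\<lambda>x. - Dh x)" unfolding Dh_def
    using * by (intro continuous_on_diff continuous_on_minus continuous_on_compose2[OF Du_cont]
        continuous_on_subset[OF Du_cont] continuous_intros) auto
  show "GDERIV (\<lambda>x. - h x) x :> - Dh x" if "x \<in> cap'" for x
    using that cap'_subset mem_cap'[of x] cap_subset by (intro GDERIV_minus h_grad) auto
  show "- h x \<le> 0" if "x \<in> frontier cap'" for x
  proof -
    have x: "x \<in> closure cap'" "\<sigma> x \<notin> cap"
      using that mem_cap' unfolding frontier_def interior_open[OF \<open>open cap'\<close>] by blast+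
    then consider "norm (\<sigma> x) = R" | "\<sigma> x \<bullet> e = c" using *(1,2)[OF x(1)] by (fastforce simp: cap_def)
    then show ?thesis
    proof cases
      case 1
      then show ?thesis using u_bdry[of "\<sigma> x"] u_nonneg[OF *(3)[OF x(1)]] by (simp add: h_def)
    next
      case 2
      then have "\<sigma> x = x" by (simp add: reflect_inner[OF e]) (simp add: reflect_def)
      then show ?thesis by (simp add: h_def)
    qed
  qed
qed

lemma cap_nonneg: "x \<in> B \<Longrightarrow> 0 \<le> u x - pos_cut cap h x"
proof -
  assume x: "x \<in> B"
  then have "0 \<le> u x" "x \<in> cap \<Longrightarrow> 0 \<le> u (\<sigma> x)"
    using u_nonneg[of x] u_nonneg[OF \<sigma>_cap[of x]] by (auto simp: cap_def)
  then show ?thesis by (simp add: pos_cut_def h_def max_def)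
qed

text \<open>Replacing \<open>u\<close> by \<open>max u (u \<circ> \<sigma>)\<close> on the reflected cap changes the energy by the opposite amount, which is
  nonnegative.\<close>

lemma energy_cap: "energy (\<lambda>x. u x - pos_cut cap h x) (\<lambda>x. Du x - grad_cut cap h Dh x) \<le> energy u Du"
proof -
  let ?\<rho> = "\<lambda>x. G (norm (Du x)) - F (u x)"
  let ?\<rho>1 = "\<lambda>x. G (norm (Du x - grad_cut cap h Dh x)) - F (u x - pos_cut cap h x)"
  let ?\<rho>2 = "\<lambda>x. G (norm (Du x + grad_cut cap' (\<lambda>x. - h x) (\<lambda>x. - Dh x) x)) - F (u x + pos_cut cap' (\<lambda>x. - h x) x)"
  note i0 = integrable_u
  note i1 = subtract_cut(2)[OF cut_data_cap cap_subset cap_nonneg]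
  note i2 = add_cut(2)[OF cut_data_cap' cap'_subset]
  have e2: "energy u Du \<le> (LINT x:B|lborel. ?\<rho>2 x)"
    using add_cut(1)[OF cut_data_cap' cap'_subset] by (simp only: energy_def)
  define k where "k = (\<lambda>x. indicator B x *\<^sub>R ?\<rho>1 x - indicator B x *\<^sub>R ?\<rho> x)"
  have k: "k x = (if x \<in> cap \<and> h x > 0 then ?\<rho> (\<sigma> x) - ?\<rho> x else 0)" for x
    using cap_subset by (auto simp: k_def pos_cut_def grad_cut_def h_def Dh_def norm_reflect_0[OF e] indicator_def)
  have h_swap: "h (\<sigma> x) = - h x" for x by (simp add: h_def reflect_reflect[OF e])
  have k': "indicator B x *\<^sub>R ?\<rho>2 x - indicator B x *\<^sub>R ?\<rho> x = - k (\<sigma> x)" for x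
    unfolding k using cap'_subset mem_cap'[of x]
    by (auto simp: h_swap pos_cut_def grad_cut_def reflect_reflect[OF e] Dh_def h_def norm_reflect_0[OF e] indicator_def)
  have int: "integrable lborel k" "integrable lborel (\<lambda>x. indicator B x *\<^sub>R ?\<rho> x)" "integrable lborel (\<lambda>x. indicator B x *\<^sub>R ?\<rho>1 x)"
    "integrable lborel (\<lambda>x. indicator B x *\<^sub>R ?\<rho>2 x)"
    using i0 i1 i2 by (auto simp: k_def set_integrable_def)
  have "energy u Du \<le> (LINT x|lborel. indicator B x *\<^sub>R ?\<rho>2 x)" using e2 by (simp add: set_lebesgue_integral_def)
  also have "\<dots> = energy u Du + (LINT x|lborel. (indicator B x *\<^sub>R ?\<rho>2 x - indicator B x *\<^sub>R ?\<rho> x))"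
    using int(2,4) by (subst Bochner_Integration.integral_diff) (simp_all add: energy_def set_lebesgue_integral_def)
  also have "\<dots> = energy u Du - (LINT x|lborel. k (\<sigma> x))"
    unfolding k' by simp
  also have "(LINT x|lborel. k (\<sigma> x)) = (LINT x|lborel. k x)"
    using int(1) by (intro integral_reflect[OF e]) auto
  finally have "(LINT x|lborel. k x) \<le> 0" by simp
  moreover have "(LINT x|lborel. k x) = (LINT x|lborel. indicator B x *\<^sub>R ?\<rho>1 x) - (LINT x|lborel. indicator B x *\<^sub>R ?\<rho> x)"
    unfolding k_def using int by (intro Bochner_Integration.integral_diff)
  ultimately show ?thesis by (simp add: energy_def set_lebesgue_integral_def)
qed

end

section \<open>Signs and values of slopes\<close>

text \<open>The direction \<open>e'\<close> across the kink need not be the normal \<open>e\<close>: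
  the kink lies on the hyperplane in \<open>slope_nonpos\<close>, but inside the cap in
  \<open>slopes_match\<close>, where \<open>e'\<close> is the direction of
  \<open>Dh x0\<close>.\<close>

lemma (in reflected_minimizer) no_kink_reflected:
  assumes x0: "x0 \<in> B" "h x0 = 0" "u x0 > 0"
    and half: "\<delta> > 0" "\<And>x. x \<in> ball x0 \<delta> \<Longrightarrow> (x \<in> cap \<and> h x > 0) \<longleftrightarrow> (x - x0) \<bullet> e' > 0"
    and jump: "norm e' = 1" "flux g (reflect e 0 (Du (\<sigma> x0))) - flux g (Du x0) = (- \<kappa>) *\<^sub>R e'"
  shows "\<kappa> = 0"
proof (rule no_kink[OF cut_data_cap cap_subset cap_nonneg energy_cap x0(1) _ x0(2,3) half jump(1)])
  show "x0 \<in> closure cap"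
    unfolding closure_approachable
  proof (intro allI impI)
    fix \<epsilon> :: real assume "\<epsilon> > 0"
    define t where "t = min \<delta> \<epsilon> / 2"
    have t: "t > 0" "t < \<delta>" "t < \<epsilon>" using \<open>\<epsilon> > 0\<close> half(1) by (auto simp: t_def)
    have "x0 + t *\<^sub>R e' \<in> cap"
      using half(2)[of "x0 + t *\<^sub>R e'"] t jump(1) inner_self_unit[OF jump(1)] by (simp add: dist_norm)
    then show "\<exists>y\<in>cap. dist y x0 < \<epsilon>"
      using t jump(1) by (intro bexI[of _ "x0 + t *\<^sub>R e'"]) (simp_all add: dist_norm)
  qed
  show "flux g (Du x0 - Dh x0) - flux g (Du x0) = (- \<kappa>) *\<^sub>R e'"
    using jump(2) by (simp add: Dh_def)
qed

lemma (in reflected_minimizer) h_increasing_near: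
  assumes "x0 \<in> B" "\<sigma> x0 \<in> B" "Dh x0 \<bullet> w > 0"
  obtains \<delta> where "\<delta> > 0" "\<And>x. x \<in> ball x0 \<delta> \<Longrightarrow> x \<in> B" "\<And>x. x \<in> ball x0 \<delta> \<Longrightarrow> \<sigma> x \<in> B"
    "\<And>y t. y \<in> ball x0 \<delta> \<Longrightarrow> y + t *\<^sub>R w \<in> ball x0 \<delta> \<Longrightarrow> t > 0 \<Longrightarrow> h y < h (y + t *\<^sub>R w)"
proof -
  have \<sigma>_cont: "continuous_on UNIV \<sigma>" by (intro continuous_intros)
  define S where "S = B \<inter> \<sigma> -` B"
  have S: "open S" "x0 \<in> S"
    using assms open_vimage[OF open_ball \<sigma>_cont] by (auto simp: S_def)
  have "continuous_on S (\<lambda>x. Dh x \<bullet> w)"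
    unfolding Dh_def S_def
    by (intro continuous_intros continuous_on_compose2[OF Du_cont] continuous_on_subset[OF Du_cont]) auto
  then have "open ((\<lambda>x. Dh x \<bullet> w) -` {0<..} \<inter> S)"
    using continuous_on_open_vimage[OF S(1)] open_greaterThan by blast
  then obtain \<delta> where \<delta>: "\<delta> > 0" "ball x0 \<delta> \<subseteq> (\<lambda>x. Dh x \<bullet> w) -` {0<..} \<inter> S"
    using S(2) assms(3) openE[of _ x0] by (metis IntI vimageI greaterThan_iff)
  show ?thesis
  proof (rule that[OF \<delta>(1)])
    show "x \<in> B" "\<sigma> x \<in> B" if "x \<in> ball x0 \<delta>" for x
      using \<delta>(2) that by (auto simp: S_def)
    show "h y < h (y + t *\<^sub>R w)" if "y \<in> ball x0 \<delta>" "y + t *\<^sub>R w \<in> ball x0 \<delta>" "t > 0" for y t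
    proof (rule less_along_direction[OF convex_ball _ _ that])
      show "GDERIV h x :> Dh x" if "x \<in> ball x0 \<delta>" for x
        using \<delta>(2) that by (intro h_grad) (auto simp: S_def)
      show "Dh x \<bullet> w > 0" if "x \<in> ball x0 \<delta>" for x
        using \<delta>(2) that by auto
    qed
  qed
qed

context ball_minimizer
begin

lemma u_pos_if_grad_nonzero:
  assumes "x \<in> B" "Du x \<noteq> 0"
  shows "u x > 0"
proof (rule ccontr)
  assume "\<not> u x > 0"
  then have "u x = 0" using u_nonneg[of x] assms by auto
  then have "Du x = 0" using assms u_nonneg by (intro grad_zero_at_min[of x B]) auto
  then show False using assms by simp
qed

text \<open>Reflect at the hyperplane through \<open>x0\<close>. There \<open>h\<close> vanishes,
  and with a positive slope it would increase along \<open>e\<close>, so near \<open>x0\<close> it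
  would be positive exactly beyond the hyperplane. The minimum of \<open>u\<close> and its
  reflection would then have a kink at \<open>x0\<close>.\<close>

lemma slope_nonpos:
  assumes x0: "x0 \<in> B" and e: "norm e = 1" and "x0 \<bullet> e \<ge> 0"
  shows "Du x0 \<bullet> e \<le> 0"
proof (rule ccontr)
  assume "\<not> Du x0 \<bullet> e \<le> 0"
  then have p: "Du x0 \<bullet> e > 0" by simp
  interpret reflected_minimizer g f R u Du e "x0 \<bullet> e"
    using e assms(3) by unfold_locales
  have \<sigma>x0: "\<sigma> x0 = x0" by (simp add: reflect_def)
  have ee: "e \<bullet> e = 1" by (rule inner_self_unit[OF e])
  have "Dh x0 \<bullet> e > 0"
    using p by (simp add: Dh_def \<sigma>x0 inner_diff_left reflect_inner[OF e])
  then obtain \<delta> where \<delta>: "\<delta> > 0" "\<And>x. x \<in> ball x0 \<delta> \<Longrightarrow> x \<in> B"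
    "\<And>y t. y \<in> ball x0 \<delta> \<Longrightarrow> y + t *\<^sub>R e \<in> ball x0 \<delta> \<Longrightarrow> t > 0 \<Longrightarrow> h y < h (y + t *\<^sub>R e)"
    using h_increasing_near[of x0 e] x0 \<sigma>x0 by metis
  have "Du x0 \<noteq> 0" using p by auto
  \<comment> \<open>Reflection preserves the norm of the gradient, so the flux changes only by twice
    its component along \<open>e\<close>.\<close>
  define \<kappa> where "\<kappa> = 2 * (Du x0 \<bullet> e) * (g (norm (Du x0)) / norm (Du x0))"
  have "\<kappa> = 0"
  proof (rule no_kink_reflected[OF x0 _ _ \<delta>(1) _ e])
    show "h x0 = 0" by (simp add: h_def \<sigma>x0)
    show "u x0 > 0" using u_pos_if_grad_nonzero[OF x0 \<open>Du x0 \<noteq> 0\<close>] .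
    show "flux g (reflect e 0 (Du (\<sigma> x0))) - flux g (Du x0) = (- \<kappa>) *\<^sub>R e"
      by (simp add: \<sigma>x0 flux_def norm_reflect_0[OF e] \<kappa>_def) (simp add: reflect_def algebra_simps)
    fix x assume x: "x \<in> ball x0 \<delta>"
    show "(x \<in> cap \<and> h x > 0) \<longleftrightarrow> (x - x0) \<bullet> e > 0"
    proof
      assume "x \<in> cap \<and> h x > 0"
      then show "(x - x0) \<bullet> e > 0" by (simp add: cap_def inner_diff_left)
    next
      assume t: "(x - x0) \<bullet> e > 0"
      define t where "t = (x - x0) \<bullet> e"
      define y where "y = x - t *\<^sub>R e"
      have "(norm (v - (v \<bullet> e) *\<^sub>R e))\<^sup>2 = (norm v)\<^sup>2 - (v \<bullet> e) * (v \<bullet> e)" for v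
        by (simp add: power2_norm_eq_inner inner_diff_left inner_diff_right ee inner_commute)
      from this[of "x - x0"] have "(norm (y - x0))\<^sup>2 = (norm (x - x0))\<^sup>2 - t * t"
        by (simp add: y_def t_def algebra_simps)
      then have "(norm (y - x0))\<^sup>2 \<le> (norm (x - x0))\<^sup>2" by simp
      then have "norm (y - x0) \<le> norm (x - x0)" by simp
      then have "y \<in> ball x0 \<delta>" using x by (simp add: dist_norm norm_minus_commute)
      then have "h y < h (y + t *\<^sub>R e)"
        using \<delta>(3)[of y t] x t by (simp add: y_def t_def)
      moreover have "\<sigma> y = y"
        by (simp add: reflect_def y_def t_def inner_diff_left ee)
      ultimately have "h x > 0" by (simp add: h_def y_def)
      then show "x \<in> cap \<and> h x > 0" using \<delta>(2)[OF x] t by (simp add: cap_def inner_diff_left)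
    qed
  qed
  moreover have "g (norm (Du x0)) > 0" using g_pos \<open>Du x0 \<noteq> 0\<close> by simp
  ultimately show False using p \<open>Du x0 \<noteq> 0\<close> by (simp add: \<kappa>_def)
qed

text \<open>The hyperplane is the midpoint of the two given points; \<open>s \<le> r\<close> puts it
  on the nonnegative side and \<open>- r < s\<close> puts the first point into the cap. If the
  slopes did not match, \<open>u\<close> and its reflection would cross transversally there. In one
  dimension the crossing is a single point, so \<open>h\<close> is positive locally on a half-line,
  which is the configuration that \<open>no_kink\<close> excludes.\<close>

lemma slopes_match:
  assumes one: "\<And>v :: real ^ 'n. v = (v \<bullet> e) *\<^sub>R e" and e: "norm e = 1"
    and rs: "- r < s" "s \<le> r" "r < R" and eq: "u (r *\<^sub>R e) = u ((- s) *\<^sub>R e)" "u (r *\<^sub>R e) > 0"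
  shows "Du (r *\<^sub>R e) = - Du ((- s) *\<^sub>R e)"
proof -
  interpret reflected_minimizer g f R u Du e "(r - s) / 2"
    using e rs by unfold_locales auto
  define x0 where "x0 = r *\<^sub>R e"
  have ee: "e \<bullet> e = 1" by (rule inner_self_unit[OF e])
  have \<sigma>x0: "\<sigma> x0 = (- s) *\<^sub>R e"
  proof -
    have "2 * (r - (r - s) / 2) = r + s" by (simp add: field_simps)
    then show ?thesis
      by (simp only: x0_def reflect_def inner_scaleR_left ee mult_1_right) (simp add: algebra_simps)
  qed
  have x0: "x0 \<in> B" "x0 \<in> cap" using rs e ee by (auto simp: x0_def cap_def)
  have \<sigma>B: "\<sigma> x0 \<in> B" using \<sigma>_cap_ball[OF x0(1)] rs ee by (simp add: x0_def)
  have ref: "reflect e 0 d = - d" for d :: "real ^ 'n"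
  proof -
    have "reflect e 0 d = d - 2 *\<^sub>R ((d \<bullet> e) *\<^sub>R e)" by (simp add: reflect_def)
    also have "\<dots> = - d" by (subst one[of d, symmetric]) (simp add: scaleR_2)
    finally show ?thesis .
  qed
  have "Dh x0 = 0"
  proof (rule ccontr)
    assume D: "Dh x0 \<noteq> 0"
    define e' where "e' = (1 / norm (Dh x0)) *\<^sub>R Dh x0"
    have e': "norm e' = 1" "Dh x0 \<bullet> e' > 0" using D by (simp_all add: e'_def)
    have one': "v = (v \<bullet> e') *\<^sub>R e'" for v :: "real ^ 'n"
    proof -
      obtain a where a: "e' = a *\<^sub>R e" using one[of e'] by metis
      have "a * a = 1" using inner_self_unit[OF e'(1)] ee by (simp add: a)
      have "(v \<bullet> e') *\<^sub>R e' = (a * a) *\<^sub>R ((v \<bullet> e) *\<^sub>R e)" by (simp add: a mult_ac)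
      then show ?thesis using one[of v] \<open>a * a = 1\<close> by simp
    qed
    obtain \<delta>1 where \<delta>1: "\<delta>1 > 0" "ball x0 \<delta>1 \<subseteq> cap"
      using x0(2) cut_data_cap openE unfolding cut_data_def by metis
    obtain \<delta>2 where \<delta>2: "\<delta>2 > 0"
      "\<And>y t. y \<in> ball x0 \<delta>2 \<Longrightarrow> y + t *\<^sub>R e' \<in> ball x0 \<delta>2 \<Longrightarrow> t > 0 \<Longrightarrow> h y < h (y + t *\<^sub>R e')"
      using h_increasing_near[OF x0(1) \<sigma>B e'(2)] by metis
    have h0: "h x0 = 0" using eq \<sigma>x0 by (simp add: h_def x0_def)
    define \<kappa> where "\<kappa> = - ((flux g (reflect e 0 (Du (\<sigma> x0))) - flux g (Du x0)) \<bullet> e')"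
    have "\<kappa> = 0"
    proof (rule no_kink_reflected[OF x0(1) h0 _ _ _ e'(1), of "min \<delta>1 \<delta>2"])
      show "u x0 > 0" using eq by (simp add: x0_def)
      show "min \<delta>1 \<delta>2 > 0" using \<delta>1 \<delta>2 by simp
      show "flux g (reflect e 0 (Du (\<sigma> x0))) - flux g (Du x0) = (- \<kappa>) *\<^sub>R e'"
        by (subst one') (simp add: \<kappa>_def)
      fix x assume x: "x \<in> ball x0 (min \<delta>1 \<delta>2)"
      define t where "t = (x - x0) \<bullet> e'"
      have xt: "x = x0 + t *\<^sub>R e'" using one'[of "x - x0"] by (simp add: t_def algebra_simps)
      have "x \<in> cap" using x \<delta>1 by auto
      moreover have "h x > 0 \<longleftrightarrow> t > 0"
      proof -
        consider "t > 0" | "t = 0" | "t < 0" by linarith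
        then show ?thesis
        proof cases
          case 1
          then show ?thesis using \<delta>2(2)[of x0 t] x xt h0 \<delta>2(1) by simp
        next
          case 2
          then show ?thesis using xt h0 by simp
        next
          case 3
          have "x + (- t) *\<^sub>R e' = x0" by (simp add: xt)
          then have "h x < h x0" using \<delta>2(2)[of x "- t"] x 3 \<delta>2(1) by simp
          then show ?thesis using 3 h0 by simp
        qed
      qed
      ultimately show "(x \<in> cap \<and> h x > 0) \<longleftrightarrow> (x - x0) \<bullet> e' > 0" by (simp add: t_def)
    qed
    then have "flux g (reflect e 0 (Du (\<sigma> x0))) - flux g (Du x0) = 0"
      using one'[of "flux g (reflect e 0 (Du (\<sigma> x0))) - flux g (Du x0)"] by (simp add: \<kappa>_def)
    then have "reflect e 0 (Du (\<sigma> x0)) = Du x0" using flux_inject by (metis eq_iff_diff_eq_0)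
    then show False using D by (simp add: Dh_def)
  qed
  then show ?thesis by (simp add: Dh_def ref x0_def \<sigma>x0[unfolded x0_def] add_eq_0_iff)
qed

section \<open>Superlevel sets and truncation\<close>

lemma open_superlevel: "open {x \<in> B. u x > c}"
proof -
  have "continuous_on B u" using u_cont by (rule continuous_on_subset) auto
  then have "open (u -` {c<..} \<inter> B)"
    using continuous_on_open_vimage[OF open_ball] open_greaterThan by blast
  moreover have "u -` {c<..} \<inter> B = {x \<in> B. u x > c}" by auto
  ultimately show ?thesis by simp
qed

lemma cut_data_level: "c \<ge> 0 \<Longrightarrow> cut_data B (\<lambda>x. u x - c) Du"
  using u_cont Du_cont u_bdry R_pos
  by (auto simp: cut_data_def closure_ball frontier_ball
      intro!: continuous_intros u_grad GDERIV_diff[THEN GDERIV_subst] GDERIV_const)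

text \<open>Comparison with the minimum of \<open>u\<close> and \<open>c\<close>, whose density on
  \<open>A\<close> is \<open>- F c\<close>. The two integrals are kept apart because stretching by
  \<open>t\<close> acts on them with different powers of \<open>t\<close>.\<close>

lemma truncation_le:
  assumes c: "c \<ge> 0"
  defines "A \<equiv> {x \<in> B. u x > c}"
  shows "integrable lborel (\<lambda>x. indicator A x * G (norm (Du x)))" (is "integrable _ ?q")
    and "integrable lborel (\<lambda>x. indicator A x * (F (u x) - F c))" (is "integrable _ ?w")
    and "(LINT x|lborel. indicator A x * G (norm (Du x))) \<le> (LINT x|lborel. indicator A x * (F (u x) - F c))"
proof -
  have A: "open A" "A \<subseteq> B" using open_superlevel[of c] by (auto simp: A_def)
  have int: "integrable lborel (\<lambda>x. indicator A x * k x)"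
    if k: "continuous_on (cball 0 R) k" for k :: "real ^ 'n \<Rightarrow> real"
  proof -
    obtain L where L: "\<forall>x\<in>cball 0 R. norm (k x) \<le> L"
      using compact_imp_bounded[OF compact_continuous_image[OF k compact_cball]] by (auto simp: bounded_iff)
    have [measurable]: "(\<lambda>x. indicator A x *\<^sub>R k x) \<in> borel_measurable borel"
      using A by (intro borel_measurable_continuous_on_indicator continuous_on_subset[OF k]) auto
    then have "integrable lborel (\<lambda>x. indicator A x *\<^sub>R (indicator A x *\<^sub>R k x))"
    proof (intro integrableI_bounded_set_indicator[where B = L])
      show "emeasure lborel A < \<infinity>"
        using A emeasure_mono[of A B lborel] emeasure_lborel_ball_finite[of "0 :: real ^ 'n" R]
        by (auto intro: le_less_trans)
      show "AE x in lborel. x \<in> A \<longrightarrow> norm (indicator A x *\<^sub>R k x) \<le> L"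
        using A(2) L by (intro AE_I2) auto
    qed (use A in auto)
    moreover have "indicator A x *\<^sub>R (indicator A x *\<^sub>R k x) = indicator A x * k x" for x
      by (simp add: indicator_def)
    ultimately show ?thesis by (simp only:)
  qed
  show q: "integrable lborel ?q"
    by (intro int continuous_on_compose2[OF G_cont] continuous_intros Du_cont) auto
  show w: "integrable lborel ?w"
    using u_nonneg by (intro int continuous_on_compose2[OF F_cont] continuous_intros u_cont) auto
  have nn: "0 \<le> u x - pos_cut B (\<lambda>x. u x - c) x" if "x \<in> B" for x
    using that u_nonneg[of x] c by (auto simp: pos_cut_def max_def)
  let ?e = "\<lambda>x. G (norm (Du x - grad_cut B (\<lambda>x. u x - c) Du x)) - F (u x - pos_cut B (\<lambda>x. u x - c) x)"
  have e: "indicator B x *\<^sub>R ?e x = indicator B x *\<^sub>R (G (norm (Du x)) - F (u x)) - ?q x + ?w x" for x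
    using A(2) by (auto simp: A_def pos_cut_def grad_cut_def indicator_def primitive_0)
  have i: "integrable lborel (\<lambda>x. indicator B x *\<^sub>R (G (norm (Du x)) - F (u x)))"
    using integrable_u by (simp add: set_integrable_def)
  have "energy u Du \<le> (LINT x|lborel. indicator B x *\<^sub>R ?e x)"
    using subtract_cut(1)[OF cut_data_level[OF c] _ nn] by (simp add: energy_def set_lebesgue_integral_def)
  also have "\<dots> = (LINT x|lborel. indicator B x *\<^sub>R (G (norm (Du x)) - F (u x)) - ?q x + ?w x)"
    by (simp only: e)
  also have "\<dots> = energy u Du - (LINT x|lborel. ?q x) + (LINT x|lborel. ?w x)"
    using i q w by (simp add: energy_def set_lebesgue_integral_def)
  finally show "(LINT x|lborel. ?q x) \<le> (LINT x|lborel. ?w x)" by simp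
qed

end

section \<open>Stretching a superlevel set\<close>

context ball_minimizer
begin

text \<open>The competitor is \<open>min u l + (u \<circ> \<phi> - c)\<^sup>+\<close>, where \<open>\<phi>\<close> is the inverse of \<open>x \<mapsto> z + t (x - z)\<close>.  Its energy is
  compared with that of \<open>u\<close> using \<open>t * G (p / t) \<le> G p\<close> and \<open>truncation_le\<close>.\<close>

lemma stretch_inequality:
  assumes c: "0 \<le> l" "l \<le> c" and t: "t > 1"
    and C0: "open C0" "convex C0" "C0 \<subseteq> B" "\<And>x. x \<in> B \<Longrightarrow> u x > c \<Longrightarrow> x \<in> C0" "\<And>x. x \<in> frontier C0 \<Longrightarrow> u x \<le> c"
    and sub: "\<And>x. x \<in> C0 \<Longrightarrow> z + t *\<^sub>R (x - z) \<in> B"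
    and level: "\<And>x. x \<in> C0 \<Longrightarrow> u x > c \<Longrightarrow> l \<le> u (z + t *\<^sub>R (x - z))"
    and K: "K > 0" "\<And>a b. 0 \<le> a \<Longrightarrow> a \<le> M \<Longrightarrow> 0 \<le> b \<Longrightarrow> b \<le> M \<Longrightarrow> \<bar>F b - F a\<bar> \<le> K * \<bar>b - a\<bar>"
    and M: "\<And>x. x \<in> cball 0 R \<Longrightarrow> u x \<le> M" "c \<le> M"
  shows "(t - 1) * (LINT x|lborel. indicator {x \<in> B. u x > c} x * G (norm (Du x)))
     \<le> 2 * K * (c - l) * measure lborel B"
proof -
  define A where "A = {x \<in> B. u x > c}"
  define q where "q = (\<lambda>x. indicator A x * G (norm (Du x)))"
  define w where "w = (\<lambda>x. indicator A x * (F (u x) - F c))"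
  have c0: "c \<ge> 0" using c by simp
  have q: "integrable lborel q" and w: "integrable lborel w" and qw: "(LINT x|lborel. q x) \<le> (LINT x|lborel. w x)"
    using truncation_le[OF c0] by (simp_all add: q_def w_def A_def)
  define a where "a = z - (1 / t) *\<^sub>R z"
  define \<phi> where "\<phi> = (\<lambda>x. a + (1 / t) *\<^sub>R x)"
  have \<phi>1: "z + t *\<^sub>R (\<phi> x - z) = x" and \<phi>2: "\<phi> (z + t *\<^sub>R (x - z)) = x" for x
    using t by (simp_all add: \<phi>_def a_def algebra_simps)
  define C where "C = \<phi> -` C0"
  define h2 where "h2 = (\<lambda>x. u (\<phi> x) - c)"
  define D2 where "D2 = (\<lambda>x. (1 / t) *\<^sub>R Du (\<phi> x))"
  have \<phi>_cont: "continuous_on S \<phi>" for S unfolding \<phi>_def by (intro continuous_intros)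
  have C_eq: "C = (\<lambda>x. (z - t *\<^sub>R z) + t *\<^sub>R x) ` C0"
  proof -
    have "x \<in> C \<longleftrightarrow> x \<in> (\<lambda>x. (z - t *\<^sub>R z) + t *\<^sub>R x) ` C0" for x
    proof
      assume "x \<in> C"
      then show "x \<in> (\<lambda>x. (z - t *\<^sub>R z) + t *\<^sub>R x) ` C0"
        using \<phi>1[of x] by (intro image_eqI[of _ _ "\<phi> x"]) (auto simp: C_def algebra_simps)
    next
      assume "x \<in> (\<lambda>x. (z - t *\<^sub>R z) + t *\<^sub>R x) ` C0"
      then obtain y where "y \<in> C0" "x = z + t *\<^sub>R (y - z)" by (auto simp: algebra_simps)
      then show "x \<in> C" using \<phi>2[of y] by (simp add: C_def)
    qed
    then show ?thesis by blast
  qed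
  have CB: "C \<subseteq> B"
  proof
    fix x assume "x \<in> C"
    then show "x \<in> B" using sub[of "\<phi> x"] \<phi>1[of x] by (simp add: C_def)
  qed
  have openC: "open C" unfolding C_def by (intro open_vimage C0 \<phi>_cont)
  have cl: "\<phi> x \<in> closure C0" if "x \<in> closure C" for x
  proof -
    have "\<phi> ` closure C \<subseteq> closure (\<phi> ` C)" by (rule image_closure_subset[OF \<phi>_cont closed_closure closure_subset])
    moreover have "closure (\<phi> ` C) \<subseteq> closure C0" by (rule closure_mono) (auto simp: C_def)
    ultimately show ?thesis using that by blast
  qed
  have clB: "closure C0 \<subseteq> cball 0 R" using closure_mono[OF C0(3)] R_pos by (simp add: closure_ball)
  have cd2: "cut_data C h2 D2"
    unfolding cut_data_def
  proof (intro conjI ballI)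
    show "open C" by (rule openC)
    show "convex C" unfolding C_eq by (rule convex_affinity[OF C0(2)])
    show "bounded C" using CB bounded_ball bounded_subset by blast
    show "continuous_on (closure C) h2" unfolding h2_def
      using cl clB by (intro continuous_intros continuous_on_compose2[OF u_cont] \<phi>_cont) auto
    show "continuous_on (closure C) D2" unfolding D2_def
      using cl clB by (intro continuous_intros continuous_on_compose2[OF Du_cont] \<phi>_cont) auto
    show "GDERIV h2 x :> D2 x" if "x \<in> C" for x
    proof -
      have "GDERIV u (\<phi> x) :> Du (\<phi> x)" using that C0(3) by (intro u_grad) (auto simp: C_def)
      then have "GDERIV (\<lambda>x. u (\<phi> x)) x :> (1 / t) *\<^sub>R Du (\<phi> x)"
        by (rule GDERIV_compose_symmetric[where L = "\<lambda>x. (1 / t) *\<^sub>R x" and a = a, rotated -1])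
           (auto simp: \<phi>_def intro: linear_scaleR linearI simp: algebra_simps)
      from GDERIV_diff[OF this GDERIV_const] show ?thesis by (simp add: h2_def D2_def)
    qed
    show "h2 x \<le> 0" if "x \<in> frontier C" for x
    proof -
      have x: "x \<in> closure C" "x \<notin> C" using that openC by (auto simp: frontier_def interior_open)
      then have "\<phi> x \<in> frontier C0" using cl C0(1) by (auto simp: frontier_def interior_open C_def)
      then show ?thesis using C0(5) by (simp add: h2_def)
    qed
  qed
  note cd1 = cut_data_level[OF c(1)]
  have nn: "0 \<le> u x - pos_cut B (\<lambda>x. u x - l) x" if "x \<in> B" for x
    using that u_nonneg[of x] c by (auto simp: pos_cut_def max_def)
  let ?v = "\<lambda>x. u x - pos_cut B (\<lambda>x. u x - l) x + pos_cut C h2 x"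
  let ?D = "\<lambda>x. Du x - grad_cut B (\<lambda>x. u x - l) Du x + grad_cut C h2 D2 x"
  have E: "energy u Du \<le> energy ?v ?D" "set_integrable lborel B (\<lambda>x. G (norm (?D x)) - F (?v x))"
    using energy_le_cut[where \<eta> = "\<lambda>_. 0" and D\<eta> = "\<lambda>_. 0",
        OF cd1 subset_refl cd2 CB continuous_on_const continuous_on_const GDERIV_const refl] nn
    by simp_all
  have At: "x \<in> C \<and> h2 x > 0 \<longleftrightarrow> \<phi> x \<in> A" for x
    using C0(3,4) by (auto simp: C_def h2_def A_def)
  \<comment> \<open>The stretched piece is placed on the plateau at height \<open>l\<close> instead
    of \<open>c\<close>. Here \<kappa> is this drop, and each comparison of densities pays at most
    \<open>K * \<kappa>\<close> for it.\<close>
  define \<kappa> where "\<kappa> = c - l"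
  have \<kappa>: "\<kappa> \<ge> 0" using c by (simp add: \<kappa>_def)
  have Fl: "\<bar>F l - F c\<bar> \<le> K * \<kappa>"
    using K(2)[of c l] c M(2) by (simp add: \<kappa>_def)
  have Fu: "\<bar>F (u x) - F c\<bar> \<le> K * \<kappa>" if "l \<le> u x" "u x \<le> c" for x
  proof -
    have "\<bar>F (u x) - F c\<bar> \<le> K * \<bar>u x - c\<bar>" using that c M(2) by (intro K(2)) auto
    also have "\<dots> \<le> K * \<kappa>" using that K(1) by (intro mult_left_mono) (auto simp: \<kappa>_def)
    finally show ?thesis .
  qed
  have K\<kappa>: "K * \<kappa> \<ge> 0" using K(1) \<kappa> by simp
  have openA: "open {x. \<phi> x \<in> A}"
  proof -
    have "continuous_on C h2" using cd2 by (auto simp: cut_data_def intro: continuous_on_subset[OF _ closure_subset])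
    then have "open (h2 -` {0<..} \<inter> C)" using continuous_on_open_vimage[OF openC] open_greaterThan by blast
    moreover have "h2 -` {0<..} \<inter> C = {x. \<phi> x \<in> A}" using At by auto
    ultimately show ?thesis by simp
  qed
  have levelA: "x \<in> B" "l \<le> u x" if "\<phi> x \<in> A" for x
    using that level[of "\<phi> x"] \<phi>1[of x] C0(4)[of "\<phi> x"] sub[of "\<phi> x"] by (auto simp: A_def)
  have new_le: "G (norm (?D x)) - F (?v x) + F c \<le> (1 / t) * q (\<phi> x) - w (\<phi> x) + K * \<kappa>"
    if x: "x \<in> B" "u x > l \<or> \<phi> x \<in> A" for x
  proof (cases "\<phi> x \<in> A")
    case True
    have "Du x - grad_cut B (\<lambda>x. u x - l) Du x = 0"
    proof (cases "u x > l")
      case False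
      \<comment> \<open>At such points \<open>grad_cut\<close> subtracts nothing, so
        \<open>Du x\<close> itself has to vanish. It does, because \<open>u\<close> is at least
        \<open>l\<close> on the open stretched set and \<open>x\<close> is a local minimum.\<close>
      then have "u x = l" using levelA(2)[OF True] by simp
      then have "Du x = 0"
        using levelA True openA by (intro grad_zero_at_min[of x "{x. \<phi> x \<in> A}"]) auto
      then show ?thesis by (simp add: grad_cut_def)
    qed (use x in \<open>simp add: grad_cut_def\<close>)
    moreover have "grad_cut C h2 D2 x = D2 x" using At[of x] True by (simp add: grad_cut_def)
    ultimately have D: "?D x = (1 / t) *\<^sub>R Du (\<phi> x)" by (simp add: D2_def)
    have v: "?v x = u (\<phi> x) - \<kappa>"
      using At[of x] True levelA(2)[OF True] x by (auto simp: pos_cut_def h2_def \<kappa>_def)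
    have A: "\<phi> x \<in> B" "u (\<phi> x) > c" using True by (auto simp: A_def)
    have "\<bar>F (u (\<phi> x) - \<kappa>) - F (u (\<phi> x))\<bar> \<le> K * \<bar>(u (\<phi> x) - \<kappa>) - u (\<phi> x)\<bar>"
      using A M(1)[of "\<phi> x"] c \<kappa> by (intro K(2)) (auto simp: \<kappa>_def)
    then have "- F (u (\<phi> x) - \<kappa>) \<le> - F (u (\<phi> x)) + K * \<kappa>" using \<kappa> by simp
    moreover have "G (norm (Du (\<phi> x)) / t) \<le> (1 / t) * G (norm (Du (\<phi> x)))"
      using G_scale[of t "norm (Du (\<phi> x))"] t by (simp add: field_simps)
    ultimately show ?thesis using True t by (simp add: D v q_def w_def)
  next
    case False
    then have "u x > l" using x by simp
    then have D: "?D x = 0" and v: "?v x = l"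
      using At[of x] False x by (auto simp: grad_cut_def pos_cut_def)
    show ?thesis using False Fl by (simp add: D v q_def w_def primitive_0)
  qed
  have old_ge: "- (G (norm (Du x)) - F (u x) + F c) \<le> - q x + w x + K * \<kappa>"
    if x: "x \<in> B" "u x > l \<or> \<phi> x \<in> A" for x
  proof (cases "x \<in> A")
    case True
    then show ?thesis using K\<kappa> by (simp add: q_def w_def)
  next
    case False
    then have "l \<le> u x" "u x \<le> c" using x levelA by (auto simp: A_def)
    from Fu[OF this] G_nonneg[of "norm (Du x)"] show ?thesis using False by (simp add: q_def w_def)
  qed
  let ?m = "\<lambda>x. (1 / t) * q (\<phi> x) - w (\<phi> x) - q x + w x + 2 * (K * \<kappa>) * indicator B x"
  let ?\<Delta> = "\<lambda>x. (G (norm (?D x)) - F (?v x)) - (G (norm (Du x)) - F (u x))"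
  have point: "indicator B x *\<^sub>R ?\<Delta> x \<le> ?m x" for x
  proof (cases "x \<in> B \<and> (u x > l \<or> \<phi> x \<in> A)")
    case True
    then show ?thesis using new_le[of x] old_ge[of x] by simp
  next
    case False
    then have "\<phi> x \<notin> A" "x \<notin> A" using levelA[of x] c by (auto simp: A_def)
    moreover have "x \<in> B \<Longrightarrow> ?\<Delta> x = 0"
      using False At[of x] by (auto simp: pos_cut_def grad_cut_def)
    ultimately show ?thesis using K\<kappa> by (cases "x \<in> B") (auto simp: q_def w_def)
  qed
  have t0: "1 / t \<noteq> 0" using t by simp
  have [measurable]: "q \<in> borel_measurable borel" "w \<in> borel_measurable borel"
    using q w by (auto dest: borel_measurable_integrable)
  have i\<phi>: "integrable lborel (\<lambda>x. q (\<phi> x))" "integrable lborel (\<lambda>x. w (\<phi> x))"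
    using lborel_integral_affine_euclidean(1)[OF t0, of q a] lborel_integral_affine_euclidean(1)[OF t0, of w a] q w
    by (simp_all add: \<phi>_def)
  define n where "n = DIM(real ^ 'n)"
  have n: "n \<ge> 1" unfolding n_def by (simp add: Suc_leI)
  define Q where "Q = (LINT x|lborel. q x)"
  define W where "W = (LINT x|lborel. w x)"
  have sc: "(LINT x|lborel. k (\<phi> x)) = t ^ n * (LINT x|lborel. k x)" if "k \<in> borel_measurable borel" for k :: "real ^ 'n \<Rightarrow> real"
  proof -
    have "(LINT x|lborel. k x) = (1 / t) ^ n * (LINT x|lborel. k (\<phi> x))"
      using lborel_integral_affine_euclidean(2)[OF t0 that, of a] t by (simp add: \<phi>_def n_def)
    then show ?thesis using t by (simp add: power_one_over)
  qed
  have iB: "integrable lborel (\<lambda>x. 2 * (K * \<kappa>) * indicator B x :: real)"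
    using emeasure_lborel_ball_finite[of "0 :: real ^ 'n" R] by (intro integrable_mult_right integrable_real_indicator) auto
  have i\<Delta>: "set_integrable lborel B ?\<Delta>" by (rule set_integral_diff(1)[OF E(2) integrable_u])
  have "(LINT x:B|lborel. ?\<Delta> x) = energy ?v ?D - energy u Du"
    unfolding energy_def by (rule set_integral_diff(2)[OF E(2) integrable_u])
  then have "0 \<le> (LINT x:B|lborel. ?\<Delta> x)" using E(1) by simp
  also have "\<dots> \<le> (LINT x|lborel. ?m x)"
    unfolding set_lebesgue_integral_def using i\<Delta> q w i\<phi> iB
    by (intro integral_mono point Bochner_Integration.integrable_add Bochner_Integration.integrable_diff integrable_mult_right)
       (simp_all add: set_integrable_def)
  also have "\<dots> = (1 / t) * (t ^ n * Q) - t ^ n * W - Q + W + 2 * (K * \<kappa>) * measure lborel B"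
    using q w i\<phi> iB by (simp add: sc Q_def W_def)
  finally have *: "0 \<le> (1 / t) * (t ^ n * Q) - t ^ n * W - Q + W + 2 * (K * \<kappa>) * measure lborel B" .
  obtain m where m: "n = Suc m" using n by (cases n) auto
  have tm: "t ^ m \<ge> 1" using t by simp
  \<comment> \<open>Replacing \<open>W\<close> by \<open>Q\<close> eliminates \<open>F\<close>; the
    coefficient of \<open>Q\<close> that remains is t^(n-1) - t^n = - t^m (t - 1).\<close>
  have "(t ^ n - 1) * Q \<le> (t ^ n - 1) * W"
    using qw t by (intro mult_left_mono) (auto simp: Q_def W_def)
  then have "t ^ m * (t - 1) * Q \<le> 2 * (K * \<kappa>) * measure lborel B"
    using * t by (simp add: m algebra_simps)
  moreover have "Q \<ge> 0" unfolding Q_def q_def by (intro integral_nonneg_AE) (auto simp: G_nonneg)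
  then have "(t - 1) * Q \<le> t ^ m * ((t - 1) * Q)"
    using tm t mult_right_mono[of 1 "t ^ m" "(t - 1) * Q"] by simp
  ultimately show ?thesis
    by (simp add: Q_def q_def A_def \<kappa>_def mult_ac)
qed

end

section \<open>Profiles along rays\<close>

text \<open>The derivative is required to be nonzero only below the value \<open>M\<close>, so that
  a plateau at the maximum is allowed.\<close>

definition profile :: "real \<Rightarrow> real \<Rightarrow> (real \<Rightarrow> real) \<Rightarrow> (real \<Rightarrow> real) \<Rightarrow> bool" where
  "profile R M P P' \<longleftrightarrow> continuous_on {0..R} P \<and> P 0 = M \<and> P R = 0 \<and>
     (\<forall>r. 0 < r \<longrightarrow> r < R \<longrightarrow> (P has_real_derivative P' r) (at r)) \<and>
     (\<forall>r s. 0 \<le> r \<longrightarrow> r \<le> s \<longrightarrow> s \<le> R \<longrightarrow> P s \<le> P r) \<and>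
     (\<forall>r. 0 < r \<longrightarrow> r < R \<longrightarrow> 0 < P r \<and> (P r < M \<longrightarrow> P' r \<noteq> 0))"

text \<open>Values strictly below \<open>M\<close> avoid the plateau; there the nonvanishing
  derivative makes the profile injective and its inverse differentiable.\<close>

lemma profile_inverse:
  assumes "profile R M P P'" "R > 0" "M > 0"
  obtains k where "\<And>y. 0 < y \<Longrightarrow> y < M \<Longrightarrow> 0 < k y \<and> k y < R \<and> P (k y) = y"
    "\<And>r. 0 < r \<Longrightarrow> r < R \<Longrightarrow> P r < M \<Longrightarrow> k (P r) = r"
    "\<And>y. 0 < y \<Longrightarrow> y < M \<Longrightarrow> (k has_real_derivative inverse (P' (k y))) (at y)"
proof -
  have P: "continuous_on {0..R} P" "P 0 = M" "P R = 0"
    and deriv: "\<And>r. 0 < r \<Longrightarrow> r < R \<Longrightarrow> (P has_real_derivative P' r) (at r)"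
    and mono: "\<And>r s. 0 \<le> r \<Longrightarrow> r \<le> s \<Longrightarrow> s \<le> R \<Longrightarrow> P s \<le> P r"
    and pos: "\<And>r. 0 < r \<Longrightarrow> r < R \<Longrightarrow> 0 < P r"
    and nz: "\<And>r. 0 < r \<Longrightarrow> r < R \<Longrightarrow> P r < M \<Longrightarrow> P' r \<noteq> 0"
    using assms(1) unfolding profile_def by blast+
  have ex: "\<exists>r. 0 < r \<and> r < R \<and> P r = y" if "0 < y" "y < M" for y
  proof -
    have "\<exists>r\<ge>0. r \<le> R \<and> P r = y" using that P assms by (intro IVT2') auto
    then obtain r where r: "0 \<le> r" "r \<le> R" "P r = y" by auto
    then have "r \<noteq> 0" "r \<noteq> R" using that P by auto
    then show ?thesis using r by (intro exI[of _ r]) auto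
  qed
  \<comment> \<open>Between two points with equal values the mean value theorem gives a critical
    point, and monotonicity keeps its value below \<open>M\<close>.\<close>
  have no: False if "0 < r" "r < s" "s < R" "P r = P s" "P r < M" for r s
  proof -
    obtain \<xi> where \<xi>: "r < \<xi>" "\<xi> < s" "P s - P r = (s - r) * P' \<xi>"
      using MVT2[of r s P P'] deriv \<open>r < s\<close> \<open>0 < r\<close> \<open>s < R\<close> by (metis le_less_trans less_le_trans)
    have "P' \<xi> = 0" using \<xi> that by simp
    moreover have "P \<xi> < M" using mono[of r \<xi>] \<xi> that by simp
    ultimately show False using nz[of \<xi>] \<xi> that by simp
  qed
  define k where "k = (\<lambda>y. SOME r. 0 < r \<and> r < R \<and> P r = y)"
  have k: "0 < k y \<and> k y < R \<and> P (k y) = y" if "0 < y" "y < M" for y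
    unfolding k_def by (rule someI_ex[OF ex[OF that]])
  have kP: "k (P r) = r" if "0 < r" "r < R" "P r < M" for r
  proof -
    have kr: "0 < k (P r)" "k (P r) < R" "P (k (P r)) = P r" using k[OF pos[OF that(1,2)] that(3)] by auto
    have "\<not> r < k (P r)" using no[OF that(1) _ kr(2) kr(3)[symmetric] that(3)] by blast
    moreover have "P (k (P r)) < M" using kr(3) that(3) by simp
    then have "\<not> k (P r) < r" using no[OF kr(1) _ that(2) kr(3)] by blast
    ultimately show ?thesis by simp
  qed
  have dk: "(k has_real_derivative inverse (P' (k y))) (at y)" if y: "0 < y" "y < M" for y
  proof (rule DERIV_inverse_function[where f = P and a = 0 and b = M])
    have ky: "0 < k y" "k y < R" "P (k y) = y" using k[OF y] by auto
    show "(P has_real_derivative P' (k y)) (at (k y))" "P' (k y) \<noteq> 0"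
      using deriv nz ky y by auto
    show "0 < y" "y < M" using y by auto
    show "P (k y) = y" if "0 < y" "y < M" for y using k that by auto
    have cont: "isCont P z" if "0 < z" "z < R" for z using deriv[OF that] by (rule DERIV_isCont)
    have "eventually (\<lambda>z. P z < M) (at (k y))"
      using cont[OF ky(1,2)] y(2) ky(3) by (intro order_tendstoD(2)[of P y]) (auto simp: isCont_def)
    then obtain d where d: "d > 0" "\<And>z. z \<noteq> k y \<Longrightarrow> dist z (k y) < d \<Longrightarrow> P z < M"
      unfolding eventually_at by auto
    define e where "e = min (d / 2) (min (k y / 2) ((R - k y) / 2))"
    have e: "e > 0" "e < d" "e < k y" "e < R - k y" using d(1) ky by (auto simp: e_def min_def)
    have "isCont k (P (k y))"
    proof (rule isCont_inverse_function[where f = P and x = "k y", OF e(1)])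
      fix z assume z: "\<bar>z - k y\<bar> \<le> e"
      then have "0 < z" "z < R" using e by auto
      moreover have "P z < M" using d(2)[of z] z e(2) ky y by (cases "z = k y") (auto simp: dist_real_def)
      ultimately show "k (P z) = z" "isCont P z" using kP cont by auto
    qed
    then show "isCont k y" by (simp add: ky)
  qed
  show ?thesis by (rule that[OF k kP dk])
qed

lemma profiles_eq:
  assumes P: "profile R M P P'" and Q: "profile R M Q Q'" and RM: "R > 0" "M > 0"
    and match: "\<And>r s. 0 < r \<Longrightarrow> r < R \<Longrightarrow> 0 < s \<Longrightarrow> s < R \<Longrightarrow> P r = Q s \<Longrightarrow> P' r = Q' s"
    and r: "0 \<le> r" "r \<le> R"
  shows "P r = Q r"
proof -
  obtain k where k: "\<And>y. 0 < y \<Longrightarrow> y < M \<Longrightarrow> 0 < k y \<and> k y < R \<and> P (k y) = y"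
    "\<And>r. 0 < r \<Longrightarrow> r < R \<Longrightarrow> P r < M \<Longrightarrow> k (P r) = r"
    "\<And>y. 0 < y \<Longrightarrow> y < M \<Longrightarrow> (k has_real_derivative inverse (P' (k y))) (at y)"
    using profile_inverse[OF P RM] by blast
  obtain j where j: "\<And>y. 0 < y \<Longrightarrow> y < M \<Longrightarrow> 0 < j y \<and> j y < R \<and> Q (j y) = y"
    "\<And>r. 0 < r \<Longrightarrow> r < R \<Longrightarrow> Q r < M \<Longrightarrow> j (Q r) = r"
    "\<And>y. 0 < y \<Longrightarrow> y < M \<Longrightarrow> (j has_real_derivative inverse (Q' (j y))) (at y)"
    using profile_inverse[OF Q RM] by blast
  have const: "k x - j x = k y - j y" if "x \<in> {0<..<M}" "y \<in> {0<..<M}" for x y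
  proof (rule DERIV_isconst3[OF RM(2) that])
    fix z assume z: "z \<in> {0<..<M}"
    have "P' (k z) = Q' (j z)" using k(1)[of z] j(1)[of z] z by (intro match) auto
    then show "((\<lambda>z. k z - j z) has_real_derivative 0) (at z)"
      using DERIV_diff[OF k(3)[of z] j(3)[of z]] z by simp
  qed
  \<comment> \<open>A constant gap \<tau> > 0 would confine all values of \<open>j\<close> to radii
    below \<open>R - \<tau>\<close>. Then \<open>Q\<close>, being antimonotone, could not take
    values below \<open>Q (R - \<tau>) > 0\<close> there. The statement is generic so that it
    excludes both signs of the gap.\<close>
  have no: False
    if K: "\<And>y. 0 < y \<Longrightarrow> y < M \<Longrightarrow> 0 < k y \<and> k y < R \<and> P (k y) = y"
      and J: "\<And>y. 0 < y \<Longrightarrow> y < M \<Longrightarrow> 0 < j y \<and> j y < R \<and> Q (j y) = y"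
      and C: "\<And>x y. x \<in> {0<..<M} \<Longrightarrow> y \<in> {0<..<M} \<Longrightarrow> k x - j x = k y - j y"
      and Q: "profile R M Q Q'" and y: "0 < y" "y < M" "j y < k y" for y j k P Q Q'
  proof -
    define \<tau> where "\<tau> = k y - j y"
    have \<tau>: "0 < \<tau>" "\<tau> < R" using y K[of y] J[of y] by (auto simp: \<tau>_def)
    have "0 < Q (R - \<tau>)" using Q \<tau> by (simp add: profile_def)
    define y' where "y' = min (Q (R - \<tau>)) M / 2"
    have y': "0 < y'" "y' < M" "y' < Q (R - \<tau>)" using \<open>0 < Q (R - \<tau>)\<close> RM by (auto simp: y'_def)
    have "j y' = k y' - \<tau>" using C[of y' y] y y' by (simp add: \<tau>_def)
    then have "j y' < R - \<tau>" "0 < j y'" "Q (j y') = y'" using K[of y'] J[of y'] y' by auto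
    then have "Q (R - \<tau>) \<le> y'" using Q \<tau> unfolding profile_def by (metis diff_le_eq le_add_same_cancel1 less_imp_le)
    then show False using y' by simp
  qed
  have kj: "k y = j y" if "0 < y" "y < M" for y
  proof -
    have const': "j x - k x = j y - k y" if "x \<in> {0<..<M}" "y \<in> {0<..<M}" for x y
      using const[OF that] by simp
    show ?thesis
      using no[OF k(1) j(1) const Q that] no[OF j(1) k(1) const' P that] by (cases "k y" "j y" rule: linorder_cases) auto
  qed
  have half: "P r = Q r" if "P r < M" "0 < r" "r < R" "profile R M P P'"
      "\<And>y. 0 < y \<Longrightarrow> y < M \<Longrightarrow> 0 < j y \<and> j y < R \<and> Q (j y) = y"
      "\<And>r. 0 < r \<Longrightarrow> r < R \<Longrightarrow> P r < M \<Longrightarrow> k (P r) = r" "\<And>y. 0 < y \<Longrightarrow> y < M \<Longrightarrow> k y = j y" for P Q P' j k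
    using that unfolding profile_def by metis
  consider "r = 0" | "r = R" | "0 < r" "r < R" using r by linarith
  then show ?thesis
  proof cases
    case 3
    have "P r \<le> M" "Q r \<le> M" using P Q 3 unfolding profile_def by (metis less_imp_le order_refl)+
    moreover have "P r < M \<Longrightarrow> P r = Q r" using half[OF _ 3 P j(1) k(2) kj] by blast
    moreover have "Q r < M \<Longrightarrow> Q r = P r" using half[OF _ 3 Q k(1) j(2) kj[symmetric]] by blast
    ultimately show ?thesis by linarith
  qed (use P Q in \<open>auto simp: profile_def\<close>)
qed

section \<open>Critical points and behaviour along rays\<close>

context ball_minimizer
begin

text \<open>Since the derivative at \<open>p\<close> in direction \<open>p - z\<close> is 0, the
  level at the displaced point drops by o(t - 1). Dividing \<open>stretch_inequality\<close> by t -
  1 and letting t tend to 1 from the right gives \<open>Q \<le> 0\<close>, while a nonzero gradient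
  above the level would make \<open>Q\<close> positive. The centre \<open>z\<close> and the convex
  set \<open>C0\<close> are left free, as the radial and the one-dimensional case need different
  ones.\<close>

lemma no_flat_level:
  assumes p: "p \<in> B" "Du p \<bullet> (p - z) = 0" and T: "T > 1"
    and C0: "open C0" "convex C0" "C0 \<subseteq> B" "\<And>x. x \<in> B \<Longrightarrow> u x > u p \<Longrightarrow> x \<in> C0"
      "\<And>x. x \<in> frontier C0 \<Longrightarrow> u x \<le> u p"
    and path: "\<And>t. 1 < t \<Longrightarrow> t < T \<Longrightarrow> z + t *\<^sub>R (p - z) \<in> B \<and> u (z + t *\<^sub>R (p - z)) \<le> u p"
    and sub: "\<And>t x. 1 < t \<Longrightarrow> t < T \<Longrightarrow> x \<in> C0 \<Longrightarrow> z + t *\<^sub>R (x - z) \<in> B"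
    and level: "\<And>t x. 1 < t \<Longrightarrow> t < T \<Longrightarrow> x \<in> C0 \<Longrightarrow> u x > u p \<Longrightarrow> u (z + t *\<^sub>R (p - z)) \<le> u (z + t *\<^sub>R (x - z))"
    and x: "x \<in> B" "u x > u p"
  shows "Du x = 0"
proof (rule ccontr)
  assume "Du x \<noteq> 0"
  define c where "c = u p"
  have c: "c \<ge> 0" using u_nonneg[of p] p by (simp add: c_def)
  define A where "A = {x \<in> B. u x > c}"
  define Q where "Q = (LINT x|lborel. indicator A x * G (norm (Du x)))"
  obtain M where M: "M > 0" "\<And>x. x \<in> cball 0 R \<Longrightarrow> u x \<le> M" by (rule u_bounded, rule that)
  obtain K where K: "K > 0" "\<And>a b. 0 \<le> a \<Longrightarrow> a \<le> M \<Longrightarrow> 0 \<le> b \<Longrightarrow> b \<le> M \<Longrightarrow> \<bar>F b - F a\<bar> \<le> K * \<bar>b - a\<bar>"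
    by (rule F_lipschitz[of M], rule that)
  define l where "l = (\<lambda>t. u (z + t *\<^sub>R (p - z)))"
  have l1: "l 1 = c" by (simp add: l_def c_def)
  have Q_le: "Q \<le> - (2 * K * measure lborel B) * ((l t - l 1) / (t - 1))" if t: "1 < t" "t < T" for t
  proof -
    have "(t - 1) * Q \<le> 2 * K * (c - l t) * measure lborel B"
      unfolding Q_def A_def
    proof (rule stretch_inequality[OF _ _ t(1) C0(1-3) _ _ sub[OF t] _ K M(2)])
      show "0 \<le> l t" using path[OF t] u_nonneg by (auto simp: l_def)
      show "l t \<le> c" using path[OF t] by (auto simp: l_def c_def)
      show "c \<le> M" using M(2) p by (auto simp: c_def)
      show "l t \<le> u (z + t *\<^sub>R (x - z))" if "x \<in> C0" "u x > c" for x
        using level[OF t] that by (simp add: l_def c_def)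
    qed (use C0(4,5) in \<open>simp_all add: c_def\<close>)
    then show ?thesis using t by (simp add: l1 field_simps)
  qed
  have "(l has_real_derivative 0) (at 1)"
  proof -
    have "((\<lambda>t. u (z + t *\<^sub>R (p - z))) has_derivative (\<lambda>d. 0)) (at 1)"
    proof (rule has_derivative_compose[of "\<lambda>t. z + t *\<^sub>R (p - z)" "\<lambda>d. d *\<^sub>R (p - z)" 1 UNIV u, THEN has_derivative_eq_rhs])
      show "((\<lambda>t. z + t *\<^sub>R (p - z)) has_derivative (\<lambda>d. d *\<^sub>R (p - z))) (at 1)"
        by (auto intro!: derivative_eq_intros)
      show "(u has_derivative (\<lambda>d. d \<bullet> Du p)) (at (z + 1 *\<^sub>R (p - z)))"
        using u_grad[OF p(1)] by (simp add: gderiv_def)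
    qed (use p(2) in \<open>simp add: inner_commute\<close>)
    then show ?thesis by (auto simp: l_def has_field_derivative_def elim!: has_derivative_eq_rhs)
  qed
  then have "((\<lambda>t. (l t - l 1) / (t - 1)) \<longlongrightarrow> 0) (at_right 1)"
    unfolding has_field_derivative_iff by (rule tendsto_mono[rotated]) (simp add: at_le)
  then have "((\<lambda>t. - (2 * K * measure lborel B) * ((l t - l 1) / (t - 1))) \<longlongrightarrow> - (2 * K * measure lborel B) * 0) (at_right 1)"
    by (intro tendsto_mult_left)
  moreover have "eventually (\<lambda>t. Q \<le> - (2 * K * measure lborel B) * ((l t - l 1) / (t - 1))) (at_right 1)"
    using T Q_le by (auto simp: eventually_at_right_field)
  ultimately have "Q \<le> - (2 * K * measure lborel B) * 0"
    by (intro tendsto_lowerbound) auto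
  then have "Q \<le> 0" by simp
  have "open A" unfolding A_def by (rule open_superlevel)
  have AB: "A \<subseteq> B" by (auto simp: A_def)
  define \<eta> where "\<eta> = G (norm (Du x)) / 2"
  have \<eta>: "\<eta> > 0" using G_pos[of "norm (Du x)"] \<open>Du x \<noteq> 0\<close> by (simp add: \<eta>_def)
  have "continuous_on A (\<lambda>x. G (norm (Du x)))"
    using AB by (intro continuous_on_compose2[OF G_cont] continuous_intros continuous_on_subset[OF Du_cont]) auto
  then have "open ((\<lambda>x. G (norm (Du x))) -` {\<eta><..} \<inter> A)"
    using continuous_on_open_vimage[OF \<open>open A\<close>] open_greaterThan by blast
  moreover have "x \<in> (\<lambda>x. G (norm (Du x))) -` {\<eta><..} \<inter> A"
    using x \<eta> by (auto simp: \<eta>_def A_def c_def)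
  ultimately obtain d where d: "d > 0" "ball x d \<subseteq> (\<lambda>x. G (norm (Du x))) -` {\<eta><..} \<inter> A"
    by (rule openE)
  have "0 < measure lborel (ball x d) * \<eta>" using content_ball_pos[OF d(1)] \<eta> by simp
  also have "\<dots> = (LINT y|lborel. indicator (ball x d) y *\<^sub>R \<eta>)" by simp
  also have "\<dots> \<le> Q" unfolding Q_def
  proof (rule integral_mono)
    show "integrable lborel (\<lambda>y. indicator (ball x d) y *\<^sub>R \<eta>)"
      using emeasure_lborel_ball_finite[of x d] by (intro integrableI_bounded_set_indicator[where B = \<eta>]) (use \<eta> in auto)
    show "integrable lborel (\<lambda>x. indicator A x * G (norm (Du x)))"
      using truncation_le(1)[OF c] by (simp add: A_def)
    show "indicator (ball x d) y *\<^sub>R \<eta> \<le> indicator A y * G (norm (Du y))" for y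
    proof (cases "y \<in> ball x d")
      case True
      then show ?thesis using d(2) by (force simp: less_imp_le)
    qed (simp add: G_nonneg)
  qed
  finally show False using \<open>Q \<le> 0\<close> by simp
qed

lemma DERIV_ray:
  assumes "norm e = 1" "\<bar>r\<bar> < R"
  shows "((\<lambda>r. u (r *\<^sub>R e)) has_real_derivative Du (r *\<^sub>R e) \<bullet> e) (at r)"
proof -
  have "((\<lambda>r. u (r *\<^sub>R e)) has_derivative (*) (Du (r *\<^sub>R e) \<bullet> e)) (at r)"
    using u_grad[of "r *\<^sub>R e"] assms
    by (intro has_derivative_compose[of "\<lambda>r. r *\<^sub>R e" "\<lambda>d. d *\<^sub>R e" r UNIV u, THEN has_derivative_eq_rhs])
       (auto intro!: derivative_eq_intros simp: gderiv_def inner_commute fun_eq_iff)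
  then show ?thesis by (simp add: has_field_derivative_def)
qed

lemma continuous_on_ray:
  assumes "norm e = 1"
  shows "continuous_on {0..R} (\<lambda>r. u (r *\<^sub>R e))" "continuous_on {0..R} (\<lambda>r. Du (r *\<^sub>R e) \<bullet> e)"
  using assms by (auto intro!: continuous_intros continuous_on_compose2[OF u_cont] continuous_on_compose2[OF Du_cont])

lemma ray_slope_nonpos:
  assumes "norm e = 1" "0 \<le> r" "r < R"
  shows "Du (r *\<^sub>R e) \<bullet> e \<le> 0"
  using assms inner_self_unit[OF assms(1)] by (intro slope_nonpos) auto

lemma ray_antimono:
  assumes e: "norm e = 1" and "0 \<le> r" "r \<le> s" "s \<le> R"
  shows "u (s *\<^sub>R e) \<le> u (r *\<^sub>R e)"
proof (rule DERIV_nonpos_imp_decreasing_open[OF \<open>r \<le> s\<close>])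
  show "continuous_on {r..s} (\<lambda>r. u (r *\<^sub>R e))"
    using assms by (intro continuous_on_subset[OF continuous_on_ray(1)[OF e]]) auto
  fix x assume x: "r < x" "x < s"
  then have "0 \<le> x" "x < R" using assms by auto
  then show "\<exists>y. ((\<lambda>r. u (r *\<^sub>R e)) has_real_derivative y) (at x) \<and> y \<le> 0"
    using DERIV_ray[OF e, of x] ray_slope_nonpos[OF e, of x] by auto
qed

text \<open>Along the ray, \<open>soft_pos\<close> of the excess over the level has derivative 0
  throughout: above the level the gradient vanishes, elsewhere \<open>soft_step\<close> does. Hence
  the excess at the origin equals that at \<open>r\<close>, namely 0, without any study of the shape
  of the superlevel set.\<close>

lemma ray_constant:
  assumes e: "norm e = 1" and r: "0 < r" "r < R"
    and flat: "\<And>x. x \<in> B \<Longrightarrow> u x > u (r *\<^sub>R e) \<Longrightarrow> Du x = 0"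
  shows "u (r *\<^sub>R e) = u 0"
proof (rule ccontr)
  assume "u (r *\<^sub>R e) \<noteq> u 0"
  moreover have "u (r *\<^sub>R e) \<le> u (0 *\<^sub>R e)" using ray_antimono[OF e, of 0 r] r by simp
  ultimately have lt: "u (r *\<^sub>R e) < u 0" by simp
  define k where "k = (\<lambda>s. soft_pos 1 (u (s *\<^sub>R e) - u (r *\<^sub>R e)))"
  have k0: "(k has_real_derivative 0) (at s)" if "\<bar>s\<bar> < R" for s
  proof -
    have "(k has_real_derivative soft_step 1 (u (s *\<^sub>R e) - u (r *\<^sub>R e)) * (Du (s *\<^sub>R e) \<bullet> e)) (at s)"
      unfolding k_def using DERIV_ray[OF e that]
      by (intro DERIV_chain2[OF DERIV_soft_pos]) (auto intro!: derivative_eq_intros)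
    moreover have "soft_step 1 (u (s *\<^sub>R e) - u (r *\<^sub>R e)) * (Du (s *\<^sub>R e) \<bullet> e) = 0"
    proof (cases "u (s *\<^sub>R e) > u (r *\<^sub>R e)")
      case True
      then show ?thesis using flat[of "s *\<^sub>R e"] that e by simp
    qed (simp add: soft_step_def)
    ultimately show ?thesis by simp
  qed
  have "k r = k 0"
    using r by (intro DERIV_isconst_end) (auto intro!: k0 DERIV_isCont continuous_at_imp_continuous_on)
  then show False using lt by (simp add: k_def soft_pos_def max_def)
qed

text \<open>If \<open>v\<close> is tangent to the sphere, \<open>slope_nonpos\<close> applies to
  both \<open>v\<close> and \<open>- v\<close>, so tangential derivatives vanish. The points
  \<open>x\<close> and \<open>y\<close> are then joined by an arc of a great circle in the plane of
  \<open>a\<close> and \<open>b\<close>.\<close>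

lemma sphere_constant:
  assumes dim: "CARD('n) \<ge> 2" and x: "norm x = norm y" "x \<in> B"
  shows "u x = u y"
proof (cases "x = 0")
  case True
  then show ?thesis using x by simp
next
  case False
  define r where "r = norm x"
  have r: "r > 0" "r < R" using False x by (auto simp: r_def)
  define a where "a = (1 / r) *\<^sub>R x"
  have a: "norm a = 1" "x = r *\<^sub>R a" using r by (auto simp: a_def r_def)
  have aa: "a \<bullet> a = 1" by (rule inner_self_unit[OF a(1)])
  define w where "w = y - (y \<bullet> a) *\<^sub>R a"
  \<comment> \<open>If \<open>y\<close> is a multiple of \<open>x\<close>, the plane is not
    determined and any unit vector orthogonal to \<open>a\<close> will do; its existence requires
    dimension at least two.\<close>
  obtain b where b: "norm b = 1" "a \<bullet> b = 0" "w = (w \<bullet> b) *\<^sub>R b"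
  proof (cases "w = 0")
    case True
    obtain b where "b \<noteq> 0" "orthogonal a b" using orthogonal_to_vector_exists[of a] dim by auto
    then show ?thesis using that[of "(1 / norm b) *\<^sub>R b"] True by (simp add: orthogonal_def)
  next
    case False
    have "a \<bullet> w = 0" by (simp add: w_def inner_diff_right aa inner_commute)
    then show ?thesis using that[of "(1 / norm w) *\<^sub>R w"] False
      by (simp add: dot_square_norm power2_eq_square)
  qed
  have bb: "b \<bullet> b = 1" by (rule inner_self_unit[OF b(1)])
  define \<alpha> \<beta> where "\<alpha> = (y \<bullet> a) / r" and "\<beta> = (w \<bullet> b) / r"
  have y: "y = r *\<^sub>R (\<alpha> *\<^sub>R a + \<beta> *\<^sub>R b)"
    using b(3) r by (simp add: \<alpha>_def \<beta>_def scaleR_add_right) (simp add: w_def)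
  have n: "norm (p *\<^sub>R a + q *\<^sub>R b) ^ 2 = p\<^sup>2 + q\<^sup>2" for p q
    unfolding power2_norm_eq_inner
    by (simp add: inner_add_left inner_add_right aa bb b(2) inner_commute[of b a] power2_eq_square)
  have "r = r * norm (\<alpha> *\<^sub>R a + \<beta> *\<^sub>R b)"
    using x(1) r(1) arg_cong[OF y, of norm] by (simp add: r_def[symmetric])
  then have "norm (\<alpha> *\<^sub>R a + \<beta> *\<^sub>R b) = 1" using r(1) by simp
  then have "\<alpha>\<^sup>2 + \<beta>\<^sup>2 = 1" using n[of \<alpha> \<beta>] by simp
  then obtain \<theta> where \<theta>: "\<alpha> = cos \<theta>" "\<beta> = sin \<theta>" by (metis sincos_total_2pi)
  define \<gamma> where "\<gamma> = (\<lambda>t. r *\<^sub>R (cos t *\<^sub>R a + sin t *\<^sub>R b))"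
  have "((\<lambda>t. u (\<gamma> t)) has_real_derivative 0) (at t)" for t
  proof -
    define v where "v = (- sin t) *\<^sub>R a + cos t *\<^sub>R b"
    have v: "norm v = 1" using n[of "- sin t" "cos t"] by (simp add: v_def power2_eq_1_iff) (smt (verit) norm_ge_zero)
    have "norm (cos t *\<^sub>R a + sin t *\<^sub>R b) = 1" using n[of "cos t" "sin t"] by (simp add: power2_eq_1_iff) (smt (verit) norm_ge_zero)
    then have \<gamma>B: "\<gamma> t \<in> B" using r by (simp add: \<gamma>_def)
    have "\<gamma> t \<bullet> v = 0"
      by (simp add: \<gamma>_def v_def inner_add_left inner_add_right inner_diff_right aa bb b(2) inner_commute[of b a])
    then have "Du (\<gamma> t) \<bullet> v = 0"
      using slope_nonpos[OF \<gamma>B v] slope_nonpos[OF \<gamma>B, of "- v"] v by simp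
    then have 0: "(r *\<^sub>R v) \<bullet> Du (\<gamma> t) = 0" by (simp add: inner_commute)
    have "((\<lambda>t. u (\<gamma> t)) has_derivative (\<lambda>d. 0)) (at t)"
    proof (rule has_derivative_compose[of \<gamma> "\<lambda>d. d *\<^sub>R (r *\<^sub>R v)" t UNIV u, THEN has_derivative_eq_rhs])
      show "(\<gamma> has_derivative (\<lambda>d. d *\<^sub>R r *\<^sub>R v)) (at t)"
        unfolding \<gamma>_def v_def by (auto intro!: derivative_eq_intros simp: fun_eq_iff algebra_simps)
      show "(u has_derivative (\<lambda>d. d \<bullet> Du (\<gamma> t))) (at (\<gamma> t))" using u_grad[OF \<gamma>B] by (simp add: gderiv_def)
    qed (use 0 in \<open>auto simp: fun_eq_iff\<close>)
    then show ?thesis by (auto simp: has_field_derivative_def elim!: has_derivative_eq_rhs)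
  qed
  then have "u (\<gamma> 0) = u (\<gamma> \<theta>)" using DERIV_isconst_all[of "\<lambda>t. u (\<gamma> t)"] by blast
  then show ?thesis by (simp add: \<gamma>_def a(2)[symmetric] \<theta>[symmetric] y[symmetric])
qed

end

section \<open>Radial symmetry\<close>

lemma one_dim_coordinate:
  fixes e :: "real ^ 'n"
  assumes "CARD('n) = 1" "norm e = 1"
  shows "v = (v \<bullet> e) *\<^sub>R e"
proof -
  obtain i :: 'n where i: "UNIV = {i}" using assms(1) by (metis card_1_singletonE)
  have s: "a \<bullet> b = a $ i * b $ i" for a b :: "real ^ 'n" by (simp add: inner_vec_def i)
  have "e $ i * e $ i = 1" using inner_self_unit[OF assms(2)] by (simp add: s)
  then have "v $ i = (v \<bullet> e) * e $ i" by (simp add: s)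
  moreover have "j = i" for j using i by auto
  ultimately show ?thesis by (metis vec_eq_iff vector_scaleR_component real_scaleR_def)
qed

context ball_minimizer
begin

text \<open>With radial symmetry at hand the stretching is centred at the origin and
  \<open>C0\<close> is the ball of radius \<open>r\<close>; factors below \<open>R / r\<close> keep
  its image inside \<open>B\<close>.\<close>

lemma critical_ray_point_radial:
  assumes radial: "\<And>x y. norm x = norm y \<Longrightarrow> x \<in> B \<Longrightarrow> u x = u y"
    and e: "norm e = 1" and r: "0 < r" "r < R" and crit: "Du (r *\<^sub>R e) \<bullet> e = 0"
  shows "u (r *\<^sub>R e) = u 0"
proof (rule ray_constant[OF e r])
  have U: "u x = u (norm x *\<^sub>R e)" if "x \<in> B" for x using radial[of x "norm x *\<^sub>R e"] that e by simp
  fix x assume x: "x \<in> B" "u (r *\<^sub>R e) < u x"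
  show "Du x = 0"
  proof (rule no_flat_level[where p = "r *\<^sub>R e" and z = 0 and T = "R / r" and ?C0.0 = "ball 0 r"])
    show "r *\<^sub>R e \<in> B" using r e by simp
    show "Du (r *\<^sub>R e) \<bullet> (r *\<^sub>R e - 0) = 0" using crit by simp
    show "1 < R / r" using r by simp
    show "open (ball (0 :: real ^ 'n) r)" "convex (ball (0 :: real ^ 'n) r)" "ball 0 r \<subseteq> B" using r by auto
    show "x \<in> ball 0 r" if "x \<in> B" "u (r *\<^sub>R e) < u x" for x
    proof (rule ccontr)
      assume "x \<notin> ball 0 r"
      then have "u (norm x *\<^sub>R e) \<le> u (r *\<^sub>R e)" using that r by (intro ray_antimono[OF e]) auto
      then show False using U that by simp
    qed
    show "u x \<le> u (r *\<^sub>R e)" if "x \<in> frontier (ball 0 r)" for x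
      using that r U[of x] by (simp add: frontier_ball)
    fix t assume t: "1 < t" "t < R / r"
    have tr: "t * r < R" "r \<le> t * r" using t r by (auto simp: field_simps)
    show "0 + t *\<^sub>R (r *\<^sub>R e - 0) \<in> B \<and> u (0 + t *\<^sub>R (r *\<^sub>R e - 0)) \<le> u (r *\<^sub>R e)"
      using ray_antimono[OF e, of r "t * r"] tr r t e by simp
    fix x :: "real ^ 'n" assume x: "x \<in> ball 0 r"
    have tx: "t * norm x \<le> t * r" using x t by (intro mult_left_mono) auto
    have "norm (0 + t *\<^sub>R (x - 0)) = t * norm x" using t by simp
    then show B: "0 + t *\<^sub>R (x - 0) \<in> B" using tr(1) tx unfolding mem_ball_0 by linarith
    show "u (0 + t *\<^sub>R (r *\<^sub>R e - 0)) \<le> u (0 + t *\<^sub>R (x - 0))"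
      using ray_antimono[OF e, of "t * norm x" "t * r"] tx tr t U[OF B] by simp
  qed (use x in auto)
qed

lemma critical_ray_point_one_dim:
  assumes dim: "CARD('n) = 1"
    and e: "norm e = 1" and r: "0 < r" "r < R" and crit: "Du (r *\<^sub>R e) \<bullet> e = 0"
  shows "u (r *\<^sub>R e) = u 0"
proof (rule ray_constant[OF e r])
  have ee: "e \<bullet> e = 1" by (rule inner_self_unit[OF e])
  have one: "v = (v \<bullet> e) *\<^sub>R e" for v by (rule one_dim_coordinate[OF dim e])
  have nrm: "norm x = \<bar>x \<bullet> e\<bar>" for x
  proof -
    have "norm x = norm ((x \<bullet> e) *\<^sub>R e)" using one[of x] by simp
    then show ?thesis using e by simp
  qed
  have mono_neg: "u ((- s) *\<^sub>R e) \<le> u ((- r) *\<^sub>R e)" if "0 \<le> r" "r \<le> s" "s \<le> R" for r s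
    using ray_antimono[of "- e" r s] that e by simp
  fix x assume x: "x \<in> B" "u (r *\<^sub>R e) < u x"
  let ?C0 = "B \<inter> {x. x \<bullet> e < r}"
  show "Du x = 0"
  proof (rule no_flat_level[where p = "r *\<^sub>R e" and z = "(- R) *\<^sub>R e" and T = "2 * R / (r + R)" and ?C0.0 = ?C0])
    show "r *\<^sub>R e \<in> B" using r e by simp
    show "Du (r *\<^sub>R e) \<bullet> (r *\<^sub>R e - (- R) *\<^sub>R e) = 0" using crit by (simp add: inner_add_right)
    show "1 < 2 * R / (r + R)" using r by simp
    have "open {x. x \<bullet> e < r}" by (intro open_Collect_less continuous_intros)
    then show op: "open ?C0" by (intro open_Int open_ball)
    show "convex ?C0" "?C0 \<subseteq> B"
      using convex_halfspace_lt[of e r] by (auto simp: inner_commute[of e] intro!: convex_Int)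
    show "x \<in> ?C0" if x: "x \<in> B" "u (r *\<^sub>R e) < u x" for x
    proof (rule ccontr)
      assume "x \<notin> ?C0"
      then have "u ((x \<bullet> e) *\<^sub>R e) \<le> u (r *\<^sub>R e)"
        using x r nrm[of x] by (intro ray_antimono[OF e]) auto
      then show False using one[of x] x by simp
    qed
    show "u x \<le> u (r *\<^sub>R e)" if "x \<in> frontier ?C0" for x
    proof -
      have "closed {x. x \<bullet> e \<le> r}" by (intro closed_Collect_le continuous_intros)
      then have "closure ?C0 \<subseteq> cball 0 R \<inter> {x. x \<bullet> e \<le> r}"
        by (intro closure_minimal closed_Int closed_cball) auto
      moreover have "x \<in> closure ?C0" "x \<notin> ?C0"
        using that unfolding frontier_def interior_open[OF op] by blast+
      ultimately consider "norm x = R" | "x \<bullet> e = r" by fastforce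
      then show ?thesis
      proof cases
        case 1
        then show ?thesis using u_bdry[of x] u_nonneg[of "r *\<^sub>R e"] r e by simp
      next
        case 2
        then show ?thesis using one[of x] by simp
      qed
    qed
    fix t assume t: "1 < t" "t < 2 * R / (r + R)"
    have tr: "r \<le> - R + t * (r + R)" "- R + t * (r + R) < R"
    proof -
      have "1 * (r + R) \<le> t * (r + R)" using t r by (intro mult_right_mono) auto
      then show "r \<le> - R + t * (r + R)" by simp
      show "- R + t * (r + R) < R" using t r by (simp add: pos_less_divide_eq)
    qed
    have move: "(- R) *\<^sub>R e + t *\<^sub>R (s *\<^sub>R e - (- R) *\<^sub>R e) = (- R + t * (s + R)) *\<^sub>R e" for s
      by (simp add: algebra_simps)
    have "u ((- R + t * (r + R)) *\<^sub>R e) \<le> u (r *\<^sub>R e)"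
      using tr r by (intro ray_antimono[OF e]) auto
    then show "(- R) *\<^sub>R e + t *\<^sub>R (r *\<^sub>R e - (- R) *\<^sub>R e) \<in> B \<and> u ((- R) *\<^sub>R e + t *\<^sub>R (r *\<^sub>R e - (- R) *\<^sub>R e)) \<le> u (r *\<^sub>R e)"
      unfolding move using tr r e by simp
    fix x :: "real ^ 'n" assume x: "x \<in> ?C0"
    define s where "s = x \<bullet> e"
    define s' where "s' = - R + t * (s + R)"
    have xs: "x = s *\<^sub>R e" using one[of x] by (simp add: s_def)
    have s: "- R < s" "s < r" using x nrm[of x] by (auto simp: s_def)
    have ss': "s \<le> s'" "s' \<le> - R + t * (r + R)"
    proof -
      have "1 * (s + R) \<le> t * (s + R)" using t s by (intro mult_right_mono) auto
      then show "s \<le> s'" by (simp add: s'_def)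
      have "t * (s + R) \<le> t * (r + R)" using t s by (intro mult_left_mono) auto
      then show "s' \<le> - R + t * (r + R)" by (simp add: s'_def)
    qed
    show "(- R) *\<^sub>R e + t *\<^sub>R (x - (- R) *\<^sub>R e) \<in> B"
      unfolding xs move s'_def[symmetric] using s ss' tr e by simp
    assume ux: "u (r *\<^sub>R e) < u x"
    show "u ((- R) *\<^sub>R e + t *\<^sub>R (r *\<^sub>R e - (- R) *\<^sub>R e)) \<le> u ((- R) *\<^sub>R e + t *\<^sub>R (x - (- R) *\<^sub>R e))"
      unfolding xs move s'_def[symmetric]
    \<comment> \<open>Points move to the right. On the decreasing side the image is compared with
      the image of \<open>r\<close>; on the increasing side moving right can only raise the value,
      which already exceeded the level.\<close>
    proof (cases "s' \<ge> 0")
      case True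
      then show "u ((- R + t * (r + R)) *\<^sub>R e) \<le> u (s' *\<^sub>R e)"
        using ss' tr by (intro ray_antimono[OF e]) auto
    next
      case False
      have "u (r *\<^sub>R e) < u (s *\<^sub>R e)" using ux xs by simp
      also have "\<dots> \<le> u (s' *\<^sub>R e)" using mono_neg[of "- s'" "- s"] False ss' s by simp
      finally show "u ((- R + t * (r + R)) *\<^sub>R e) \<le> u (s' *\<^sub>R e)"
        using \<open>u ((- R + t * (r + R)) *\<^sub>R e) \<le> u (r *\<^sub>R e)\<close> by simp
    qed
  qed (use x in auto)
qed

text \<open>A zero inside would be a minimum, hence a critical point, and \<open>crit\<close> would
  give it the value at the origin, which is positive because \<open>u\<close> decreases along rays
  and is not identically 0.\<close>

lemma pos_if_no_critical:
  assumes nonzero: "\<exists>x\<in>cball 0 R. u x \<noteq> 0"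
    and crit: "\<And>e r. norm e = 1 \<Longrightarrow> 0 < r \<Longrightarrow> r < R \<Longrightarrow> Du (r *\<^sub>R e) \<bullet> e = 0 \<Longrightarrow> u (r *\<^sub>R e) = u 0"
    and x: "x \<in> B"
  shows "u x > 0"
proof -
  have ray: "\<exists>e. norm e = 1 \<and> y = norm y *\<^sub>R e" if "y \<noteq> 0" for y :: "real ^ 'n"
    using that by (intro exI[of _ "(1 / norm y) *\<^sub>R y"]) simp
  obtain y where y: "y \<in> cball 0 R" "u y \<noteq> 0" using nonzero by auto
  have "u y > 0" using y u_nonneg[of y] by auto
  moreover have "u y \<le> u 0"
  proof (cases "y = 0")
    case False
    then obtain e where e: "norm e = 1" "y = norm y *\<^sub>R e" using ray by blast
    then show ?thesis using ray_antimono[OF e(1), of 0 "norm y"] y by auto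
  qed simp
  ultimately have u0: "u 0 > 0" by simp
  show ?thesis
  proof (rule ccontr)
    assume "\<not> u x > 0"
    then have Dx: "Du x = 0" using u_pos_if_grad_nonzero[OF x] by blast
    have "x \<noteq> 0" using \<open>\<not> u x > 0\<close> u0 by auto
    then obtain e where e: "norm e = 1" "x = norm x *\<^sub>R e" using ray by blast
    have "u (norm x *\<^sub>R e) = u 0"
      using e x \<open>x \<noteq> 0\<close> Dx by (intro crit) auto
    then show False using \<open>\<not> u x > 0\<close> u0 e(2) by simp
  qed
qed

lemma even_one_dim:
  assumes dim: "CARD('n) = 1" and nonzero: "\<exists>x\<in>cball 0 R. u x \<noteq> 0" and e: "norm e = 1" and r: "0 \<le> r" "r \<le> R"
  shows "u (r *\<^sub>R e) = u ((- r) *\<^sub>R e)"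
proof -
  have crit: "u (r *\<^sub>R e) = u 0" if "norm e = 1" "0 < r" "r < R" "Du (r *\<^sub>R e) \<bullet> e = 0" for e r
    by (rule critical_ray_point_one_dim[OF dim that])
  have pos: "u x > 0" if "x \<in> B" for x by (rule pos_if_no_critical[OF nonzero crit that])
  have prof: "profile R (u 0) (\<lambda>r. u (r *\<^sub>R e)) (\<lambda>r. Du (r *\<^sub>R e) \<bullet> e)" if e: "norm e = 1" for e
    unfolding profile_def
    using continuous_on_ray(1)[OF e] u_bdry[of "R *\<^sub>R e"] R_pos DERIV_ray[OF e] ray_antimono[OF e] pos crit[OF e] e
    by auto
  have "u (r *\<^sub>R e) = u (r *\<^sub>R (- e))"
  proof (rule profiles_eq[OF prof[OF e] prof[of "- e"] R_pos _ _ r])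
    show "norm (- e) = 1" using e by simp
    show "u 0 > 0" using pos R_pos by simp
    fix r s assume rs: "0 < r" "r < R" "0 < s" "s < R" and eq: "u (r *\<^sub>R e) = u (s *\<^sub>R - e)"
    have up: "u (r *\<^sub>R e) > 0" using pos rs e by simp
    have "Du (r *\<^sub>R e) = - Du ((- s) *\<^sub>R e)"
    \<comment> \<open>\<open>slopes_match\<close> wants the more distant point on the positive side;
      otherwise the direction is reversed and the two points exchange roles.\<close>
    proof (cases "s \<le> r")
      case True
      then show ?thesis
        using rs eq up by (intro slopes_match[OF one_dim_coordinate[OF dim e] e]) auto
    next
      case False
      have e': "norm (- e) = 1" using e by simp
      have "Du (s *\<^sub>R (- e)) = - Du ((- r) *\<^sub>R (- e))"
        using rs eq up False by (intro slopes_match[OF one_dim_coordinate[OF dim e'] e']) auto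
      then show ?thesis by simp
    qed
    then show "Du (r *\<^sub>R e) \<bullet> e = Du (s *\<^sub>R - e) \<bullet> - e" by simp
  qed
  then show ?thesis by simp
qed

lemma radial:
  assumes nonzero: "\<exists>x\<in>cball 0 R. u x \<noteq> 0" and "norm x = norm y" "x \<in> B"
  shows "u x = u y"
proof (cases "CARD('n) = 1")
  case False
  have "CARD('n) \<noteq> 0" by simp
  then have "CARD('n) \<ge> 2" using False by linarith
  from sphere_constant[OF this assms(2,3)] show ?thesis .
next
  case True
  show ?thesis
  proof (cases "x = 0")
    case x0: False
    define e where "e = (1 / norm x) *\<^sub>R x"
    have e: "norm e = 1" "x = norm x *\<^sub>R e" using x0 by (simp_all add: e_def)
    have "\<bar>y \<bullet> e\<bar> = norm x"
      using arg_cong[OF one_dim_coordinate[OF True e(1), of y], of norm] e(1) assms(2) by simp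
    then have "y \<bullet> e = norm x \<or> y \<bullet> e = - norm x" by linarith
    then have "y = norm x *\<^sub>R e \<or> y = (- norm x) *\<^sub>R e"
      using one_dim_coordinate[OF True e(1), of y] by metis
    then show ?thesis
      using even_one_dim[OF True nonzero e(1), of "norm x"] e(2) assms(3) by auto
  qed (use assms in auto)
qed

lemma critical_ray_point:
  assumes "\<exists>x\<in>cball 0 R. u x \<noteq> 0" "norm e = 1" "0 < r" "r < R" "Du (r *\<^sub>R e) \<bullet> e = 0"
  shows "u (r *\<^sub>R e) = u 0"
  by (rule critical_ray_point_radial[OF radial[OF assms(1)] assms(2-5)])

theorem minimizer_radial:
  assumes nonzero: "\<exists>x\<in>cball 0 R. u x \<noteq> 0"
  shows "(\<forall>x\<in>ball 0 R. u x > 0) \<and>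
    (\<exists>U U'. antimono_on {0..R} U \<and>
       (\<forall>r\<in>{0..R}. (U has_real_derivative U' r) (at r within {0..R})) \<and>
       continuous_on {0..R} U' \<and>
       (\<forall>x\<in>ball 0 R. u x = U (norm x)) \<and>
       (\<exists>R'. 0 \<le> R' \<and> R' < R \<and>
          (\<forall>r\<in>{R'<..<R}. U' r < 0) \<and> U constant_on {0..R'}))"
proof -
  have pos: "u x > 0" if "x \<in> B" for x
    by (rule pos_if_no_critical[OF nonzero critical_ray_point[OF nonzero] that])
  obtain e :: "real ^ 'n" where e: "norm e = 1" using vector_choose_size[of 1] by auto
  define U where "U = (\<lambda>r. u (r *\<^sub>R e))"
  define U' where "U' = (\<lambda>r. Du (r *\<^sub>R e) \<bullet> e)"
  have U_cont: "continuous_on {0..R} U" and U'_cont: "continuous_on {0..R} U'"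
    using continuous_on_ray[OF e] by (simp_all add: U_def U'_def)
  have mono: "U s \<le> U r" if "0 \<le> r" "r \<le> s" "s \<le> R" for r s
    using ray_antimono[OF e that] by (simp add: U_def)
  have deriv: "(U has_real_derivative U' r) (at r within {0..R})" if r: "r \<in> {0..R}" for r
  proof -
    \<comment> \<open>The gradient of \<open>u\<close> is known only inside the ball. Writing
      \<open>U\<close> as the integral of the continuous function \<open>U'\<close> yields the
      one-sided derivatives at 0 and \<open>R\<close>.\<close>
    have int: "U s = U 0 + integral {0..s} U'" if "s \<in> {0..R}" for s
    proof -
      have "(U' has_integral (U s - U 0)) {0..s}"
      proof (rule fundamental_theorem_of_calculus_interior)
        show "continuous_on {0..s} U" using that by (intro continuous_on_subset[OF U_cont]) auto
        show "(U has_vector_derivative U' x) (at x)" if "x \<in> {0<..<s}" for x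
          using DERIV_ray[OF e, of x] that \<open>s \<in> {0..R}\<close>
          by (auto simp: U_def U'_def simp flip: has_real_derivative_iff_has_vector_derivative)
      qed (use that in auto)
      then show ?thesis by (simp add: integral_unique)
    qed
    have "((\<lambda>s. U 0 + integral {0..s} U') has_real_derivative 0 + U' r) (at r within {0..R})"
      by (intro DERIV_add DERIV_const integral_has_real_derivative U'_cont r)
    then have "((\<lambda>s. U 0 + integral {0..s} U') has_real_derivative U' r) (at r within {0..R})" by simp
    then show ?thesis
      by (rule has_field_derivative_transform_within[OF _ zero_less_one r]) (rule int[symmetric])
  qed
  have uU: "u x = U (norm x)" if "x \<in> B" for x
    unfolding U_def using that e by (intro radial[OF nonzero]) auto
  \<comment> \<open>\<open>R'\<close> will be the last radius at which the maximum is attained.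
    Closedness of \<open>S\<close> puts its supremum into \<open>S\<close>, and beyond it
    \<open>critical_ray_point\<close> forbids a vanishing slope.\<close>
  define S where "S = {r \<in> {0..R}. U r = U 0}"
  have U0: "U 0 > 0" "U R = 0" using pos[of 0] R_pos u_bdry[of "R *\<^sub>R e"] e by (simp_all add: U_def)
  have "closed S"
    unfolding S_def using continuous_closed_preimage_constant[OF U_cont] by simp
  moreover have "S \<noteq> {}" "bdd_above S" using R_pos by (auto simp: S_def intro!: exI[of _ 0] bdd_aboveI[of _ R])
  ultimately have "Sup S \<in> S" using closed_contains_Sup by blast
  define R' where "R' = Sup S"
  have R': "0 \<le> R'" "R' \<le> R" "U R' = U 0" using \<open>Sup S \<in> S\<close> by (auto simp: R'_def S_def)
  have "R' \<noteq> R" using R' U0 by auto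
  have "U' r < 0" if r: "R' < r" "r < R" for r
  proof -
    have "r \<notin> S" using r cSup_upper[OF _ \<open>bdd_above S\<close>, of r] by (auto simp: R'_def)
    then have "u (r *\<^sub>R e) \<noteq> u 0" using r R' by (auto simp: S_def U_def)
    then have "U' r \<noteq> 0" using critical_ray_point[OF nonzero e, of r] r R' by (auto simp: U'_def)
    moreover have "U' r \<le> 0" using ray_slope_nonpos[OF e, of r] r R' by (simp add: U'_def)
    ultimately show ?thesis by simp
  qed
  moreover have "U constant_on {0..R'}"
    unfolding constant_on_def
  proof (intro exI ballI)
    fix r assume "r \<in> {0..R'}"
    then show "U r = U 0" using mono[of 0 r] mono[of r R'] R' by auto
  qed
  moreover have "antimono_on {0..R} U"
    using mono by (auto intro!: monotone_onI)
  ultimately show ?thesis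
    using pos deriv U'_cont uU R' \<open>R' \<noteq> R\<close>
    by (intro conjI exI[of _ U] exI[of _ U'] exI[of _ R'] ballI) auto
qed

end

theorem theorem4p2:
  fixes g f :: "real \<Rightarrow> real" and R :: real and u :: "real ^ 'n \<Rightarrow> real"
  assumes "R > 0"
    and "continuous_on {0..} g" and "g C1_differentiable_on {0<..}"
    and "g 0 = 0" and "strict_mono_on {0..} g"
    and "continuous_on {0..} f"
    and "u \<in> C1_closure (ball 0 R)"
    and "\<forall>x\<in>cball 0 R. u x \<ge> 0" and "\<exists>x\<in>cball 0 R. u x \<noteq> 0"
    and "weak_solution g f (ball 0 R) u"
    and "\<forall>x\<in>frontier (ball 0 R). u x = 0"
    and "global_minimizer g f (ball 0 R) u"
  shows "(\<forall>x\<in>ball 0 R. u x > 0) \<and>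
    (\<exists>U U'. antimono_on {0..R} U \<and>
       (\<forall>r\<in>{0..R}. (U has_real_derivative U' r) (at r within {0..R})) \<and>
       continuous_on {0..R} U' \<and>
       (\<forall>x\<in>ball 0 R. u x = U (norm x)) \<and>
       (\<exists>R'. 0 \<le> R' \<and> R' < R \<and>
          (\<forall>r\<in>{R'<..<R}. U' r < 0) \<and> U constant_on {0..R'}))"
proof -
  have cl: "closure (ball (0 :: real ^ 'n) R) = cball 0 R" using assms(1) by (simp add: closure_ball)
  have fr: "frontier (ball (0 :: real ^ 'n) R) = sphere 0 R" using assms(1) by (simp add: frontier_ball)
  obtain Du where Du: "continuous_on (cball 0 R) Du" "\<And>x. x \<in> ball 0 R \<Longrightarrow> GDERIV u x :> Du x"
    and u: "continuous_on (cball 0 R) u"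
    using assms(7) unfolding C1_closure_def cl by auto
  \<comment> \<open>On the open ball \<open>grad\<close> returns any given gradient, so minimality
    of \<open>J_functional\<close> takes the form assumed in the locale.\<close>
  have J: "J_functional g f (ball 0 R) v = (LINT x:ball 0 R|lborel. primitive g (norm (Dv x)) - primitive f (v x))"
    if "\<And>x. x \<in> ball 0 R \<Longrightarrow> GDERIV v x :> Dv x" for v and Dv :: "real ^ 'n \<Rightarrow> real ^ 'n"
    unfolding J_functional_def
    by (rule set_lebesgue_integral_cong) (simp_all add: grad_eqI[OF that])
  interpret ball_minimizer g f R u Du
  proof
    fix v :: "real ^ 'n \<Rightarrow> real" and Dv :: "real ^ 'n \<Rightarrow> real ^ 'n"
    assume v: "continuous_on (cball 0 R) v" "continuous_on (cball 0 R) Dv"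
      "\<And>x. x \<in> ball 0 R \<Longrightarrow> GDERIV v x :> Dv x" "\<And>x. x \<in> ball 0 R \<Longrightarrow> 0 \<le> v x" "\<And>x. norm x = R \<Longrightarrow> v x = 0"
    have "v \<in> X_space (ball 0 R)"
      using v by (auto simp: X_space_def C1_closure_def cl fr)
    then have "J_functional g f (ball 0 R) u \<le> J_functional g f (ball 0 R) v"
      using assms(12) v(4) by (auto simp: global_minimizer_def)
    then show "(LINT x:ball 0 R|lborel. primitive g (norm (Du x)) - primitive f (u x))
        \<le> (LINT x:ball 0 R|lborel. primitive g (norm (Dv x)) - primitive f (v x))"
      using J[OF Du(2)] J[OF v(3)] by simp
  qed (use assms u Du fr in auto)
  show ?thesis by (rule minimizer_radial[OF assms(9)])
qed

end
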